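(* Let $M$ be a connected manifold with boundary $\partial M$. Then the following hold. (a) If $\partial M$ is compact, then $\partial M$ is strongly collared in $M$. (b) If $\partial M$ is Lindelöf, then $\partial M$ is collared in $M$. (c) If $M-\partial M$ is metrisable and $\partial M$ is collared in $M$, then $\partial M$ is Lindelöf. (d) If $M$ is normal and $\partial M$ is countably metacompact (in particular, metrisable or Lindelöf) and collared in $M$, then $\partial M$ is strongly collared in $M$. (e) If $M-\partial M$ is metrisable, then the following are equivalent: $\partial M$ is collared in $M$; $\partial M$ is strongly collared in $M$; $M$ is metrisable.
   Context: Manifolds are NOT assumed metrisable, second countable, paracompact, or (unless stated) connected. A manifold (of dimension $n\ge 1$, $n$ fixed) is a Hausdorff space each of whose points has a neighborhood homeomorphic to $\mathbb{R}^{n-1}\times\mathbb{R}_{\ge 0}$. The boundary $\partial M$ is the set of points that do not have a neighborhood homeomorphic to $\mathbb{R}^n$; it is a closed subset of $M$ and is itself an $(n-1)$-manifold without boundary (not necessarily connected). It carries the subspace topology. Let $B$ be a closed subset of a space $X$. $B$ is locally collared in $X$ if there is a cover $\mathcal{U}$ of $B$ by subsets of $B$ that are open in $B$ and, for each $U\in\mathcal{U}$, an embedding (homeomorphism onto its image) $h:\overline{U}\times[0,1]\to X$ with $h(x,0)=x$ for $x\in\overline{U}$, such that $h^{-1}(B)=\overline{U}\times\{0\}$ and the image of $U\times[0,1)$ is open in $X$. If the embeddings are closed, $B$ is locally strongly collared in $X$. If $\mathcal{U}=\{B\}$, then $B$ is collared in $X$ (strongly collared, if the embedding is closed). Explicitly,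 $B$ is collared in $X$ if there is an embedding $h:B\times[0,1]\to X$ with $h(x,0)=x$ for all $x\in B$, $h^{-1}(B)=B\times\{0\}$, and $h(B\times[0,1))$ open in $X$; it is strongly collared if moreover $h$ can be chosen to be a closed embedding. A space is countably metacompact if any countable open cover has a point-finite open refinement. Normal spaces are by convention Hausdorff. *)

theory Defs
  imports "HOL-Analysis.Analysis"
begin

text \<open>A neighbourhood of a point need not be open. This matters for manifolds: an interior point
  has a neighbourhood homeomorphic to the closed half-space, but no open one.\<close>

definition nbhd :: "'a topology \<Rightarrow> 'a \<Rightarrow> 'a set \<Rightarrow> bool"
  where "nbhd X x N \<longleftrightarrow> N \<subseteq> topspace X \<and> x \<in> X interior_of N"

definition half_space :: "nat \<Rightarrow> ((nat \<Rightarrow> real) \<times> real) topology"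
  where "half_space n = prod_topology (Euclidean_space (n - 1)) (top_of_set {0..})"

text \<open>The dimension \<^term>\<open>n\<close> is meant to be at least 1. No countability, metrisability or
  connectedness assumption is made.\<close>

definition manifold :: "nat \<Rightarrow> 'a topology \<Rightarrow> bool"
  where "manifold n M \<longleftrightarrow> Hausdorff_space M \<and>
    (\<forall>x\<in>topspace M. \<exists>N. nbhd M x N \<and> subtopology M N homeomorphic_space half_space n)"

definition boundary :: "nat \<Rightarrow> 'a topology \<Rightarrow> 'a set"
  where "boundary n M = {x \<in> topspace M.
    \<not> (\<exists>N. nbhd M x N \<and> subtopology M N homeomorphic_space Euclidean_space n)}"

definition collaring :: "'a topology \<Rightarrow> 'a set \<Rightarrow> ('a \<times> real \<Rightarrow> 'a) \<Rightarrow> bool"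
  where "collaring X B h \<longleftrightarrow>
    embedding_map (prod_topology (subtopology X B) (top_of_set {0..1})) X h \<and>
    (\<forall>x\<in>B. h (x, 0) = x) \<and>
    {p \<in> B \<times> {0..1}. h p \<in> B} = B \<times> {0} \<and>
    openin X (h ` (B \<times> {0..<1}))"

text \<open>Both notions are intended for \<^term>\<open>B\<close> closed in \<^term>\<open>X\<close>.\<close>

definition collared :: "'a topology \<Rightarrow> 'a set \<Rightarrow> bool"
  where "collared X B \<longleftrightarrow> (\<exists>h. collaring X B h)"

definition strongly_collared :: "'a topology \<Rightarrow> 'a set \<Rightarrow> bool"
  where "strongly_collared X B \<longleftrightarrow> (\<exists>h. collaring X B h \<and>
    closed_map (prod_topology (subtopology X B) (top_of_set {0..1})) X h)"

definition countably_metacompact_space :: "'a topology \<Rightarrow> bool"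
  where "countably_metacompact_space X \<longleftrightarrow>
    (\<forall>\<U>. countable \<U> \<and> (\<forall>U\<in>\<U>. openin X U) \<and> \<Union>\<U> = topspace X \<longrightarrow>
      (\<exists>\<V>. (\<forall>V\<in>\<V>. openin X V \<and> (\<exists>U\<in>\<U>. V \<subseteq> U)) \<and> \<Union>\<V> = topspace X \<and>
           (\<forall>x\<in>topspace X. finite {V\<in>\<V>. x \<in> V})))"

end

theory Submission
  imports Defs "HOL-Homology.Invariance_of_Domain"
begin

text \<open>The heart of the matter is that a locally collarable closed Lindelof subset \<open>B\<close> of a locally
  compact Hausdorff space is collared. No external collar is attached. Given a collar of variable
  height \<open>f\<close> and a local collar over a compact \<open>K\<close>, one pushes the whole space inwards along the local
  collar by an amount \<open>u\<close> supported in \<open>K\<close>, carries the given collar along, and fills the freed strip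
  with the local collar; this yields a collar of height \<open>f + u\<close>. Running through an exhaustion of \<open>B\<close>
  by compact sets, with the later local collars chosen too short to meet the finished part, the
  heights and collars become locally constant, and the limit has positive height everywhere.

  Invariance of domain identifies the boundary of a manifold with the bottom of each chart, so it is
  locally collarable. If the boundary is collared, the interior is connected; a connected locally
  compact metrizable space is Lindelof, so a metrizable interior is second countable, and so are the
  boundary, which embeds in the interior at level \<open>1/2\<close>, and the whole manifold. For strong collars
  in normal spaces one lowers the collar below a continuous function that keeps it inside a
  neighbourhood whose closure lies in the open collar.\<close>

section \<open>Metrizability and covering properties\<close>

text \<open>The obstacle is that \<open>M\<close> need not be normal or paracompact, so functions on
  the boundary cannot in general be extended and locally finite families of bumps are not at hand.
  In the collaring construction every height and every push is therefore a function on all of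
  \<open>M\<close>. The bumps come from complete regularity of locally compact Hausdorff spaces, and
  one push moves only points of a compact set. The bound 1/2 on a push keeps the slope
  \<open>1 - u\<close> of the affine maps on the fibres away from 0. Countability is what allows the
  pushes to be ordered in a sequence. For the interior, connectedness supplies it: a locally compact
  metrizable space is in general only a topological sum of Lindelof pieces. For strong collars there
  may be no uniform height up to which the fibres stay in a given neighbourhood of the boundary.
  Countable metacompactness, together with normality, replaces the missing constant by a positive
  continuous function.\<close>

text \<open>This is Urysohn's metrization theorem: Urysohn functions for countably many pairs of
  base sets embed the space in a countable power of the line. Normality is available because a
  second countable space is Lindelof and a regular Lindelof space is normal.\<close>

lemma second_countable_regular_imp_metrizable:
  assumes reg: "regular_space X" and haus: "Hausdorff_space X" and sc: "second_countable X"
  shows "metrizable_space X"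
proof -
  obtain \<B> where \<B>: "countable \<B>" "\<And>V. V \<in> \<B> \<Longrightarrow> openin X V"
    and base: "\<And>U x. openin X U \<Longrightarrow> x \<in> U \<Longrightarrow> \<exists>V\<in>\<B>. x \<in> V \<and> V \<subseteq> U"
    using sc unfolding second_countable_def by metis
  have norm: "normal_space X"
    using reg sc regular_Lindelof_imp_normal_space second_countable_imp_Lindelof_space by blast
  define P where "P = {(U,V). U \<in> \<B> \<and> V \<in> \<B> \<and> X closure_of U \<subseteq> V}"
  have "countable P"
    by (rule countable_subset[of _ "\<B> \<times> \<B>"]) (auto simp: P_def \<B>)
  have "\<exists>f. continuous_map X euclideanreal f \<and> f ` (X closure_of U) \<subseteq> {0} \<and> f ` (topspace X - V) \<subseteq> {1}"
    if "(U,V) \<in> P" for U V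
  proof -
    have "closedin X (topspace X - V)" "disjnt (X closure_of U) (topspace X - V)"
      using that \<B> by (auto simp: P_def disjnt_def)
    then show ?thesis
      using norm closedin_closure_of[of X U] unfolding normal_space_iff_Urysohn_alt by blast
  qed
  then have "\<exists>f. continuous_map X euclideanreal f \<and> f ` (X closure_of (fst p)) \<subseteq> {0} \<and> f ` (topspace X - snd p) \<subseteq> {1}"
    if "p \<in> P" for p
    using that by (cases p) auto
  then obtain f where f: "\<And>p. p \<in> P \<Longrightarrow> continuous_map X euclideanreal (f p)"
      "\<And>p. p \<in> P \<Longrightarrow> f p ` (X closure_of (fst p)) \<subseteq> {0}" "\<And>p. p \<in> P \<Longrightarrow> f p ` (topspace X - snd p) \<subseteq> {1::real}"
    by metis
  define E where "E x = (\<lambda>p\<in>P. f p x)" for x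
  let ?Y = "product_topology (\<lambda>p. euclideanreal) P"
  \<comment> \<open>Regularity places a base set around \<open>x\<close> whose closure lies in a
    base set inside \<open>W\<close>, so a single coordinate, belonging to a pair in
    \<open>P\<close>, separates \<open>x\<close> from everything outside \<open>W\<close>.\<close>
  have sep: "\<exists>p\<in>P. f p x = 0 \<and> (\<forall>y \<in> topspace X - W. f p y = 1)" if W: "openin X W" "x \<in> W" for x W
  proof -
    obtain V where V: "V \<in> \<B>" "x \<in> V" "V \<subseteq> W" using base[OF W] by blast
    have "\<exists>U'. openin X U' \<and> x \<in> U' \<and> X closure_of U' \<subseteq> V"
    proof -
      have "closedin X (topspace X - V)" "x \<in> topspace X - (topspace X - V)"
        using V \<B> openin_subset by fastforce+
      then obtain U' where *: "openin X U'" "x \<in> U'" "disjnt (topspace X - V) (X closure_of U')"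
        using reg unfolding regular_space by metis
      moreover have "X closure_of U' \<subseteq> topspace X" by (rule closure_of_subset_topspace)
      ultimately show ?thesis by (intro exI[of _ U']) (auto simp: disjnt_iff)
    qed
    then obtain U' where U': "openin X U'" "x \<in> U'" "X closure_of U' \<subseteq> V" by blast
    obtain U where U: "U \<in> \<B>" "x \<in> U" "U \<subseteq> U'" using base[OF U'(1,2)] by blast
    have "(U,V) \<in> P"
      using U V U' closure_of_mono by (fastforce simp: P_def)
    moreover have "x \<in> X closure_of U"
      using U \<B> by (meson closure_of_subset openin_subset subsetD)
    ultimately show ?thesis
      using f(2,3)[of "(U,V)"] V by (intro bexI[of _ "(U,V)"]) auto
  qed
  have cont: "continuous_map X ?Y E"
    unfolding E_def continuous_map_componentwise
  proof (intro conjI ballI)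
    fix p assume "p \<in> P"
    then show "continuous_map X euclideanreal (\<lambda>x. (\<lambda>p\<in>P. f p x) p)" using f(1) by simp
  qed auto
  have inj: "inj_on E (topspace X)"
  proof (rule inj_onI, rule ccontr)
    fix x y assume xy: "x \<in> topspace X" "y \<in> topspace X" "E x = E y" "x \<noteq> y"
    then obtain W where "openin X W" "x \<in> W" "y \<notin> W"
      using haus unfolding Hausdorff_space_def disjnt_def by blast
    then obtain p where "p \<in> P" "f p x = 0" "f p y = 1" using sep xy by blast
    then show False using xy(3) by (metis E_def restrict_apply' zero_neq_one)
  qed
  have "open_map X (subtopology ?Y (E ` topspace X)) E"
    unfolding open_map_def
  proof (intro allI impI)
    fix W assume W: "openin X W"
    show "openin (subtopology ?Y (E ` topspace X)) (E ` W)"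
    proof (subst openin_subopen, intro ballI)
      fix e assume "e \<in> E ` W"
      then obtain x where x: "x \<in> W" "e = E x" by auto
      then obtain p where p: "p \<in> P" "f p x = 0" "\<forall>y \<in> topspace X - W. f p y = 1" using sep W by blast
      have xX: "x \<in> topspace X" using W x openin_subset by blast
      \<comment> \<open>The slab where coordinate \<open>p\<close> is below 1 cuts the image of
        \<open>E\<close> inside the image of \<open>W\<close>, because \<open>f p\<close> equals 1
        outside \<open>W\<close>.\<close>
      let ?T = "{g \<in> topspace ?Y. g p \<in> {..<1}}"
      have o: "openin ?Y ?T"
        by (rule openin_continuous_map_preimage[OF continuous_map_product_projection[OF p(1)]]) auto
      show "\<exists>T. openin (subtopology ?Y (E ` topspace X)) T \<and> e \<in> T \<and> T \<subseteq> E ` W"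
      proof (intro exI conjI)
        show "openin (subtopology ?Y (E ` topspace X)) (?T \<inter> E ` topspace X)"
          using o openin_subtopology by blast
        show "e \<in> ?T \<inter> E ` topspace X" using x xX p by (auto simp: E_def)
        show "?T \<inter> E ` topspace X \<subseteq> E ` W"
        proof
          fix g assume "g \<in> ?T \<inter> E ` topspace X"
          then obtain y where y: "y \<in> topspace X" "g = E y" "g p < 1" by auto
          then have "y \<in> W" using p by (force simp: E_def)
          then show "g \<in> E ` W" using y by blast
        qed
      qed
    qed
  qed
  moreover have "continuous_map X (subtopology ?Y (E ` topspace X)) E"
    using cont by (simp add: continuous_map_in_subtopology)
  moreover have sur: "E ` topspace X = topspace (subtopology ?Y (E ` topspace X))"
    using continuous_map_image_subset_topspace[OF cont] by auto
  ultimately have "homeomorphic_map X (subtopology ?Y (E ` topspace X)) E"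
    using inj bijective_open_imp_homeomorphic_map by blast
  moreover have "metrizable_space ?Y"
    unfolding metrizable_space_product_topology
    using \<open>countable P\<close> metrizable_space_euclidean by (auto intro: countable_subset[of _ P])
  ultimately show ?thesis
    by (metis homeomorphic_map_imp_homeomorphic_space homeomorphic_metrizable_space metrizable_space_subtopology)
qed

text \<open>Base sets of an open subspace are open in \<open>X\<close>, so the bases of countably
  many open pieces unite to a base of \<open>X\<close>. For manifolds this upgrades Lindelof to
  second countable.\<close>

lemma Lindelof_locally_second_countable_imp_second_countable:
  assumes "Lindelof_space X"
    and loc: "\<And>x. x \<in> topspace X \<Longrightarrow> \<exists>U. openin X U \<and> x \<in> U \<and> second_countable (subtopology X U)"
  shows "second_countable X"
proof -
  let ?\<U> = "{U. openin X U \<and> second_countable (subtopology X U)}"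
  have "\<Union>?\<U> = topspace X"
    using loc openin_subset by fast
  then have "\<exists>\<V>. countable \<V> \<and> \<V> \<subseteq> ?\<U> \<and> \<Union>\<V> = topspace X"
    by (intro Lindelof_spaceD[OF assms(1)]) auto
  then obtain \<V> where \<V>: "countable \<V>" "\<V> \<subseteq> ?\<U>" "\<Union>\<V> = topspace X"
    by metis
  have *: "\<exists>\<B>. countable \<B> \<and> (\<forall>V\<in>\<B>. openin X V) \<and> (\<forall>W x. openin X W \<and> x \<in> W \<and> x \<in> U \<longrightarrow> (\<exists>V\<in>\<B>. x \<in> V \<and> V \<subseteq> W))"
    if "U \<in> \<V>" for U
  proof -
    have U: "openin X U" "second_countable (subtopology X U)" using that \<V> by auto
    then obtain \<B> where \<B>: "countable \<B>" "\<forall>V\<in>\<B>. openin (subtopology X U) V"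
       "\<forall>W x. openin (subtopology X U) W \<and> x \<in> W \<longrightarrow> (\<exists>V\<in>\<B>. x \<in> V \<and> V \<subseteq> W)"
      unfolding second_countable_def by blast
    show ?thesis
    proof (intro exI[of _ \<B>] conjI allI impI)
      show "\<forall>V\<in>\<B>. openin X V" using \<B>(2) U(1) openin_open_subtopology by blast
      fix W x assume W: "openin X W \<and> x \<in> W \<and> x \<in> U"
      then have "openin (subtopology X U) (W \<inter> U) \<and> x \<in> W \<inter> U" by (auto simp: openin_subtopology)
      from \<B>(3)[rule_format, OF this] show "\<exists>V\<in>\<B>. x \<in> V \<and> V \<subseteq> W" by auto
    qed (fact \<B>(1))
  qed
  then obtain \<B> where \<B>: "\<forall>U\<in>\<V>. countable (\<B> U) \<and> (\<forall>V\<in>\<B> U. openin X V) \<and>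
      (\<forall>W x. openin X W \<and> x \<in> W \<and> x \<in> U \<longrightarrow> (\<exists>V\<in>\<B> U. x \<in> V \<and> V \<subseteq> W))"
    using bchoice[OF ballI, OF *] by metis
  show ?thesis
    unfolding second_countable_def
  proof (intro exI[of _ "\<Union>(\<B> ` \<V>)"] conjI allI impI)
    show "countable (\<Union> (\<B> ` \<V>))" using \<V>(1) \<B> by simp
    fix W x assume W: "openin X W \<and> x \<in> W"
    then obtain U where "U \<in> \<V>" "x \<in> U" using \<V>(3) openin_subset by blast
    then obtain V where "V \<in> \<B> U" "x \<in> V" "V \<subseteq> W" using \<B> W by metis
    then show "\<exists>V\<in>\<Union>(\<B> ` \<V>). x \<in> V \<and> V \<subseteq> W" using \<open>U \<in> \<V>\<close> by blast
  qed (use \<B> in simp)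
qed

section \<open>Coverings of metric and of locally compact spaces\<close>

text \<open>\<open>R x\<close> is the supremum of the radii up to 1 of compact closed balls around
  \<open>x\<close>, and it is 1-Lipschitz. Enlarging a compact set by half of \<open>R\<close> stays
  within a compact set, while the union of all iterated enlargements of a point is open and closed.
  Connectedness makes this sigma-compact set the whole space.\<close>

lemma (in Metric_space) locally_compact_connected_imp_Lindelof:
  assumes lc: "locally_compact_space mtopology" and conn: "connected_space mtopology"
  shows "Lindelof_space mtopology"
proof (cases "M = {}")
  case True
  then show ?thesis by (metis Lindelof_space_topspace_empty topspace_mtopology)
next
  case False
  then obtain x0 where x0: "x0 \<in> M" by blast
  \<comment> \<open>The cap at 1 keeps \<open>S x\<close> bounded even if all closed balls are
    compact, so that its supremum is meaningful.\<close>
  define S where "S x = {r. 0 < r \<and> r \<le> 1 \<and> compactin mtopology (mcball x r)}" for x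
  define R where "R x = Sup (S x)" for x
  have bdd: "bdd_above (S x)" for x by (auto simp: S_def)
  have down: "s \<in> S x" if "r \<in> S y" "s + d x y \<le> r" "0 < s" "x \<in> M" "y \<in> M" for r s x y
  proof -
    have "mcball x s \<subseteq> mcball y r"
    proof
      fix z assume "z \<in> mcball x s"
      then show "z \<in> mcball y r" using triangle[of y x z] that by (auto simp: commute)
    qed
    then have "compactin mtopology (mcball x s)"
      using that closed_compactin[of mtopology "mcball y r"] by (auto simp: S_def)
    moreover have "r \<le> 1" using that by (simp add: S_def)
    then have "s \<le> 1" using that(2) nonneg[of x y] by linarith
    ultimately show ?thesis using that by (simp add: S_def)
  qed
  have ne: "S x \<noteq> {}" if x: "x \<in> M" for x
  proof -
    obtain U K where UK: "openin mtopology U" "compactin mtopology K" "x \<in> U" "U \<subseteq> K"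
      using lc x unfolding locally_compact_space_def by auto
    then obtain r where r: "r > 0" "mball x r \<subseteq> U" by (meson openin_mtopology)
    have "mcball x (min 1 (r/2)) \<subseteq> K" using r UK by (force simp: mcball_def mball_def)
    then have "compactin mtopology (mcball x (min 1 (r/2)))" using UK closed_compactin by blast
    then have "min 1 (r/2) \<in> S x" using r by (auto simp: S_def)
    then show ?thesis by blast
  qed
  have Rpos: "R x > 0" if "x \<in> M" for x
  proof -
    obtain r where r: "r \<in> S x" using ne[OF \<open>x \<in> M\<close>] by blast
    then show ?thesis unfolding R_def using cSup_upper[OF r bdd] by (auto simp: S_def)
  qed
  have cpt: "compactin mtopology (mcball x s)" if x: "x \<in> M" "s < R x" "0 < s" for x s
  proof -
    obtain r where "r \<in> S x" "s < r" using x ne[OF x(1)] bdd[of x] unfolding R_def by (meson less_cSup_iff)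
    then have "s \<in> S x" using down[of r x s x] x by auto
    then show ?thesis by (simp add: S_def)
  qed
  have lip: "R x \<le> R y + d x y" if "x \<in> M" "y \<in> M" for x y
  proof -
    have "r \<le> R y + d x y" if r: "r \<in> S x" for r
    proof (cases "r \<le> d x y")
      case True then show ?thesis using Rpos \<open>y \<in> M\<close> by force
    next
      case False
      then have "r - d x y \<in> S y" using down[OF r, of "r - d x y" y] \<open>x \<in> M\<close> \<open>y \<in> M\<close> by (auto simp: commute)
      then have "r - d x y \<le> R y" unfolding R_def using bdd cSup_upper by blast
      then show ?thesis by simp
    qed
    then show ?thesis unfolding R_def[of x] using ne[OF \<open>x \<in> M\<close>] by (intro cSup_least) auto
  qed
  define N where "N K = {y \<in> M. \<exists>x\<in>K. d x y \<le> R x / 2}" for K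
  have step: "\<exists>K'. compactin mtopology K' \<and> N K \<subseteq> K'" if K: "compactin mtopology K" for K
  proof -
    have KM: "K \<subseteq> M" using K compactin_subset_topspace by fastforce
    have "K \<subseteq> (\<Union>x\<in>K. mball x (R x / 4))"
      using KM Rpos by force
    moreover have "\<forall>U \<in> (\<lambda>x. mball x (R x / 4)) ` K. openin mtopology U" by auto
    ultimately have "\<exists>\<F>. finite \<F> \<and> \<F> \<subseteq> (\<lambda>x. mball x (R x / 4)) ` K \<and> K \<subseteq> \<Union>\<F>"
      by (rule K[unfolded compactin_def, THEN conjunct2, rule_format, OF conjI, rotated])
    then obtain \<F> where \<F>: "finite \<F>" "\<F> \<subseteq> (\<lambda>x. mball x (R x / 4)) ` K" "K \<subseteq> \<Union>\<F>"
      by blast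
    obtain F where F: "finite F" "F \<subseteq> K" "K \<subseteq> (\<Union>x\<in>F. mball x (R x / 4))"
      using finite_subset_image[OF \<F>(1,2)] \<F>(3) by auto
    \<comment> \<open>The factor 7/8 is 1/4 + (1 + 1/4)/2: \<open>x\<close> is within
      \<open>R z / 4\<close> of the centre \<open>z\<close>, hence \<open>R x\<close> is at most 5/4
      of \<open>R z\<close>, and \<open>y\<close> is within \<open>R x / 2\<close> of
      \<open>x\<close>. Being below 1, the factor keeps the balls compact.\<close>
    let ?K = "\<Union>x\<in>F. mcball x (7/8 * R x)"
    have "compactin mtopology ?K"
      using F KM Rpos cpt by (intro compactin_Union) (auto simp: subset_iff)
    moreover have "N K \<subseteq> ?K"
    proof
      fix y assume "y \<in> N K"
      then obtain x where x: "y \<in> M" "x \<in> K" "d x y \<le> R x / 2" by (auto simp: N_def)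
      then obtain z where z: "z \<in> F" "x \<in> mball z (R z / 4)" using F by blast
      then have M: "z \<in> M" "x \<in> M" "d z x < R z / 4" by auto
      have "d z y \<le> 7/8 * R z"
        using triangle[of z x y] lip[of x z] M x commute[of x z] by auto
      then show "y \<in> ?K" using z x M by auto
    qed
    ultimately show ?thesis by blast
  qed
  have "\<exists>C. (compactin mtopology (C 0) \<and> x0 \<in> C 0) \<and> (\<forall>n. compactin mtopology (C (Suc n)) \<and> N (C n) \<subseteq> C (Suc n))"
  proof -
    \<comment> \<open>Dependent choice expresses the starting condition only through the invariant,
      hence the clause for \<open>n = 0\<close>.\<close>
    have "\<exists>C. \<forall>n::nat. (compactin mtopology (C n) \<and> (n = 0 \<longrightarrow> x0 \<in> C n)) \<and> N (C n) \<subseteq> C (Suc n)"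
    proof (rule dependent_nat_choice)
      show "\<exists>x. compactin mtopology x \<and> (0 = (0::nat) \<longrightarrow> x0 \<in> x)" using x0 by (intro exI[of _ "{x0}"]) auto
    qed (use step in auto)
    then show ?thesis by blast
  qed
  then obtain C where C: "compactin mtopology (C n)" "x0 \<in> C 0" "N (C n) \<subseteq> C (Suc n)" for n
    by (metis not0_implies_Suc)
  let ?U = "\<Union>(range C)"
  have UM: "?U \<subseteq> M" using C compactin_subset_topspace by fastforce
  have op: "openin mtopology ?U"
    unfolding openin_mtopology
  proof (intro conjI UM allI impI)
    fix x assume "x \<in> ?U"
    then obtain n where n: "x \<in> C n" by blast
    then have xM: "x \<in> M" using UM by blast
    have "mball x (R x / 2) \<subseteq> N (C n)" using n by (auto simp: N_def intro!: bexI[of _ x])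
    then show "\<exists>r>0. mball x r \<subseteq> ?U" using Rpos[OF xM] C(3)[of n] by (intro exI[of _ "R x / 2"]) auto
  qed
  have "closedin mtopology ?U"
    unfolding closedin_metric
  proof (intro conjI UM allI impI)
    fix y assume y: "y \<in> M - ?U"
    have "disjnt ?U (mball y (R y / 4))"
    proof (rule ccontr)
      assume "\<not> ?thesis"
      then obtain x n where x: "x \<in> C n" "y \<in> M" "x \<in> M" "d y x < R y / 4" by (auto simp: disjnt_iff)
      \<comment> \<open>By the Lipschitz property \<open>R x\<close> is at least 3/4 of
        \<open>R y\<close>, so \<open>R x / 2\<close> exceeds \<open>R y / 4\<close>: a point this
        close to the union is caught by the next enlargement.\<close>
      then have "d x y \<le> R x / 2" using lip[OF x(2,3)] nonneg[of y x] commute[of x y] by linarith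
      then have "y \<in> N (C n)" using x by (auto simp: N_def intro!: bexI[of _ x])
      then show False using C y by blast
    qed
    then show "\<exists>r>0. disjnt ?U (mball y r)" using Rpos y by (intro exI[of _ "R y / 4"]) auto
  qed
  then have "?U = M"
    using conn op C(2) unfolding connected_space_clopen_in by auto
  moreover have "Lindelof_space (subtopology mtopology (\<Union>(range C)))"
    by (intro Lindelof_space_Union) (auto intro!: compact_imp_Lindelof_space compact_space_subtopology C)
  ultimately show ?thesis by (metis subtopology_topspace topspace_mtopology)
qed

lemma metrizable_locally_compact_connected_imp_Lindelof:
  assumes "metrizable_space X" "locally_compact_space X" "connected_space X"
  shows "Lindelof_space X"
  using assms Metric_space.locally_compact_connected_imp_Lindelof unfolding metrizable_space_def by blast

text \<open>Shrink \<open>U i\<close> to the part within \<open>1 / (i + 1)\<close> of the closed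
  set \<open>F i\<close> that the earlier members leave uncovered. A ball around \<open>x\<close>
  inside \<open>U k\<close> has no points of \<open>F i\<close> for \<open>i > k\<close>, so
  \<open>x\<close> drops out of \<open>V i\<close> for these \<open>i\<close> once
  \<open>1 / (i + 1)\<close> is below the radius.\<close>

lemma metrizable_imp_countably_metacompact:
  assumes "metrizable_space X"
  shows "countably_metacompact_space X"
proof -
  obtain M d where "Metric_space M d" and X: "X = Metric_space.mtopology M d"
    using assms unfolding metrizable_space_def by blast
  then interpret Metric_space M d by simp
  show ?thesis
    unfolding countably_metacompact_space_def X
  proof (intro allI impI, elim conjE)
    fix \<U> assume cU: "countable \<U>" and oU: "\<forall>U\<in>\<U>. openin mtopology U" and UU: "\<Union>\<U> = topspace mtopology"
    show "\<exists>\<V>. (\<forall>V\<in>\<V>. openin mtopology V \<and> (\<exists>U\<in>\<U>. V \<subseteq> U)) \<and> \<Union>\<V> = topspace mtopology \<and>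
           (\<forall>x\<in>topspace mtopology. finite {V\<in>\<V>. x \<in> V})"
    proof (cases "\<U> = {}")
      case True
      then show ?thesis using UU by (intro exI[of _ "{}"]) (metis Union_empty empty_iff)
    next
      case False
      then obtain U :: "nat \<Rightarrow> 'a set" where U: "range U = \<U>"
        using cU by (metis range_from_nat_into)
      have Uo: "openin mtopology (U i)" for i using oU U by blast
      have UM: "(\<Union>i. U i) = M" using UU U by simp
      define F where "F i = M - (\<Union>j<i. U j)" for i
      define G where "G i = (\<Union>x\<in>F i. mball x (inverse (Suc i)))" for i
      have Go: "openin mtopology (G i)" for i by (auto simp: G_def)
      have FG: "F i \<subseteq> G i" for i by (force simp: F_def G_def)
      define V where "V i = U i \<inter> G i" for i
      have fin: "finite {W \<in> range V. x \<in> W}" if x: "x \<in> M" for x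
      proof -
        obtain k where k: "x \<in> U k" using x UM by blast
        then obtain r where r: "r > 0" "mball x r \<subseteq> U k" using Uo openin_mtopology by metis
        obtain N where N: "inverse (real (Suc N)) < r" using reals_Archimedean[OF r(1)] by blast
        have "x \<notin> V i" if i: "i > k" "i \<ge> N" for i
        proof
          assume "x \<in> V i"
          then obtain y where y: "y \<in> F i" "x \<in> mball y (inverse (Suc i))" unfolding V_def G_def by blast
          then have yM: "x \<in> M" "y \<in> M" "d y x < inverse (Suc i)" by simp_all
          have "inverse (real (Suc i)) \<le> inverse (real (Suc N))" using i by simp
          then have "d x y < r" using yM N commute[of x y] by linarith
          then have "y \<in> U k" using yM by (intro subsetD[OF r(2)]) simp
          then show False using y(1) i by (auto simp: F_def)
        qed
        then have "i \<le> max k N" if "x \<in> V i" for i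
          using that by (meson leI le_max_iff_disj nle_le)
        then have "{W \<in> range V. x \<in> W} \<subseteq> V ` {..max k N}" by blast
        then show ?thesis by (meson finite_atMost finite_imageI finite_subset)
      qed
      have cover: "x \<in> \<Union>(range V)" if x: "x \<in> M" for x
      proof -
        define i where "i = (LEAST i. x \<in> U i)"
        have "\<exists>i. x \<in> U i" using x UM by blast
        then have "x \<in> U i" "\<And>j. j < i \<Longrightarrow> x \<notin> U j" unfolding i_def by (auto dest: not_less_Least intro: LeastI_ex)
        then have "x \<in> V i" using x FG[of i] by (auto simp: V_def F_def)
        then show ?thesis by blast
      qed
      show ?thesis
      proof (intro exI[of _ "range V"] conjI ballI)
        fix W assume "W \<in> range V"
        then show "openin mtopology W" "\<exists>U\<in>\<U>. W \<subseteq> U" using Uo Go U by (auto simp: V_def)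
      next
        show "\<Union>(range V) = topspace mtopology" using cover UM by (auto simp: V_def)
      qed (use fin in auto)
    qed
  qed
qed

lemma locally_compact_Lindelof_exhaustion:
  assumes haus: "Hausdorff_space X" and lc: "locally_compact_space X" and lin: "Lindelof_space X"
  obtains C :: "nat \<Rightarrow> 'a set" where "\<And>n. compactin X (C n)" "\<And>n. C n \<subseteq> X interior_of C (Suc n)"
    "(\<Union>n. C n) = topspace X"
proof -
  let ?\<U> = "{U. openin X U \<and> (\<exists>K. compactin X K \<and> U \<subseteq> K)}"
  have "\<Union>?\<U> = topspace X"
  proof
    show "topspace X \<subseteq> \<Union>?\<U>" using lc unfolding locally_compact_space_def by blast
  qed (use openin_subset in blast)
  then have "\<exists>\<V>. countable \<V> \<and> \<V> \<subseteq> ?\<U> \<and> \<Union>\<V> = topspace X"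
    by (intro Lindelof_spaceD[OF lin]) auto
  then obtain \<V> where \<V>: "countable \<V>" "\<V> \<subseteq> ?\<U>" "\<Union>\<V> = topspace X"
    by metis
  \<comment> \<open>The empty set is inserted because an enumeration by all naturals requires a
    nonempty family, and \<open>X\<close> may be empty.\<close>
  define V where "V = from_nat_into (insert {} \<V>)"
  have V: "range V = insert {} \<V>"
    unfolding V_def using \<V>(1) by (intro range_from_nat_into) auto
  have "\<exists>K. compactin X K \<and> V i \<subseteq> K" for i
  proof -
    have "V i \<in> insert {} \<V>" using V rangeI[of V i] by simp
    then show ?thesis using \<V>(2) compactin_empty by auto
  qed
  then obtain K where K: "\<And>i. compactin X (K i)" "\<And>i. V i \<subseteq> K i" by metis
  have step: "\<exists>D. compactin X D \<and> C \<union> K i \<subseteq> X interior_of D" if "compactin X C" for C i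
  proof -
    have "compactin X (C \<union> K i)" using that K compactin_Un by blast
    then obtain U L where "openin X U" "compactin X L" "C \<union> K i \<subseteq> U" "U \<subseteq> L"
      using lc locally_compact_space_compact_closed_compact[of X] haus by metis
    then show ?thesis by (meson interior_of_maximal order_trans)
  qed
  have "\<exists>C. \<forall>n. compactin X (C n) \<and> C n \<union> K n \<subseteq> X interior_of C (Suc n)"
    by (rule dependent_nat_choice[where P = "\<lambda>_. compactin X" and Q = "\<lambda>n C D. C \<union> K n \<subseteq> X interior_of D", simplified conj_assoc]) (use step compactin_empty in \<open>blast\<close>)+
  then obtain C where C: "\<And>n. compactin X (C n)" "\<And>n. C n \<union> K n \<subseteq> X interior_of C (Suc n)" by blast
  show thesis
  proof (rule that)
    show "\<Union>(range C) = topspace X"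
    proof
      show "\<Union>(range C) \<subseteq> topspace X" using C(1) compactin_subset_topspace by blast
      show "topspace X \<subseteq> \<Union>(range C)"
      proof
        fix x assume "x \<in> topspace X"
        then obtain i where "x \<in> V i" using \<V>(3) V by (metis UnionE imageE insertI2)
        then have "x \<in> X interior_of C (Suc i)" using K(2)[of i] C(2)[of i] by blast
        then have "x \<in> C (Suc i)" by (rule subsetD[OF interior_of_subset])
        then show "x \<in> \<Union>(range C)" by blast
      qed
    qed
    show "compactin X (C n)" for n by (rule C(1))
    show "C n \<subseteq> X interior_of C (Suc n)" for n using C(2)[of n] by simp
  qed
qed

section \<open>Pushing along local collars\<close>

text \<open>All cylinders are cut from the product with the whole line. Regions of different or
  varying height are then subspaces of one space, and shears and rescalings of the second coordinate
  stay within it.\<close>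

abbreviation strip :: "'a topology \<Rightarrow> ('a \<times> real) set \<Rightarrow> ('a \<times> real) topology"
  where "strip X D \<equiv> subtopology (prod_topology X euclideanreal) D"

definition under :: "'a set \<Rightarrow> ('a \<Rightarrow> real) \<Rightarrow> ('a \<times> real) set"
  where "under B f = {(x,s). x \<in> B \<and> 0 \<le> s \<and> s \<le> f x}"

text \<open>A collar of variable height \<open>f\<close>, degenerate where \<open>f = 0\<close>. Asking for a closed embedding
  makes openness of the image checkable on complements, see \<open>partial_collar_push\<close>.\<close>

definition partial_collar :: "'a topology \<Rightarrow> 'a set \<Rightarrow> ('a \<Rightarrow> real) \<Rightarrow> ('a \<times> real \<Rightarrow> 'a) \<Rightarrow> bool"
  where "partial_collar X B f e \<longleftrightarrow>
    continuous_map (strip X (under B f)) X e \<and> closed_map (strip X (under B f)) X e \<and>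
    inj_on e (under B f) \<and> (\<forall>x\<in>B. e (x, 0) = x) \<and> openin X (e ` {(x,s). x \<in> B \<and> 0 \<le> s \<and> s < f x})"

text \<open>The last clause is the only form in which openness is needed; allowing \<open>c < 1\<close> makes the
  notion stable under shortening the fibres.\<close>

definition local_collar :: "'a topology \<Rightarrow> 'a set \<Rightarrow> 'a set \<Rightarrow> ('a \<times> real \<Rightarrow> 'a) \<Rightarrow> bool"
  where "local_collar X B K k \<longleftrightarrow>
    compactin X K \<and> K \<subseteq> B \<and> continuous_map (strip X (K \<times> {0..1})) X k \<and> inj_on k (K \<times> {0..1}) \<and>
    (\<forall>x\<in>K. k (x, 0) = x) \<and> (\<forall>x\<in>K. \<forall>t\<in>{0..1}. k (x, t) \<in> B \<longrightarrow> t = 0) \<and>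
    (\<forall>V c. openin (subtopology X B) V \<and> V \<subseteq> K \<and> 0 < c \<and> c \<le> 1 \<longrightarrow> openin X (k ` (V \<times> {0..<c})))"

section \<open>Pasting maps on cylinders; one push of a collar\<close>

lemma continuous_map_strip_fst: "continuous_map (strip X D) X fst"
  by (simp add: continuous_map_from_subtopology continuous_map_fst)

lemma continuous_map_strip_snd: "continuous_map (strip X D) euclideanreal snd"
  by (simp add: continuous_map_from_subtopology continuous_map_snd)

lemma continuous_map_strip_comp_fst:
  "continuous_map X Y u \<Longrightarrow> continuous_map (strip X D) Y (\<lambda>p. u (fst p))"
  using continuous_map_compose[OF continuous_map_strip_fst, of X Y u D] by (simp add: o_def)

lemma continuous_map_closed_pair:
  assumes "closedin X A" "closedin X C" "A \<union> C = topspace X"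
    and "continuous_map (subtopology X A) Y f" "continuous_map (subtopology X C) Y f"
  shows "continuous_map X Y f"
  by (rule pasting_lemma_closed[where I = "{A,C}" and T = id and f = "\<lambda>_. f"]) (use assms in auto)

lemma closed_map_closed_pair:
  assumes "A \<union> C = topspace X"
    and "closed_map (subtopology X A) Y f" "closed_map (subtopology X C) Y f"
  shows "closed_map X Y f"
  unfolding closed_map_def
proof (intro allI impI)
  fix U assume U: "closedin X U"
  have "f ` U = f ` (U \<inter> A) \<union> f ` (U \<inter> C)"
    using closedin_subset[OF U] assms(1) by blast
  moreover have "closedin Y (f ` (U \<inter> A))" "closedin Y (f ` (U \<inter> C))"
    using assms(2,3) U by (auto simp: closed_map_def closedin_subtopology)
  ultimately show "closedin Y (f ` U)" by auto
qed

lemma closedin_strip_le: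
  assumes "continuous_map (strip X D) euclideanreal a" "continuous_map (strip X D) euclideanreal b"
    and "D \<subseteq> topspace X \<times> UNIV"
  shows "closedin (strip X D) {p \<in> D. a p \<le> b p}"
proof -
  have "closedin (strip X D) {p \<in> topspace (strip X D). b p - a p \<in> {0..}}"
    by (rule closedin_continuous_map_preimage[OF continuous_map_diff[OF assms(2,1)]]) auto
  moreover have "{p \<in> topspace (strip X D). b p - a p \<in> {0..}} = {p \<in> D. a p \<le> b p}"
    using assms(3) by auto
  ultimately show ?thesis by simp
qed

text \<open>The map \<open>T\<close> pushes \<open>B\<close> into the interior along the fibres of the local collar, stretching each
  fibre \<open>[0,1]\<close> affinely onto \<open>[u x, 1]\<close>.\<close>

lemma squeeze_map:
  assumes haus: "Hausdorff_space X" and B: "closedin X B"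
    and lc: "local_collar X B K k"
    and u: "continuous_map X euclideanreal u"
    and ur: "\<And>x. x \<in> B \<Longrightarrow> 0 \<le> u x \<and> u x \<le> 1/2" and uK: "{x \<in> B. u x \<noteq> 0} \<subseteq> K"
  shows "\<exists>T. continuous_map X X T \<and> closed_map X X T \<and> inj_on T (topspace X) \<and>
    (\<forall>x\<in>K. T x = k (x, u x)) \<and> (\<forall>p\<in>topspace X. p \<notin> k ` (K \<times> {0..1}) \<longrightarrow> T p = p) \<and>
    T ` topspace X = topspace X - k ` {(x,s). x \<in> K \<and> 0 \<le> s \<and> s < u x}"
proof -
  have K: "compactin X K" "K \<subseteq> B" and kc: "continuous_map (strip X (K \<times> {0..1})) X k"
    and kinj: "inj_on k (K \<times> {0..1})" and k0: "\<And>x. x \<in> K \<Longrightarrow> k (x,0) = x"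
    and kop: "\<And>V c. openin (subtopology X B) V \<Longrightarrow> V \<subseteq> K \<Longrightarrow> 0 < c \<Longrightarrow> c \<le> 1 \<Longrightarrow> openin X (k ` (V \<times> {0..<c}))"
    using lc by (auto simp: local_collar_def)
  have KX: "K \<subseteq> topspace X" using K(1) compactin_subset_topspace by blast
  have urK: "0 \<le> u x \<and> u x \<le> 1/2" if "x \<in> K" for x using ur K(2) that by blast
  let ?S = "strip X (K \<times> {0..1})"
  have tS: "topspace ?S = K \<times> {0..1}" using KX by auto
  have cS: "compact_space ?S"
    by (rule compact_space_subtopology) (use K(1) in \<open>auto simp: compactin_Times\<close>)
  define A where "A = k ` (K \<times> {0..1})"
  have closedk: "closed_map ?S X k" using continuous_imp_closed_map[OF kc cS haus] .
  have Acl: "closedin X A" unfolding A_def using closedk tS by (metis closed_map_def closedin_topspace)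
  then have AX: "A \<subseteq> topspace X" by (rule closedin_subset)
  have "embedding_map ?S X k"
    by (rule injective_closed_imp_embedding_map[OF kc closedk]) (use kinj tS in simp)
  then have "homeomorphic_map ?S (subtopology X A) k" by (simp only: embedding_map_def A_def tS)
  then obtain j where j: "homeomorphic_maps ?S (subtopology X A) k j" using homeomorphic_map_maps by blast
  then have jc: "continuous_map (subtopology X A) ?S j" and jk: "\<And>p. p \<in> K \<times> {0..1} \<Longrightarrow> j (k p) = p"
    unfolding homeomorphic_maps_def tS by auto
  define V where "V = {x \<in> B. u x \<noteq> 0}"
  have BX: "B \<subseteq> topspace X" using B closedin_subset by blast
  have Vo: "openin (subtopology X B) V"
  proof -
    have "openin (subtopology X B) {x \<in> topspace (subtopology X B). u x \<in> - {0}}"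
      by (rule openin_continuous_map_preimage[OF continuous_map_from_subtopology[OF u]]) auto
    moreover have "{x \<in> topspace (subtopology X B). u x \<in> - {0}} = V" using BX by (auto simp: V_def)
    ultimately show ?thesis by simp
  qed
  have "openin X (k ` (V \<times> {0..<1}))" using kop[OF Vo] uK by (simp add: V_def)
  \<comment> \<open>\<open>A\<close> and \<open>C\<close> are closed and cover \<open>X\<close>. A
    point \<open>k (x,t)\<close> in their overlap has \<open>u x = 0\<close> or
    \<open>t = 1\<close>, where \<open>\<sigma>\<close> is the identity, so \<open>T\<close> can be
    pasted from the conjugate of \<open>\<sigma>\<close> by \<open>k\<close> on \<open>A\<close> and
    the identity on \<open>C\<close>.\<close>
  define C where "C = topspace X - k ` (V \<times> {0..<1})"
  have Ccl: "closedin X C" unfolding C_def using \<open>openin X (k ` (V \<times> {0..<1}))\<close> by blast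
  have AC: "A \<union> C = topspace X" using AX uK by (auto simp: A_def C_def V_def)
  define \<sigma> where "\<sigma> p = (fst p, u (fst p) + (1 - u (fst p)) * snd p)" for p :: "'a \<times> real"
  have \<sigma>S: "\<sigma> p \<in> K \<times> {0..1}" if "p \<in> K \<times> {0..1}" for p
  proof -
    obtain x t where p: "p = (x,t)" "x \<in> K" "0 \<le> t" "t \<le> 1" using \<open>p \<in> _\<close> by auto
    have "(1 - u x) * t \<le> 1 - u x" "0 \<le> (1 - u x) * t" using urK[OF p(2)] p by (auto intro: mult_left_le)
    then have "u x + (1 - u x) * t \<in> {0..1}" using urK[OF p(2)] by (simp add: algebra_simps)
    then show ?thesis using p by (simp add: \<sigma>_def)
  qed
  have \<sigma>c: "continuous_map ?S ?S \<sigma>"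
    unfolding \<sigma>_def continuous_map_in_subtopology
  proof (intro conjI continuous_map_pairedI continuous_map_strip_fst continuous_map_add continuous_map_real_mult
      continuous_map_diff continuous_map_strip_comp_fst u continuous_map_strip_snd)
    show "(\<lambda>p. (fst p, u (fst p) + (1 - u (fst p)) * snd p)) \<in> topspace ?S \<rightarrow> K \<times> {0..1}"
      using \<sigma>S unfolding \<sigma>_def tS by auto
  qed auto
  define T where "T p = (if p \<in> A then k (\<sigma> (j p)) else p)" for p
  have Tk: "T (k p) = k (\<sigma> p)" if "p \<in> K \<times> {0..1}" for p
    using that jk by (auto simp: T_def A_def)
  have TC: "T p = p" if "p \<in> C" for p
  proof (cases "p \<in> A")
    case True
    then obtain x t where xt: "p = k (x,t)" "x \<in> K" "t \<in> {0..1}" by (auto simp: A_def)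
    have "u x = 0 \<or> t = 1" using that xt K(2) by (force simp: C_def V_def)
    then have "\<sigma> (x,t) = (x,t)" by (auto simp: \<sigma>_def)
    then show ?thesis using xt Tk[of "(x,t)"] by simp
  qed (simp add: T_def)
  have cA: "continuous_map (subtopology X A) X T"
  proof (rule continuous_map_eq)
    show "continuous_map (subtopology X A) X (k \<circ> (\<sigma> \<circ> j))"
      by (intro continuous_map_compose[OF _ kc] continuous_map_compose[OF jc \<sigma>c])
  qed (auto simp: T_def)
  have cC: "continuous_map (subtopology X C) X T"
    by (rule continuous_map_eq[OF continuous_map_from_subtopology[OF continuous_map_id]]) (auto simp: TC)
  have clA: "closed_map (subtopology X A) X T"
    by (rule continuous_imp_closed_map[OF cA _ haus])
      (metis A_def cS compact_space_subtopology compactin_subspace image_compactin kc tS compact_space_def)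
  have clC: "closed_map (subtopology X C) X T"
    by (rule closed_map_eq[OF closed_map_inclusion[OF Ccl]]) (auto simp: TC)
  \<comment> \<open>The slope \<open>1 - u x\<close> is at least 1/2, so the affine map on each
    fibre is injective.\<close>
  have \<sigma>inj: "p = q" if "\<sigma> p = \<sigma> q" "p \<in> K \<times> {0..1}" "q \<in> K \<times> {0..1}" for p q
    using that urK[of "fst p"] by (auto simp: \<sigma>_def prod_eq_iff)
  show ?thesis
  proof (intro exI[of _ T] conjI ballI impI)
    show "continuous_map X X T" using continuous_map_closed_pair[OF Acl Ccl AC cA cC] .
    show "closed_map X X T" using closed_map_closed_pair[OF AC clA clC] .
    show "inj_on T (topspace X)"
    proof (rule inj_onI)
      fix p q assume pq: "p \<in> topspace X" "q \<in> topspace X" "T p = T q"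
      have TA: "T p \<in> A \<longleftrightarrow> p \<in> A" for p
        using Tk \<sigma>S by (auto simp: A_def T_def jk)
      show "p = q"
      proof (cases "p \<in> A")
        case True
        then have "q \<in> A" using TA pq by metis
        then obtain p' q' where *: "p = k p'" "q = k q'" "p' \<in> K \<times> {0..1}" "q' \<in> K \<times> {0..1}"
          using True by (auto simp: A_def)
        then have "\<sigma> p' = \<sigma> q'" using pq Tk kinj \<sigma>S by (metis inj_onD)
        then show ?thesis using * \<sigma>inj by blast
      next
        case False
        then have "q \<notin> A" using TA pq by metis
        then show ?thesis using False pq by (simp add: T_def)
      qed
    qed
    show "T x = k (x, u x)" if "x \<in> K" for x
      using Tk[of "(x,0)"] k0 that by (simp add: \<sigma>_def)
    show "T p = p" if "p \<in> topspace X" "p \<notin> k ` (K \<times> {0..1})" for p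
      using that by (simp add: T_def A_def)
    show "T ` topspace X = topspace X - k ` {(x,s). x \<in> K \<and> 0 \<le> s \<and> s < u x}" (is "_ = _ - k ` ?Q")
    proof (intro equalityI subsetI)
      have QS: "?Q \<subseteq> K \<times> {0..1}" using urK by force
      have Q: "\<sigma> p \<notin> ?Q" if "p \<in> K \<times> {0..1}" for p
        using that urK[of "fst p"] by (auto simp: \<sigma>_def not_less)
      fix y assume "y \<in> T ` topspace X"
      then obtain p where p: "p \<in> topspace X" "y = T p" by blast
      show "y \<in> topspace X - k ` ?Q"
      proof (cases "p \<in> A")
        case True
        then obtain p' where p': "p = k p'" "p' \<in> K \<times> {0..1}" by (auto simp: A_def)
        have y: "y = k (\<sigma> p')" using p p' Tk by simp
        have "k (\<sigma> p') \<in> A" unfolding A_def by (rule imageI[OF \<sigma>S[OF p'(2)]])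
        then have "y \<in> topspace X" unfolding y by (rule subsetD[OF AX])
        moreover have "y \<notin> k ` ?Q"
        proof
          assume "y \<in> k ` ?Q"
          then obtain q where q: "y = k q" "q \<in> ?Q" by (rule imageE)
          have "\<sigma> p' = q"
            by (rule inj_onD[OF kinj _ \<sigma>S[OF p'(2)] subsetD[OF QS q(2)]]) (use q(1) y in simp)
          then have "\<sigma> p' \<in> ?Q" using q(2) by (simp only:)
          then show False using Q[OF p'(2)] by (rule notE[rotated])
        qed
        ultimately show ?thesis by blast
      next
        case False
        then have "y = p" "p \<notin> k ` ?Q" using p image_mono[OF QS, of k] by (auto simp only: T_def A_def if_False)
        then show ?thesis using p by simp
      qed
    next
      fix y assume y: "y \<in> topspace X - k ` {(x,s). x \<in> K \<and> 0 \<le> s \<and> s < u x}"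
      show "y \<in> T ` topspace X"
      proof (cases "y \<in> A")
        case False
        then show ?thesis using y by (auto simp: T_def intro!: image_eqI[of _ _ y])
      next
        case True
        then obtain x t where xt: "y = k (x,t)" "x \<in> K" "0 \<le> t" "t \<le> 1" by (auto simp: A_def)
        then have ut: "u x \<le> t" using y by force
        \<comment> \<open>The preimage of height \<open>t\<close> under the affine map on the fibre
          of \<open>x\<close>; it is nonnegative because \<open>y\<close> lies outside the freed
          strip.\<close>
        define t' where "t' = (t - u x) / (1 - u x)"
        have u1: "1 - u x > 0" using urK[OF xt(2)] by linarith
        have t': "(x,t') \<in> K \<times> {0..1}" using xt u1 ut by (auto simp: t'_def divide_simps)
        have "\<sigma> (x,t') = (x,t)" using u1 by (simp add: \<sigma>_def t'_def)
        then have "T (k (x,t')) = y" using Tk[OF t'] xt by simp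
        moreover have "k (x,t') \<in> topspace X" using t' AX by (auto simp: A_def)
        ultimately show ?thesis by blast
      qed
    qed
  qed
qed

text \<open>The new collar runs first up the local collar to height \<open>u\<close> and then along the old collar
  transported by \<open>T\<close>. The complement of its open part is the image under the closed map \<open>T\<close> of the
  complement of the old one.\<close>

lemma partial_collar_push:
  assumes haus: "Hausdorff_space X" and B: "closedin X B"
    and pc: "partial_collar X B f e" and f0: "\<And>x. x \<in> B \<Longrightarrow> 0 \<le> f x"
    and f: "continuous_map X euclideanreal f"
    and lc: "local_collar X B K k"
    and u: "continuous_map X euclideanreal u"
    and ur: "\<And>x. x \<in> B \<Longrightarrow> 0 \<le> u x \<and> u x \<le> 1/2" and uK: "{x \<in> B. u x \<noteq> 0} \<subseteq> K"
  obtains e' where "partial_collar X B (\<lambda>x. f x + u x) e'"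
    "\<And>x s. (x,s) \<in> under B f \<Longrightarrow> u x = 0 \<Longrightarrow> e (x,s) \<notin> k ` (K \<times> {0..1}) \<Longrightarrow> e' (x,s) = e (x,s)"
proof -
  obtain T where T: "continuous_map X X T" "closed_map X X T" "inj_on T (topspace X)"
    and TK: "\<And>x. x \<in> K \<Longrightarrow> T x = k (x, u x)"
    and Tid: "\<And>p. p \<in> topspace X \<Longrightarrow> p \<notin> k ` (K \<times> {0..1}) \<Longrightarrow> T p = p"
    and Tim: "T ` topspace X = topspace X - k ` {(x,s). x \<in> K \<and> 0 \<le> s \<and> s < u x}"
    using squeeze_map[OF haus B lc u ur uK] by auto
  have K: "compactin X K" "K \<subseteq> B" and kc: "continuous_map (strip X (K \<times> {0..1})) X k"
    and kinj: "inj_on k (K \<times> {0..1})" and k0: "\<And>x. x \<in> K \<Longrightarrow> k (x,0) = x"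
    and kB: "\<And>x t. x \<in> K \<Longrightarrow> t \<in> {0..1} \<Longrightarrow> k (x,t) \<in> B \<Longrightarrow> t = 0"
    using lc by (auto simp: local_collar_def)
  have ec: "continuous_map (strip X (under B f)) X e" and ecl: "closed_map (strip X (under B f)) X e"
    and einj: "inj_on e (under B f)" and e0: "\<And>x. x \<in> B \<Longrightarrow> e (x,0) = x"
    and eop: "openin X (e ` {(x,s). x \<in> B \<and> 0 \<le> s \<and> s < f x})"
    using pc by (auto simp: partial_collar_def)
  have BX: "B \<subseteq> topspace X" using B closedin_subset by blast
  have uB: "\<And>x. x \<in> B \<Longrightarrow> x \<notin> K \<Longrightarrow> u x = 0" using uK by blast
  let ?D = "under B (\<lambda>x. f x + u x)"
  have DX: "?D \<subseteq> topspace X \<times> UNIV" "under B f \<subseteq> topspace X \<times> UNIV"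
    using BX by (auto simp: under_def)
  have tD: "topspace (strip X ?D) = ?D" "topspace (strip X (under B f)) = under B f"
    using DX by auto
  define Q where "Q = {(x,s). x \<in> K \<and> 0 \<le> s \<and> s < u x}"
  have TQ: "T p \<notin> k ` Q" if "p \<in> topspace X" for p
    using Tim that unfolding Q_def by blast
  \<comment> \<open>A point of \<open>B\<close> outside \<open>K\<close> is not in the image of
    \<open>k\<close>, since \<open>k\<close> meets \<open>B\<close> only at height 0, where it fixes
    \<open>K\<close>. Hence \<open>T\<close> does not move it.\<close>
  have TB: "T x = x" if x: "x \<in> B" "u x = 0" for x
  proof (cases "x \<in> K")
    case True then show ?thesis using TK k0 x by simp
  next
    case False
    have "x \<notin> k ` (K \<times> {0..1})"
    proof
      assume "x \<in> k ` (K \<times> {0..1})"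
      then obtain y t where yt: "x = k (y,t)" "y \<in> K" "t \<in> {0..1}" by auto
      then have "t = 0" using kB x(1) by metis
      then show False using yt k0 False by simp
    qed
    then show ?thesis using Tid BX x(1) by blast
  qed
  \<comment> \<open>The new region is cut along the graph of \<open>u\<close>. The lower part sits
    over \<open>K\<close>, because \<open>u\<close> vanishes elsewhere on \<open>B\<close>, and this
    makes it compact; the upper part is a shear of the old region.\<close>
  define P1 where "P1 = {p \<in> K \<times> {0..1}. snd p \<le> u (fst p)}"
  define P2 where "P2 = {p \<in> ?D. u (fst p) \<le> snd p}"
  have P1D: "P1 \<subseteq> ?D" and P2D: "P2 \<subseteq> ?D"
    using K(2) f0 unfolding P1_def P2_def under_def by force+
  have P12: "P1 \<union> P2 = ?D"
  proof
    show "?D \<subseteq> P1 \<union> P2"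
    proof
      fix p assume p: "p \<in> ?D"
      then obtain x s where xs: "p = (x,s)" "x \<in> B" "0 \<le> s" "s \<le> f x + u x" by (auto simp: under_def)
      show "p \<in> P1 \<union> P2"
      proof (cases "u x \<le> s")
        case True
        then show ?thesis using p xs by (simp add: P2_def)
      next
        case False
        then have "x \<in> K" using uB xs(2,3) by force
        then show ?thesis using False xs ur[OF xs(2)] by (simp add: P1_def)
      qed
    qed
  qed (use P1D P2D in blast)
  have cuf: "continuous_map (strip X D) euclideanreal (\<lambda>p. u (fst p))" for D
    by (rule continuous_map_strip_comp_fst[OF u])
  have P2cl: "closedin (strip X ?D) P2"
    unfolding P2_def by (rule closedin_strip_le[OF cuf continuous_map_strip_snd DX(1)])
  have P1cpt: "compactin (prod_topology X euclideanreal) P1"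
  proof -
    have KX: "K \<subseteq> topspace X" using K(1) compactin_subset_topspace by blast
    have "closedin (strip X (K \<times> {0..1})) P1"
      unfolding P1_def by (rule closedin_strip_le[OF continuous_map_strip_snd cuf]) (use KX in auto)
    moreover have "compact_space (strip X (K \<times> {0..1}))"
      by (rule compact_space_subtopology) (use K(1) in \<open>auto simp: compactin_Times\<close>)
    ultimately have "compactin (strip X (K \<times> {0..1})) P1" using closedin_compact_space by blast
    then show ?thesis by (simp add: compactin_subtopology)
  qed
  have P1cl: "closedin (strip X ?D) P1"
  proof -
    have "Hausdorff_space (strip X ?D)"
      using haus by (intro Hausdorff_space_subtopology) (simp add: Hausdorff_space_prod_topology)
    moreover have "compactin (strip X ?D) P1" using P1cpt P1D by (simp add: compactin_subtopology)
    ultimately show ?thesis by (rule compactin_imp_closedin)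
  qed
  define e' where "e' p = (if u (fst p) \<le> snd p then T (e (fst p, snd p - u (fst p))) else k p)" for p
  define \<phi> where "\<phi> p = (fst p, snd p - u (fst p))" for p :: "'a \<times> real"
  define \<psi> where "\<psi> p = (fst p, snd p + u (fst p))" for p :: "'a \<times> real"
  \<comment> \<open>On the graph of \<open>u\<close> both prescriptions agree:
    \<open>T (e (x,0)) = T x = k (x, u x)\<close>.\<close>
  have e'1: "e' p = k p" if "p \<in> P1" for p
  proof (cases "snd p = u (fst p)")
    case True
    then have "e' p = T (e (fst p, 0))" by (simp add: e'_def)
    also have "\<dots> = T (fst p)" using that K(2) e0 by (auto simp: P1_def)
    also have "\<dots> = k p" using that TK True by (auto simp: P1_def)
    finally show ?thesis .
  qed (use that in \<open>auto simp: P1_def e'_def\<close>)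
  have e'2: "e' p = T (e (\<phi> p))" if "p \<in> P2" for p using that by (simp add: P2_def e'_def \<phi>_def)
  have \<phi>: "\<phi> p \<in> under B f" if "p \<in> P2" for p using that by (auto simp: \<phi>_def P2_def under_def)
  have \<psi>: "\<psi> p \<in> P2" if "p \<in> under B f" for p using that ur by (force simp: \<psi>_def P2_def under_def)
  have "homeomorphic_maps (strip X P2) (strip X (under B f)) \<phi> \<psi>"
    unfolding homeomorphic_maps_def
  proof (intro conjI ballI)
    show "continuous_map (strip X P2) (strip X (under B f)) \<phi>"
      unfolding continuous_map_in_subtopology
    proof
      show "continuous_map (strip X P2) (prod_topology X euclideanreal) \<phi>" unfolding \<phi>_def
        by (intro continuous_map_pairedI continuous_map_diff cuf continuous_map_strip_fst continuous_map_strip_snd)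
    qed (use \<phi> in auto)
    show "continuous_map (strip X (under B f)) (strip X P2) \<psi>"
      unfolding continuous_map_in_subtopology
    proof
      show "continuous_map (strip X (under B f)) (prod_topology X euclideanreal) \<psi>" unfolding \<psi>_def
        by (intro continuous_map_pairedI continuous_map_add cuf continuous_map_strip_fst continuous_map_strip_snd)
    qed (use \<psi> in auto)
  qed (auto simp: \<phi>_def \<psi>_def)
  then have \<phi>hom: "homeomorphic_map (strip X P2) (strip X (under B f)) \<phi>" by (rule homeomorphic_maps_imp_map)
  have sub: "subtopology (strip X ?D) P1 = strip X P1" "subtopology (strip X ?D) P2 = strip X P2"
    using P1D P2D by (auto simp: subtopology_subtopology Int_absorb1)
  have tP: "topspace (strip X P1) \<subseteq> P1" "topspace (strip X P2) \<subseteq> P2" by auto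
  have c1: "continuous_map (strip X P1) X e'"
  proof (rule continuous_map_eq)
    show "continuous_map (strip X P1) X k"
      by (rule continuous_map_from_subtopology_mono[OF kc]) (auto simp: P1_def)
  qed (use e'1 tP in auto)
  have cl1: "closed_map (strip X P1) X e'"
    by (rule continuous_imp_closed_map[OF c1 compact_space_subtopology[OF P1cpt] haus])
  have c2: "continuous_map (strip X P2) X e'"
  proof (rule continuous_map_eq)
    show "continuous_map (strip X P2) X (T \<circ> (e \<circ> \<phi>))"
      using homeomorphic_imp_continuous_map[OF \<phi>hom] ec T(1) continuous_map_compose by metis
  qed (use e'2 tP in auto)
  have cl2: "closed_map (strip X P2) X e'"
  proof (rule closed_map_eq)
    show "closed_map (strip X P2) X (T \<circ> (e \<circ> \<phi>))"
      using homeomorphic_imp_closed_map[OF \<phi>hom] ecl T(2) closed_map_compose by metis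
  qed (use e'2 tP in auto)
  have eX: "e p \<in> topspace X" if "p \<in> under B f" for p
    using continuous_map_image_subset_topspace[OF ec] that tD(2) by blast
  have notP2: "p \<in> Q \<and> e' p = k p" if "p \<in> ?D" "p \<notin> P2" for p
  proof -
    have "p \<in> P1" using that P12 by blast
    moreover have "\<not> u (fst p) \<le> snd p" using that unfolding P2_def by blast
    ultimately show ?thesis using e'1[of p] by (auto simp: Q_def P1_def)
  qed
  have QK: "Q \<subseteq> K \<times> {0..1}" using ur K(2) unfolding Q_def by force
  have inj: "inj_on e' ?D"
  proof (rule inj_onI)
    have \<phi>inj: "p = q" if "\<phi> p = \<phi> q" for p q using that by (auto simp: \<phi>_def prod_eq_iff)
    \<comment> \<open>Points below the graph of \<open>u\<close> go into the freed strip, which the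
      image of \<open>T\<close> misses, so the two parts cannot collide.\<close>
    have mixed: False if "p \<in> ?D" "q \<in> ?D" "e' p = e' q" "p \<in> P2" "q \<notin> P2" for p q
    proof -
      have "k q \<in> k ` Q" using notP2[OF that(2,5)] by simp
      moreover have "k q = T (e (\<phi> p))" using notP2[OF that(2,5)] e'2[OF that(4)] that(3) by simp
      ultimately show False using TQ[OF eX[OF \<phi>[OF that(4)]]] by simp
    qed
    fix p q assume pq: "p \<in> ?D" "q \<in> ?D" "e' p = e' q"
    consider "p \<in> P2" "q \<in> P2" | "p \<notin> P2" "q \<notin> P2"
      using mixed[of p q] mixed[of q p] pq by metis
    then show "p = q"
    proof cases
      case 1
      then have "T (e (\<phi> p)) = T (e (\<phi> q))" using pq e'2 by metis
      then have "e (\<phi> p) = e (\<phi> q)" using inj_onD[OF T(3)] eX \<phi> 1 by blast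
      then have "\<phi> p = \<phi> q" using inj_onD[OF einj] \<phi> 1 by blast
      then show ?thesis by (rule \<phi>inj)
    next
      case 2
      have "p \<in> Q" "q \<in> Q" "k p = k q" using notP2[OF pq(1) 2(1)] notP2[OF pq(2) 2(2)] pq(3) by auto
      then show ?thesis using inj_onD[OF kinj _ subsetD[OF QK] subsetD[OF QK]] by blast
    qed
  qed
  have im: "e' ` {(x,s). x \<in> B \<and> 0 \<le> s \<and> s < f x + u x} = topspace X - T ` (topspace X - e ` {(x,s). x \<in> B \<and> 0 \<le> s \<and> s < f x})"
    (is "e' ` ?O' = _ - T ` (_ - e ` ?O)")
  proof -
    have O: "?O \<subseteq> under B f" "?O' \<subseteq> ?D" by (auto simp: under_def)
    have \<psi>O: "\<psi> p \<in> ?O'" if "p \<in> ?O" for p using that ur by (force simp: \<psi>_def)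
    have \<phi>O: "\<phi> p \<in> ?O" if "p \<in> ?O'" "p \<in> P2" for p using that by (auto simp: \<phi>_def P2_def)
    have QO: "Q \<subseteq> ?O'" using K(2) f0 unfolding Q_def by force
    have Qn: "Q \<inter> P2 = {}" by (auto simp: Q_def P2_def)
    have e'Q: "e' q = k q" if "q \<in> Q" for q
      using notP2[of q] that QO Qn O by blast
    have i1: "e' ` ?O' = T ` (e ` ?O) \<union> k ` Q"
    proof (intro equalityI subsetI)
      fix y assume "y \<in> e' ` ?O'"
      then obtain p where p: "y = e' p" "p \<in> ?O'" by (rule imageE)
      show "y \<in> T ` (e ` ?O) \<union> k ` Q"
      proof (cases "p \<in> P2")
        case True
        then show ?thesis using e'2[OF True] \<phi>O[OF p(2) True] p(1) by (simp only: image_eqI UnI1)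
      next
        case False
        then show ?thesis using notP2[OF subsetD[OF O(2) p(2)] False] p(1) by (simp only: image_eqI UnI2)
      qed
    next
      fix y assume "y \<in> T ` (e ` ?O) \<union> k ` Q"
      then show "y \<in> e' ` ?O'"
      proof
        assume "y \<in> T ` (e ` ?O)"
        then obtain z where z: "y = T z" "z \<in> e ` ?O" by (rule imageE)
        from z(2) obtain p where "z = e p" and pO: "p \<in> ?O" by (rule imageE)
        then have p: "y = T (e p)" "p \<in> ?O" using z(1) by (simp, intro pO)
        have "\<phi> (\<psi> p) = p" by (simp add: \<phi>_def \<psi>_def)
        then have "y = e' (\<psi> p)" using e'2[OF \<psi>[OF subsetD[OF O(1) p(2)]]] p(1) by simp
        then show ?thesis using \<psi>O[OF p(2)] by (rule image_eqI)
      next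
        assume "y \<in> k ` Q"
        then obtain q where q: "y = k q" "q \<in> Q" by (rule imageE)
        then have "y = e' q" using e'Q[OF q(2)] by simp
        then show ?thesis using subsetD[OF QO q(2)] by (rule image_eqI)
      qed
    qed
    have i2: "T ` (e ` ?O) = T ` topspace X - T ` (topspace X - e ` ?O)"
    proof -
      have sub: "e ` ?O \<subseteq> topspace X" using eX O by blast
      have "T ` (topspace X - e ` ?O) = T ` topspace X - T ` (e ` ?O)"
        by (rule inj_on_image_set_diff[OF T(3)]) (use sub in simp_all)
      moreover have "T ` (e ` ?O) \<subseteq> T ` topspace X" using sub by (rule image_mono)
      ultimately show ?thesis by (simp only: double_diff[OF _ subset_refl])
    qed
    have i3: "T ` (topspace X - e ` ?O) \<subseteq> T ` topspace X" by (rule image_mono) simp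
    have i4: "k ` Q \<subseteq> topspace X"
    proof -
      have "topspace (strip X (K \<times> {0..1})) = K \<times> {0..1}" using compactin_subset_topspace[OF K(1)] by auto
      then have "k ` (K \<times> {0..1}) \<subseteq> topspace X" using continuous_map_image_subset_topspace[OF kc] by simp
      then show ?thesis using image_mono[OF QK, of k] by simp
    qed
    have i5: "T ` topspace X = topspace X - k ` Q"
      using Tim unfolding Q_def .
    \<comment> \<open>Stated for abstract sets, the computation is pure set algebra, and the
      automation never sees the set comprehensions behind the letters.\<close>
    have "E = A - C" if "E = D \<union> F" "D = G - C" "C \<subseteq> G" "F \<subseteq> A" "G = A - F" for A C D E F G :: "'a set"
      using that by blast
    from this[OF i1 i2 i3 i4 i5] show ?thesis .
  qed
  have "closedin X (T ` (topspace X - e ` {(x,s). x \<in> B \<and> 0 \<le> s \<and> s < f x}))"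
    using T(2) eop unfolding closed_map_def by blast
  then have "openin X (e' ` {(x,s). x \<in> B \<and> 0 \<le> s \<and> s < f x + u x})"
    unfolding im by blast
  moreover have "continuous_map (strip X ?D) X e'"
    by (rule continuous_map_closed_pair[OF P1cl P2cl]) (use P12 tD c1 c2 sub in auto)
  moreover have "closed_map (strip X ?D) X e'"
    by (rule closed_map_closed_pair[of P1 P2]) (use P12 tD cl1 cl2 sub in auto)
  moreover have "e' (x,0) = x" if "x \<in> B" for x
  proof (cases "u x = 0")
    case True
    then show ?thesis using TB e0 that by (simp add: e'_def)
  next
    case False
    then have "x \<in> K" using uK that by blast
    then show ?thesis using False ur[OF that] k0 by (simp add: e'_def)
  qed
  ultimately have "partial_collar X B (\<lambda>x. f x + u x) e'"
    using inj by (simp add: partial_collar_def)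
  moreover have "e' (x,s) = e (x,s)" if "(x,s) \<in> under B f" "u x = 0" "e (x,s) \<notin> k ` (K \<times> {0..1})" for x s
    using that Tid eX by (simp add: e'_def under_def)
  ultimately show thesis by (rule that)
qed

section \<open>Local collars kept away from a closed set\<close>

text \<open>Local collars are taken over compact patches, which makes them closed maps into a
  Hausdorff space; \<open>V\<close> records that the patch is a neighbourhood of \<open>b\<close> in
  \<open>B\<close>.\<close>

definition locally_collarable :: "'a topology \<Rightarrow> 'a set \<Rightarrow> bool"
  where "locally_collarable X B \<longleftrightarrow>
    (\<forall>b\<in>B. \<exists>K k V. local_collar X B K k \<and> openin (subtopology X B) V \<and> b \<in> V \<and> V \<subseteq> K)"

text \<open>The new cylinder of height \<open>d\<close> is the old one of height
  \<open>c * d\<close>, so the openness clause is inherited. Small \<open>c\<close> is what brings a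
  local collar close to \<open>B\<close>.\<close>

lemma local_collar_shrink:
  assumes haus: "Hausdorff_space X" and lc: "local_collar X B K k"
    and K': "compactin X K'" "K' \<subseteq> K" and c: "0 < c" "c \<le> 1"
  shows "local_collar X B K' (\<lambda>(x,t). k (x, c * t))"
proof -
  let ?k = "\<lambda>(x,t). k (x, c * t)" and ?r = "\<lambda>p. (fst p, c * snd p)"
  have kc: "continuous_map (strip X (K \<times> {0..1})) X k" and kinj: "inj_on k (K \<times> {0..1})"
    and kop: "\<And>V d. openin (subtopology X B) V \<Longrightarrow> V \<subseteq> K \<Longrightarrow> 0 < d \<Longrightarrow> d \<le> 1 \<Longrightarrow> openin X (k ` (V \<times> {0..<d}))"
    and kB: "\<And>x t. x \<in> K \<Longrightarrow> t \<in> {0..1} \<Longrightarrow> k (x,t) \<in> B \<Longrightarrow> t = 0"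
    and k0: "\<And>x. x \<in> K \<Longrightarrow> k (x,0) = x" and KB: "K \<subseteq> B"
    using lc by (auto simp: local_collar_def)
  have ct: "c * t \<in> {0..1}" if "t \<in> {0..1}" for t
    using that c by (auto intro: mult_le_one)
  have "continuous_map (strip X (K' \<times> {0..1})) (strip X (K \<times> {0..1})) ?r"
    unfolding continuous_map_in_subtopology
  proof
    show "continuous_map (strip X (K' \<times> {0..1})) (prod_topology X euclideanreal) ?r"
      by (intro continuous_map_pairedI continuous_map_strip_fst continuous_map_real_mult_left continuous_map_strip_snd)
    show "?r \<in> topspace (strip X (K' \<times> {0..1})) \<rightarrow> K \<times> {0..1}"
      using ct K'(2) by auto
  qed
  then have "continuous_map (strip X (K' \<times> {0..1})) X (k \<circ> ?r)"
    by (rule continuous_map_compose[OF _ kc])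
  then have "continuous_map (strip X (K' \<times> {0..1})) X ?k" by (simp add: o_def case_prod_unfold)
  moreover have "inj_on ?k (K' \<times> {0..1})"
  proof (rule inj_onI)
    fix p q assume pq: "p \<in> K' \<times> {0..1}" "q \<in> K' \<times> {0..1}" "?k p = ?k q"
    obtain x t y s where e: "p = (x,t)" "q = (y,s)" by (cases p, cases q) auto
    then have "(x, c * t) = (y, c * s)"
      using pq ct[of t] ct[of s] K'(2) by (intro inj_onD[OF kinj]) auto
    then show "p = q" using e c by simp
  qed
  moreover have "openin X (?k ` (V \<times> {0..<d}))"
    if "openin (subtopology X B) V \<and> V \<subseteq> K' \<and> 0 < d \<and> d \<le> 1" for V d
  proof -
    have "?k ` (V \<times> {0..<d}) = k ` (V \<times> {0..<c * d})"
    proof (intro equalityI subsetI)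
      fix y assume "y \<in> k ` (V \<times> {0..<c * d})"
      then obtain x s where xs: "y = k (x,s)" "x \<in> V" "0 \<le> s" "s < c * d" by auto
      then have "s / c < d" "0 \<le> s / c" using c by (auto simp: field_simps)
      moreover have "y = ?k (x, s / c)" using xs c by simp
      ultimately show "y \<in> ?k ` (V \<times> {0..<d})" using xs(2) by (intro image_eqI[of _ _ "(x, s / c)"]) auto
    next
      fix y assume "y \<in> ?k ` (V \<times> {0..<d})"
      then obtain x t where xt: "y = k (x,c * t)" "x \<in> V" "0 \<le> t" "t < d" by auto
      then show "y \<in> k ` (V \<times> {0..<c * d})" using c by (intro image_eqI[of _ _ "(x, c * t)"]) auto
    qed
    moreover have "c * d \<le> 1" "0 < c * d" using that c by (auto intro: mult_le_one)
    ultimately show ?thesis using kop[of V "c * d"] that K'(2) by auto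
  qed
  moreover have "t = 0" if "x \<in> K'" "t \<in> {0..1}" "?k (x,t) \<in> B" for x t
    using kB[of x "c * t"] that K'(2) ct c by auto
  ultimately show ?thesis
    unfolding local_collar_def using K' KB k0 by auto
qed

text \<open>Since \<open>k (b,0) = b\<close> is not in \<open>L\<close>, continuity gives a box
  around \<open>(b,0)\<close> whose part in the cylinder \<open>k\<close> maps off \<open>L\<close>.
  Restricting to a compact neighbourhood of \<open>b\<close> and shortening the fibres fits the new
  cylinder into that box.\<close>

lemma local_collar_avoiding:
  assumes haus: "Hausdorff_space X" and X: "locally_compact_space X" and B: "closedin X B"
    and lc: "locally_collarable X B" and b: "b \<in> B" and L: "closedin X L" "b \<notin> L"
  shows "\<exists>K k u. local_collar X B K k \<and> k ` (K \<times> {0..1}) \<inter> L = {} \<and> continuous_map X euclideanreal u \<and>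
    (\<forall>x\<in>topspace X. 0 \<le> u x \<and> u x \<le> 1/2) \<and> u b > 0 \<and> {x \<in> B. u x \<noteq> 0} \<subseteq> K"
proof -
  obtain K k V where lk: "local_collar X B K k" and V: "openin (subtopology X B) V" "b \<in> V" "V \<subseteq> K"
    using lc b unfolding locally_collarable_def by meson
  have kc: "continuous_map (strip X (K \<times> {0..1})) X k" and k0: "k (b,0) = b" and KX: "K \<subseteq> topspace X"
    using lk V compactin_subset_topspace by (auto simp: local_collar_def)
  have BX: "B \<subseteq> topspace X" using B closedin_subset by blast
  have "openin (strip X (K \<times> {0..1})) {p \<in> topspace (strip X (K \<times> {0..1})). k p \<in> topspace X - L}"
    by (rule openin_continuous_map_preimage[OF kc]) (use L in auto)
  then obtain G where G: "openin (prod_topology X euclideanreal) G"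
    "{p \<in> topspace (strip X (K \<times> {0..1})). k p \<in> topspace X - L} = G \<inter> (K \<times> {0..1})"
    by (auto simp: openin_subtopology)
  have "(b,0) \<in> {p \<in> topspace (strip X (K \<times> {0..1})). k p \<in> topspace X - L}"
    using V KX L k0 by auto
  then have "(b,0) \<in> G" using G(2) by blast
  then obtain U I where UI: "openin X U" "open I" "b \<in> U" "0 \<in> I" "U \<times> I \<subseteq> G"
    using G(1) unfolding openin_prod_topology_alt by (metis open_openin)
  obtain d where d: "d > 0" "\<And>y::real. dist y 0 < d \<Longrightarrow> y \<in> I" using UI(2,4) unfolding open_dist by blast
  \<comment> \<open>Halving \<open>d\<close> makes the strict distance condition hold on the whole
    closed segment up to \<open>c\<close>; the minimum with 1 is what the shortening of fibres
    demands.\<close>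
  define c where "c = min 1 (d/2)"
  have c: "0 < c" "c \<le> 1" "\<And>t. t \<in> {0..1} \<Longrightarrow> c * t \<in> I"
  proof -
    show "0 < c" "c \<le> 1" using d by (auto simp: c_def)
    fix t :: real assume t: "t \<in> {0..1}"
    then have "c * t \<le> c" using \<open>0 < c\<close> by (auto intro: mult_left_le)
    then have "c * t < d" using d by (auto simp: c_def)
    then show "c * t \<in> I" using d(2)[of "c * t"] t \<open>0 < c\<close> by (simp add: dist_real_def)
  qed
  obtain V0 where V0: "openin X V0" "V = V0 \<inter> B" using V(1) by (auto simp: openin_subtopology)
  have "neighbourhood_base_of (compactin X) X"
    using X haus locally_compact_space_neighbourhood_base by blast
  moreover have "openin X (U \<inter> V0)" "b \<in> U \<inter> V0" using UI V V0 by auto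
  ultimately obtain W C where W: "openin X W" "compactin X C" "b \<in> W" "W \<subseteq> C" "C \<subseteq> U \<inter> V0"
    unfolding neighbourhood_base_of by meson
  have K': "compactin X (C \<inter> B)" "C \<inter> B \<subseteq> K"
    using W V V0 B compact_Int_closedin by blast+
  have "completely_regular_space X"
    using X haus locally_compact_Hausdorff_imp_regular_space completely_regular_eq_regular_space by blast
  then obtain g where g: "continuous_map X (top_of_set {0..1::real}) g" "g b = 0" "g ` (topspace X - W) \<subseteq> {1}"
    unfolding completely_regular_space_def using W(1,3) BX b
    by (metis (no_types, lifting) Diff_Diff_Int DiffI Diff_iff closedin_diff closedin_topspace subsetD)
  \<comment> \<open>\<open>g\<close> is 0 at \<open>b\<close> and 1 off \<open>W\<close>, so
    \<open>u\<close> equals 1/2 at \<open>b\<close>, vanishes off \<open>W\<close> and respects the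
    bound 1/2 demanded of a push.\<close>
  define u where "u x = (1 - g x) / 2" for x
  show ?thesis
  proof (intro exI conjI ballI)
    show "local_collar X B (C \<inter> B) (\<lambda>(x,t). k (x, c * t))"
      by (rule local_collar_shrink[OF haus lk K' c(1,2)])
    show "(\<lambda>(x,t). k (x, c * t)) ` ((C \<inter> B) \<times> {0..1}) \<inter> L = {}"
    proof -
      have "k (x, c * t) \<notin> L" if "x \<in> C" "x \<in> B" "t \<in> {0..1}" for x t
      proof -
        have "c * t \<in> {0..1}" using that c by (auto intro: mult_le_one)
        moreover have "x \<in> K" "x \<in> U" "c * t \<in> I" using that K' W c(3) by auto
        ultimately have "(x, c * t) \<in> G \<inter> (K \<times> {0..1})" using UI(5) by auto
        then show ?thesis using G(2) by blast
      qed
      then show ?thesis by auto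
    qed
    have gc: "continuous_map X euclideanreal g" and g01: "\<And>x. x \<in> topspace X \<Longrightarrow> g x \<in> {0..1}"
      using g(1) by (auto simp: continuous_map_in_subtopology)
    show "continuous_map X euclideanreal u"
      unfolding u_def by (intro continuous_map_real_divide continuous_map_diff gc) auto
    show "u b > 0" using g(2) by (simp add: u_def)
    show "0 \<le> u x" "u x \<le> 1/2" if "x \<in> topspace X" for x using g01[OF that] by (auto simp: u_def)
    show "{x \<in> B. u x \<noteq> 0} \<subseteq> C \<inter> B"
      using g(3) W(4) BX by (force simp: u_def)
  qed
qed

text \<open>The closed set \<open>L\<close> protects the part of the collar that is already in its final position; this
  control makes the infinite construction below locally eventually constant.\<close>

lemma partial_collar_extend:
  assumes haus: "Hausdorff_space X" and X: "locally_compact_space X" and B: "closedin X B"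
    and lc: "locally_collarable X B"
    and f: "continuous_map X euclideanreal f" and f0: "\<forall>x\<in>B. 0 \<le> f x" and pc: "partial_collar X B f e"
    and A: "compactin X A" "A \<subseteq> B" and L: "closedin X L" "A \<inter> L = {}"
  shows "\<exists>f' e'. continuous_map X euclideanreal f' \<and> partial_collar X B f' e' \<and> (\<forall>x\<in>B. f x \<le> f' x) \<and>
    (\<forall>x\<in>A. 0 < f' x) \<and> (\<forall>x\<in>B \<inter> L. f' x = f x) \<and>
    (\<forall>x s. (x,s) \<in> under B f \<longrightarrow> x \<in> L \<longrightarrow> e (x,s) \<in> L \<longrightarrow> e' (x,s) = e (x,s))"
proof -
  have BX: "B \<subseteq> topspace X" using B closedin_subset by blast
  have "\<forall>b\<in>A. \<exists>q. case q of (K,k,u) \<Rightarrow> local_collar X B K k \<and> k ` (K \<times> {0..1}) \<inter> L = {} \<and> continuous_map X euclideanreal u \<and>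
    (\<forall>x\<in>topspace X. 0 \<le> u x \<and> u x \<le> 1/2) \<and> u b > 0 \<and> {x \<in> B. u x \<noteq> 0} \<subseteq> K"
  proof
    fix b assume "b \<in> A"
    then have "b \<in> B" "b \<notin> L" using A L by auto
    from local_collar_avoiding[OF haus X B lc this(1) L(1) this(2)]
    show "\<exists>q. case q of (K,k,u) \<Rightarrow> local_collar X B K k \<and> k ` (K \<times> {0..1}) \<inter> L = {} \<and> continuous_map X euclideanreal u \<and>
      (\<forall>x\<in>topspace X. 0 \<le> u x \<and> u x \<le> 1/2) \<and> u b > 0 \<and> {x \<in> B. u x \<noteq> 0} \<subseteq> K"
      by (simp add: split_paired_Ex)
  qed
  from bchoice[OF this] obtain Q where Q: "\<forall>b\<in>A. case Q b of (K,k,u) \<Rightarrow> local_collar X B K k \<and> k ` (K \<times> {0..1}) \<inter> L = {} \<and> continuous_map X euclideanreal u \<and>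
    (\<forall>x\<in>topspace X. 0 \<le> u x \<and> u x \<le> 1/2) \<and> u b > 0 \<and> {x \<in> B. u x \<noteq> 0} \<subseteq> K" ..
  define K where "K b = fst (Q b)" for b
  define k where "k b = fst (snd (Q b))" for b
  define u where "u b = snd (snd (Q b))" for b
  have q: "local_collar X B (K b) (k b)" "k b ` (K b \<times> {0..1}) \<inter> L = {}" "continuous_map X euclideanreal (u b)"
    "\<And>x. x \<in> topspace X \<Longrightarrow> 0 \<le> u b x \<and> u b x \<le> 1/2" "u b b > 0" "{x \<in> B. u b x \<noteq> 0} \<subseteq> K b" if "b \<in> A" for b
    using bspec[OF Q that] by (auto simp: K_def k_def u_def split: prod.splits)
  let ?\<U> = "(\<lambda>b. {x \<in> topspace X. u b x \<in> {0<..}}) ` A"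
  have "openin X {x \<in> topspace X. u b x \<in> {0<..}}" if "b \<in> A" for b
    by (rule openin_continuous_map_preimage[OF q(3)[OF that]]) simp
  then have oU: "openin X U" if "U \<in> ?\<U>" for U using that by blast
  have AU: "A \<subseteq> \<Union>?\<U>" using q(5) A BX by auto
  have "\<exists>\<F>. finite \<F> \<and> \<F> \<subseteq> ?\<U> \<and> A \<subseteq> \<Union>\<F>"
    by (rule compactinD[OF A(1) _ AU]) (rule oU)
  then obtain \<F> where \<F>: "finite \<F>" "\<F> \<subseteq> ?\<U>" "A \<subseteq> \<Union>\<F>" by blast
  obtain F where F: "finite F" "F \<subseteq> A" "A \<subseteq> (\<Union>b\<in>F. {x \<in> topspace X. u b x \<in> {0<..}})"
    using finite_subset_image[OF \<F>(1,2)] \<F>(3) by auto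
  \<comment> \<open>Induction over the finite set of pushes. Positivity is asserted where some bump
    of \<open>F\<close> is positive rather than on \<open>A\<close>, since only the complete finite
    set covers \<open>A\<close>.\<close>
  have "\<exists>f' e'. continuous_map X euclideanreal f' \<and> partial_collar X B f' e' \<and> (\<forall>x\<in>B. f x \<le> f' x) \<and>
    (\<forall>x\<in>B. \<forall>b\<in>F. 0 < u b x \<longrightarrow> 0 < f' x) \<and> (\<forall>x\<in>B \<inter> L. f' x = f x) \<and>
    (\<forall>x s. (x,s) \<in> under B f \<longrightarrow> x \<in> L \<longrightarrow> e (x,s) \<in> L \<longrightarrow> e' (x,s) = e (x,s))"
    using F(1,2)
  proof (induction F rule: finite_induct)
    case empty
    then show ?case using f pc by (intro exI[of _ f] exI[of _ e]) auto
  next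
    case (insert b F)
    then obtain f' e' where IH: "continuous_map X euclideanreal f'" "partial_collar X B f' e'" "\<forall>x\<in>B. f x \<le> f' x"
      "\<forall>x\<in>B. \<forall>b\<in>F. 0 < u b x \<longrightarrow> 0 < f' x" "\<forall>x\<in>B \<inter> L. f' x = f x"
      "\<forall>x s. (x,s) \<in> under B f \<longrightarrow> x \<in> L \<longrightarrow> e (x,s) \<in> L \<longrightarrow> e' (x,s) = e (x,s)"
      by auto
    have bA: "b \<in> A" using insert by simp
    have ub: "0 \<le> u b x \<and> u b x \<le> 1/2" if "x \<in> B" for x using q(4)[OF bA] BX that by blast
    have f'0: "0 \<le> f' x" if "x \<in> B" for x using f0 IH(3) that by force
    obtain e'' where e'': "partial_collar X B (\<lambda>x. f' x + u b x) e''"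
      "\<And>x s. (x,s) \<in> under B f' \<Longrightarrow> u b x = 0 \<Longrightarrow> e' (x,s) \<notin> k b ` (K b \<times> {0..1}) \<Longrightarrow> e'' (x,s) = e' (x,s)"
      using partial_collar_push[OF haus B IH(2) f'0 IH(1) q(1,3)[OF bA] ub q(6)[OF bA]] by blast
    \<comment> \<open>Points of \<open>B\<close> with \<open>u b\<close> nonzero lie in
      \<open>K b\<close>, the bottom of a cylinder that misses \<open>L\<close>.\<close>
    have uL: "u b x = 0" if "x \<in> B" "x \<in> L" for x
    proof (rule ccontr)
      assume "u b x \<noteq> 0"
      then have "x \<in> K b" using q(6)[OF bA] that by blast
      then have "x = k b (x,0)" using q(1)[OF bA] by (simp add: local_collar_def)
      then have "x \<in> k b ` (K b \<times> {0..1})" using \<open>x \<in> K b\<close> by (intro image_eqI[of _ _ "(x,0)"]) auto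
      then show False using q(2)[OF bA] that by blast
    qed
    show ?case
    proof (intro exI conjI)
      show "continuous_map X euclideanreal (\<lambda>x. f' x + u b x)" by (intro continuous_map_add IH q(3)[OF bA])
      show "partial_collar X B (\<lambda>x. f' x + u b x) e''" by (rule e'')
      show "\<forall>x\<in>B. f x \<le> f' x + u b x" using IH(3) ub by force
      show "\<forall>x\<in>B. \<forall>b'\<in>insert b F. 0 < u b' x \<longrightarrow> 0 < f' x + u b x"
        using IH(4) ub f'0 by (auto intro: add_pos_nonneg add_nonneg_pos)
      show "\<forall>x\<in>B \<inter> L. f' x + u b x = f x" using IH(5) uL by auto
      \<comment> \<open>Both memberships matter: \<open>x\<close> in \<open>L\<close> gives
        \<open>u b x = 0\<close>, so the fibre is not shifted, and \<open>e (x,s)\<close> in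
        \<open>L\<close> keeps the point out of the cylinder that the push moves.\<close>
      show "\<forall>x s. (x,s) \<in> under B f \<longrightarrow> x \<in> L \<longrightarrow> e (x,s) \<in> L \<longrightarrow> e'' (x,s) = e (x,s)"
      proof (intro allI impI)
        fix x s assume *: "(x,s) \<in> under B f" "x \<in> L" "e (x,s) \<in> L"
        then have xB: "x \<in> B" by (simp add: under_def)
        then have "f x \<le> f' x" using IH(3) by blast
        then have u': "(x,s) \<in> under B f'" using * by (simp add: under_def)
        have "e' (x,s) = e (x,s)" using IH(6) * by blast
        moreover have "e (x,s) \<notin> k b ` (K b \<times> {0..1})" using * q(2)[OF bA] by blast
        ultimately show "e'' (x,s) = e (x,s)" using e''(2)[OF u' uL[OF xB *(2)]] by simp
      qed
    qed
  qed
  then obtain f' e' where r: "continuous_map X euclideanreal f'" "partial_collar X B f' e'" "\<forall>x\<in>B. f x \<le> f' x"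
      "\<forall>x\<in>B. \<forall>b\<in>F. 0 < u b x \<longrightarrow> 0 < f' x" "\<forall>x\<in>B \<inter> L. f' x = f x"
      "\<forall>x s. (x,s) \<in> under B f \<longrightarrow> x \<in> L \<longrightarrow> e (x,s) \<in> L \<longrightarrow> e' (x,s) = e (x,s)"
    by auto
  moreover have "\<forall>x\<in>A. 0 < f' x" using r(4) F(3) A(2) by fastforce
  ultimately show ?thesis by blast
qed

section \<open>From variable height to a genuine collar\<close>

text \<open>An embedding is open only onto its image. Cutting with the open set that the collar
  sweeps out strictly below its height makes the image of \<open>W\<close> open in
  \<open>X\<close>.\<close>

lemma partial_collar_openin_image:
  assumes pc: "partial_collar X B f e" and BX: "B \<subseteq> topspace X"
    and W: "openin (strip X (under B f)) W" "W \<subseteq> {(x,s). x \<in> B \<and> 0 \<le> s \<and> s < f x}"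
  shows "openin X (e ` W)"
proof -
  let ?O = "{(x,s). x \<in> B \<and> 0 \<le> s \<and> s < f x}"
  have e: "continuous_map (strip X (under B f)) X e" "closed_map (strip X (under B f)) X e"
    "inj_on e (under B f)" "openin X (e ` ?O)"
    using pc by (auto simp: partial_collar_def)
  have tD: "topspace (strip X (under B f)) = under B f" using BX by (auto simp: under_def)
  have OD: "?O \<subseteq> under B f" by (auto simp: under_def)
  have "embedding_map (strip X (under B f)) X e"
    by (rule injective_closed_imp_embedding_map[OF e(1,2)]) (unfold tD, rule e(3))
  then have "open_map (strip X (under B f)) (subtopology X (e ` under B f)) e"
    unfolding embedding_map_def tD by (rule homeomorphic_imp_open_map)
  then obtain H where H: "openin X H" "e ` W = H \<inter> e ` under B f"
    using W(1) unfolding open_map_def openin_subtopology by metis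
  have "e ` W \<subseteq> e ` ?O" using W(2) by (rule image_mono)
  moreover have "e ` ?O \<subseteq> e ` under B f" using OD by (rule image_mono)
  ultimately have "e ` W = H \<inter> e ` ?O" using H(2) by blast
  then show ?thesis using H(1) e(4) by auto
qed

text \<open>With height 2 the closed cylinder over \<open>{0..1}\<close> lies inside a half-open one
  on which \<open>h\<close> is an open embedding, so the restriction is an embedding as well. That
  \<open>h\<close> meets \<open>B\<close> only at height 0 is injectivity applied to
  \<open>h p = h (h p, 0)\<close>.\<close>

lemma collaredI:
  assumes BX: "B \<subseteq> topspace X" and c: "continuous_map (strip X (B \<times> {0..<2})) X h"
    and o: "open_map (strip X (B \<times> {0..<2})) X h" and inj: "inj_on h (B \<times> {0..<2})"
    and h0: "\<And>x. x \<in> B \<Longrightarrow> h (x, 0) = x"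
  shows "collared X B"
proof -
  let ?S = "strip X (B \<times> {0..<2})" and ?P = "strip X (B \<times> {0..1})"
  have t: "topspace ?S = B \<times> {0..<2}" "topspace ?P = B \<times> {0..1}" using BX by auto
  have P: "prod_topology (subtopology X B) (top_of_set {0..1}) = ?P" by (simp add: subtopology_Times)
  have sub: "subtopology ?S (B \<times> {0..1}) = ?P"
  proof -
    have "(B \<times> {0..<2}) \<inter> (B \<times> {0..1::real}) = B \<times> {0..1}" by auto
    then show ?thesis by (simp add: subtopology_subtopology)
  qed
  have "embedding_map ?S X h"
    by (rule injective_open_imp_embedding_map[OF c o]) (unfold t, rule inj)
  then have "homeomorphic_map ?S (subtopology X (h ` (B \<times> {0..<2}))) h"
    unfolding embedding_map_def t .
  then have "homeomorphic_map (subtopology ?S (B \<times> {0..1})) (subtopology (subtopology X (h ` (B \<times> {0..<2}))) (h ` (B \<times> {0..1}))) h"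
  proof (rule homeomorphic_map_subtopologies)
    have "h ` (B \<times> {0..<2}) \<subseteq> topspace X"
      using continuous_map_image_subset_topspace[OF c] t by simp
    moreover have "B \<times> {0..1} \<subseteq> B \<times> {0..<2::real}" by auto
    then have "h ` (B \<times> {0..1}) \<subseteq> h ` (B \<times> {0..<2})" "topspace ?S \<inter> (B \<times> {0..1}) = B \<times> {0..1}"
      unfolding t by (auto simp: image_mono)
    ultimately show "h ` (topspace ?S \<inter> B \<times> {0..1}) = topspace (subtopology X (h ` (B \<times> {0..<2}))) \<inter> h ` (B \<times> {0..1})"
      by auto
  qed
  moreover have "h ` (B \<times> {0..<2}) \<inter> h ` (B \<times> {0..1}) = h ` (B \<times> {0..1})" by force
  ultimately have "embedding_map ?P X h"
    unfolding embedding_map_def t sub subtopology_subtopology[of X] by simp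
  moreover have "{p \<in> B \<times> {0..1}. h p \<in> B} = B \<times> {0}"
  proof (intro equalityI subsetI)
    fix p assume "p \<in> {p \<in> B \<times> {0..1}. h p \<in> B}"
    then have p: "p \<in> B \<times> {0..1}" "h p \<in> B" by auto
    then have "h p = h (h p, 0)" using h0 by simp
    then have "p = (h p, 0)" using p by (intro inj_onD[OF inj]) auto
    then show "p \<in> B \<times> {0}" using p by (metis SigmaI insertI1)
  qed (use h0 in auto)
  moreover have "openin X (h ` (B \<times> {0..<1}))"
  proof -
    have "openin ?S (B \<times> {0..<1})"
    proof -
      have "B \<times> {0..<1} = (topspace X \<times> {..<1}) \<inter> (B \<times> {0..<2::real})" using BX by auto
      moreover have "openin (prod_topology X euclideanreal) (topspace X \<times> {..<1})"
        by (simp add: openin_prod_Times_iff)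
      ultimately show ?thesis unfolding openin_subtopology by blast
    qed
    then show ?thesis using o unfolding open_map_def by blast
  qed
  ultimately show ?thesis
    unfolding collared_def collaring_def P using h0 by blast
qed

text \<open>The start of the construction: at height 0 the open part is empty, and the projection is
  closed because the second factor is a single point and \<open>B\<close> is closed.\<close>

lemma partial_collar_zero:
  assumes "closedin X B"
  shows "partial_collar X B (\<lambda>x. 0) fst"
proof -
  have BX: "B \<subseteq> topspace X" using assms closedin_subset by blast
  have u: "under B (\<lambda>x. 0) = B \<times> {0}" by (auto simp: under_def)
  have s: "strip X (B \<times> {0}) = prod_topology (subtopology X B) (top_of_set {0})" by (simp add: subtopology_Times)
  have "closed_map (strip X (B \<times> {0})) (subtopology X B) fst"
    unfolding s by (rule closed_map_fst) (simp add: compact_space_subtopology)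
  then have "closed_map (strip X (B \<times> {0})) X fst"
    by (rule closed_map_from_closed_subtopology[OF assms])
  then show ?thesis
    unfolding partial_collar_def u by (auto simp: continuous_map_strip_fst inj_on_def)
qed

text \<open>Where \<open>f\<close> is positive, scaling by \<open>f x / 2\<close> takes the fibre
  \<open>[0,2)\<close> onto \<open>[0, f x)\<close> and has the continuous inverse
  \<open>?r\<close>. The image of \<open>W\<close> is therefore \<open>e\<close> of an open set
  strictly below the graph of \<open>f\<close>.\<close>

lemma rescaled_open_map:
  assumes pc: "partial_collar X B f e" and BX: "B \<subseteq> topspace X" and f: "continuous_map X euclideanreal f"
    and V: "openin (subtopology X B) V" "\<And>x. x \<in> V \<Longrightarrow> 0 < f x"
    and W: "openin (strip X (B \<times> {0..<2})) W" "W \<subseteq> V \<times> UNIV"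
  shows "openin X ((\<lambda>(x,t). e (x, t * f x / 2)) ` W)"
proof -
  let ?D = "under B f"
  let ?G = "{p \<in> ?D. fst p \<in> V \<and> snd p < f (fst p)}"
  have DX: "?D \<subseteq> topspace X \<times> UNIV" using BX by (auto simp: under_def)
  have tD: "topspace (strip X ?D) = ?D" using DX by auto
  have cf: "continuous_map (strip X S) euclideanreal (\<lambda>p. f (fst p))" for S
    by (rule continuous_map_strip_comp_fst[OF f])
  have "openin (strip X ?D) {p \<in> topspace (strip X ?D). f (fst p) - snd p \<in> {0<..}}"
    by (rule openin_continuous_map_preimage[OF continuous_map_diff[OF cf continuous_map_strip_snd]]) auto
  moreover have "continuous_map (strip X ?D) (subtopology X B) fst"
    unfolding continuous_map_in_subtopology using continuous_map_strip_fst tD by (fastforce simp: under_def)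
  then have "openin (strip X ?D) {p \<in> topspace (strip X ?D). fst p \<in> V}"
    by (rule openin_continuous_map_preimage[OF _ V(1)])
  ultimately have "openin (strip X ?D) ({p \<in> topspace (strip X ?D). f (fst p) - snd p \<in> {0<..}} \<inter> {p \<in> topspace (strip X ?D). fst p \<in> V})"
    by blast
  moreover have "{p \<in> topspace (strip X ?D). f (fst p) - snd p \<in> {0<..}} \<inter> {p \<in> topspace (strip X ?D). fst p \<in> V} = ?G"
    unfolding tD by auto
  ultimately have G: "openin (strip X ?D) ?G" by simp
  let ?r = "\<lambda>p. (fst p, 2 * snd p / f (fst p))"
  have tG: "topspace (strip X ?G) = ?G" using DX by auto
  have "continuous_map (strip X ?G) (strip X (B \<times> {0..<2})) ?r"
    unfolding continuous_map_in_subtopology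
  proof
    have "f (fst p) \<noteq> 0" if "p \<in> topspace (strip X ?G)" for p
      using that V(2) unfolding tG by force
    then show "continuous_map (strip X ?G) (prod_topology X euclideanreal) ?r"
      by (intro continuous_map_pairedI continuous_map_strip_fst continuous_map_real_divide
          continuous_map_real_mult_left continuous_map_strip_snd cf)
    show "?r \<in> topspace (strip X ?G) \<rightarrow> B \<times> {0..<2}"
      unfolding tG using V(2) by (auto simp: under_def divide_simps)
  qed
  then have "openin (strip X ?G) {p \<in> topspace (strip X ?G). ?r p \<in> W}"
    by (rule openin_continuous_map_preimage[OF _ W(1)])
  then have "openin (subtopology (strip X ?D) ?G) {p \<in> ?G. ?r p \<in> W}"
    unfolding tG by (simp add: subtopology_subtopology Int_absorb1)
  then have o: "openin (strip X ?D) {p \<in> ?G. ?r p \<in> W}"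
    using G openin_trans_full by blast
  have "openin X (e ` {p \<in> ?G. ?r p \<in> W})"
    by (rule partial_collar_openin_image[OF pc BX o]) (auto simp: under_def)
  moreover have "e ` {p \<in> ?G. ?r p \<in> W} = (\<lambda>(x,t). e (x, t * f x / 2)) ` W"
  proof (intro equalityI subsetI)
    fix y assume "y \<in> e ` {p \<in> ?G. ?r p \<in> W}"
    then obtain p where p: "y = e p" "p \<in> ?G" "?r p \<in> W" by blast
    then have "f (fst p) > 0" using V(2) by auto
    then have "(\<lambda>(x,t). e (x, t * f x / 2)) (?r p) = y" using p(1) by simp
    then show "y \<in> (\<lambda>(x,t). e (x, t * f x / 2)) ` W" using p(3) by blast
  next
    fix y assume "y \<in> (\<lambda>(x,t). e (x, t * f x / 2)) ` W"
    then obtain x t where xt: "(x,t) \<in> W" "y = e (x, t * f x / 2)" by auto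
    then have x: "x \<in> V" "x \<in> B" "0 \<le> t" "t < 2" using W(2) openin_subset[OF W(1)] by auto
    have fx: "0 < f x" using V(2) x by blast
    have "t * f x < 2 * f x" using x fx by simp
    then have "(x, t * f x / 2) \<in> ?G" using x fx by (auto simp: under_def)
    moreover have "?r (x, t * f x / 2) \<in> W" using xt fx by simp
    ultimately show "y \<in> e ` {p \<in> ?G. ?r p \<in> W}" using xt(2) by blast
  qed
  ultimately show ?thesis by simp
qed

lemma rescaled_continuous_map:
  assumes pc: "partial_collar X B f e" and BX: "B \<subseteq> topspace X" and f: "continuous_map X euclideanreal f"
    and f0: "\<forall>x\<in>B. 0 \<le> f x"
  shows "continuous_map (strip X (B \<times> {0..<2})) X (\<lambda>(x,t). e (x, t * f x / 2))"
proof -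
  let ?r = "\<lambda>p. (fst p, snd p * f (fst p) / 2)"
  have ec: "continuous_map (strip X (under B f)) X e" using pc by (auto simp: partial_collar_def)
  have "continuous_map (strip X (B \<times> {0..<2})) (strip X (under B f)) ?r"
    unfolding continuous_map_in_subtopology
  proof
    show "continuous_map (strip X (B \<times> {0..<2})) (prod_topology X euclideanreal) ?r"
      by (intro continuous_map_pairedI continuous_map_strip_fst continuous_map_real_divide
          continuous_map_real_mult continuous_map_strip_snd continuous_map_strip_comp_fst[OF f]) auto
    have "t * f x / 2 \<le> f x" if "x \<in> B" "0 \<le> t" "t < 2" for x t
      using mult_right_mono[of t 2 "f x"] f0 that by auto
    then show "?r \<in> topspace (strip X (B \<times> {0..<2})) \<rightarrow> under B f"
      using f0 by (auto simp: under_def)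
  qed
  from continuous_map_compose[OF this ec] show ?thesis by (simp add: o_def case_prod_unfold)
qed

proposition Lindelof_locally_collarable_imp_collared:
  assumes haus: "Hausdorff_space X" and X: "locally_compact_space X" and B: "closedin X B"
    and lc: "locally_collarable X B" and lin: "Lindelof_space (subtopology X B)"
  shows "collared X B"
proof -
  have BX: "B \<subseteq> topspace X" using B closedin_subset by blast
  let ?Y = "subtopology X B"
  have tY: "topspace ?Y = B" using BX by auto
  have hausY: "Hausdorff_space ?Y" and "locally_compact_space ?Y"
    using haus X B Hausdorff_space_subtopology locally_compact_space_closed_subset by blast+
  then obtain C where C: "\<And>n. compactin ?Y (C n)" "\<And>n. C n \<subseteq> ?Y interior_of C (Suc n)" "(\<Union>n. C n) = B"
    using locally_compact_Lindelof_exhaustion[OF _ _ lin] tY by metis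
  have CX: "compactin X (C n)" "C n \<subseteq> B" for n using C(1) by (auto simp: compactin_subtopology)
  have Cmono: "C n \<subseteq> C m" if "n \<le> m" for n m
    using C(2) interior_of_subset[of ?Y] by (intro lift_Suc_mono_le[OF _ that]) blast
  define P where "P n q = (case q of (f,e) \<Rightarrow> continuous_map X euclideanreal f \<and> (\<forall>x\<in>B. 0 \<le> f x) \<and>
     partial_collar X B f e \<and> (\<forall>x\<in>C (Suc n). 0 < f x))" for n and q :: "('a \<Rightarrow> real) \<times> ('a \<times> real \<Rightarrow> 'a)"
  define R where "R n q q' = (case q of (f,e) \<Rightarrow> case q' of (f',e') \<Rightarrow>
     (\<forall>x\<in>C n. f' x = f x \<and> (\<forall>s. (x,s) \<in> under B f \<longrightarrow> e' (x,s) = e (x,s))))"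
     for n and q q' :: "('a \<Rightarrow> real) \<times> ('a \<times> real \<Rightarrow> 'a)"
  have "\<exists>F. \<forall>n. P n (F n) \<and> R n (F n) (F (Suc n))"
  proof (rule dependent_nat_choice)
    obtain f e where "continuous_map X euclideanreal f" "partial_collar X B f e" "\<forall>x\<in>B. 0 \<le> f x" "\<forall>x\<in>C 1. 0 < f x"
      using partial_collar_extend[OF haus X B lc _ _ partial_collar_zero[OF B], of "C 1" "{}"] CX[of 1] by auto
    then have "P 0 (f,e)" by (simp add: P_def)
    then show "\<exists>q. P 0 q" ..
  next
    fix q n assume "P n q"
    then obtain f e where q: "q = (f,e)" and f: "continuous_map X euclideanreal f" and f0: "\<forall>x\<in>B. 0 \<le> f x"
      and pc: "partial_collar X B f e" and fp: "\<forall>x\<in>C (Suc n). 0 < f x"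
      by (cases q) (auto simp: P_def)
    have e: "continuous_map (strip X (under B f)) X e" "inj_on e (under B f)" "\<And>x. x \<in> B \<Longrightarrow> e (x,0) = x"
      using pc by (auto simp: partial_collar_def)
    \<comment> \<open>The finished part of the collar, over \<open>C n\<close>. It is compact
      because \<open>f\<close> is bounded on the compact set \<open>C n\<close>, so its image can
      serve as the protected closed set.\<close>
    define Z where "Z = {p \<in> C n \<times> UNIV. 0 \<le> snd p \<and> snd p \<le> f (fst p)}"
    have ZD: "Z \<subseteq> under B f" using CX(2) by (auto simp: Z_def under_def)
    have "compactin (prod_topology X euclideanreal) Z"
    proof (cases "C n = {}")
      case False
      have CnX: "C n \<subseteq> topspace X" using CX(2) BX by blast
      have "compactin euclideanreal (f ` C n)" by (rule image_compactin[OF CX(1) f])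
      then obtain m where m: "\<And>x. x \<in> C n \<Longrightarrow> f x \<le> m"
        using compact_imp_bounded[THEN bounded_imp_bdd_above] by (fastforce simp: bdd_above_def)
      let ?E = "C n \<times> {0..m}"
      have "closedin (strip X ?E) {p \<in> ?E. snd p \<le> f (fst p)}"
        by (rule closedin_strip_le[OF continuous_map_strip_snd continuous_map_strip_comp_fst[OF f]]) (use CnX in auto)
      moreover have "{p \<in> ?E. snd p \<le> f (fst p)} = Z" using m by (fastforce simp: Z_def)
      moreover have "compact_space (strip X ?E)"
        by (rule compact_space_subtopology) (use CX(1) in \<open>auto simp: compactin_Times\<close>)
      ultimately have "compactin (strip X ?E) Z" using closedin_compact_space by metis
      then show ?thesis by (simp add: compactin_subtopology)
    qed (simp add: Z_def)
    then have "compactin (strip X (under B f)) Z" using ZD by (simp add: compactin_subtopology)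
    then have "compactin X (e ` Z)" by (rule image_compactin[OF _ e(1)])
    then have Lcl: "closedin X (e ` Z)" using haus compactin_imp_closedin by blast
    \<comment> \<open>Only this shell has to be treated, as \<open>f\<close> is already positive on
      \<open>C (Suc n)\<close>. Removing an interior keeps it compact.\<close>
    define A where "A = C (Suc (Suc n)) - ?Y interior_of C (Suc n)"
    have "compactin ?Y A"
      unfolding A_def
    proof (rule closed_compactin[OF C(1)[of "Suc (Suc n)"]])
      show "closedin ?Y (C (Suc (Suc n)) - ?Y interior_of C (Suc n))"
        by (rule closedin_diff[OF compactin_imp_closedin[OF hausY C(1)] openin_interior_of])
    qed simp
    then have A: "compactin X A" "A \<subseteq> B" by (auto simp: compactin_subtopology)
    \<comment> \<open>By injectivity a point of \<open>B\<close> on the collar is its own base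
      point, hence here a point of \<open>C n\<close>, which lies in the removed interior.\<close>
    have AL: "A \<inter> e ` Z = {}"
    proof (rule ccontr)
      assume "A \<inter> e ` Z \<noteq> {}"
      then obtain x s where xs: "(x,s) \<in> Z" "e (x,s) \<in> A" by auto
      then have yB: "e (x,s) \<in> B" using A(2) by blast
      then have "e (e (x,s), 0) = e (x,s)" by (rule e(3))
      then have "(e (x,s), 0) = (x,s)" using xs ZD yB f0 by (intro inj_onD[OF e(2)]) (auto simp: under_def)
      then have "e (x,s) \<in> C n" using xs by (auto simp: Z_def)
      then show False using xs(2) C(2)[of n] by (auto simp: A_def)
    qed
    obtain f' e' where r: "continuous_map X euclideanreal f'" "partial_collar X B f' e'" "\<forall>x\<in>B. f x \<le> f' x"
      "\<forall>x\<in>A. 0 < f' x" "\<forall>x\<in>B \<inter> e ` Z. f' x = f x"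
      "\<forall>x s. (x,s) \<in> under B f \<longrightarrow> x \<in> e ` Z \<longrightarrow> e (x,s) \<in> e ` Z \<longrightarrow> e' (x,s) = e (x,s)"
      using partial_collar_extend[OF haus X B lc f f0 pc A Lcl AL] by auto
    have "0 < f' x" if x: "x \<in> C (Suc (Suc n))" for x
    proof (cases "x \<in> A")
      case False
      then have "x \<in> C (Suc n)" using x interior_of_subset by (fastforce simp: A_def)
      then show ?thesis using fp r(3) CX(2) by (meson less_le_trans subsetD)
    qed (use r in auto)
    moreover have "0 \<le> f' x" if "x \<in> B" for x using r(3) f0 that by force
    ultimately have "P (Suc n) (f',e')" using r by (simp add: P_def)
    moreover have "R n q (f',e')"
    proof -
      have "f' x = f x \<and> (\<forall>s. (x,s) \<in> under B f \<longrightarrow> e' (x,s) = e (x,s))" if x: "x \<in> C n" for x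
      proof -
        have xB: "x \<in> B" using x CX(2) by blast
        have Zi: "(x,s) \<in> under B f \<Longrightarrow> (x,s) \<in> Z" for s using x by (auto simp: Z_def under_def)
        have "(x,0) \<in> Z" using x xB f0 by (auto simp: Z_def)
        then have xL: "x \<in> e ` Z" using e(3)[OF xB] by (metis imageI)
        show ?thesis using r(5,6) xL xB Zi by blast
      qed
      then show ?thesis by (simp add: R_def q)
    qed
    ultimately show "\<exists>q'. P (Suc n) q' \<and> R n q q'" by blast
  qed
  then obtain F where F: "\<And>n. P n (F n)" "\<And>n. R n (F n) (F (Suc n))" by metis
  define f where "f n = fst (F n)" for n
  define e where "e n = snd (F n)" for n
  have fe: "continuous_map X euclideanreal (f n)" "\<forall>x\<in>B. 0 \<le> f n x" "partial_collar X B (f n) (e n)"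
    "\<And>x. x \<in> C n \<Longrightarrow> 0 < f n x" for n
    using F(1)[of n] Cmono[of n "Suc n"] by (auto simp: P_def f_def e_def case_prod_unfold)
  have stepf: "f (Suc n) x = f n x" "\<And>s. (x,s) \<in> under B (f n) \<Longrightarrow> e (Suc n) (x,s) = e n (x,s)" if "x \<in> C n" for n x
    using F(2)[of n] that by (auto simp: R_def f_def e_def case_prod_unfold)
  have stab: "f m x = f n x \<and> (\<forall>s. (x,s) \<in> under B (f n) \<longrightarrow> e m (x,s) = e n (x,s))" if "n \<le> m" "x \<in> C n" for n m x
    using that(1)
  proof (induction m rule: dec_induct)
    case (step m)
    then have "x \<in> C m" using Cmono[of n m] that by auto
    then show ?case using stepf[of x m] step.IH by (auto simp: under_def)
  qed simp
  \<comment> \<open>Every index \<open>n\<close> with \<open>x\<close> in \<open>C n\<close> yields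
    the same fibre over \<open>x\<close>; the least one is a definite choice.\<close>
  define N where "N x = (LEAST n. x \<in> C n)" for x
  have N: "x \<in> C (N x)" "N x \<le> n" if "x \<in> C n" for x n
    using that unfolding N_def by (auto intro: LeastI Least_le)
  define h where "h = (\<lambda>(x,t). e (N x) (x, t * f (N x) x / 2))"
  have uI: "(x, t * f n x / 2) \<in> under B (f n)" if "x \<in> B" "0 \<le> t" "t < 2" for x t n
    using that fe(2)[of n] mult_right_mono[of t 2 "f n x"] by (auto simp: under_def)
  have hn: "h (x,t) = e n (x, t * f n x / 2)" if "x \<in> C n" "0 \<le> t" "t < 2" for x t n
    using stab[OF N(2)[OF that(1)] N(1)[OF that(1)]] uI[OF subsetD[OF CX(2) that(1)] that(2,3), of "N x"]
    by (auto simp: h_def)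
  let ?S = "strip X (B \<times> {0..<2})"
  let ?U = "\<lambda>n. ?Y interior_of C n"
  have UC: "?U n \<subseteq> C n" for n by (rule interior_of_subset)
  have Uo: "openin ?Y (?U n)" for n by simp
  have cov: "\<exists>n. x \<in> ?U n" if "x \<in> B" for x using that C(2,3) by blast
  have tS: "topspace ?S = B \<times> {0..<2}" using BX by auto
  have fstY: "continuous_map ?S ?Y fst"
    unfolding continuous_map_in_subtopology using continuous_map_strip_fst tS by fastforce
  have To: "openin ?S {p \<in> topspace ?S. fst p \<in> ?U n}" for n
    by (rule openin_continuous_map_preimage[OF fstY Uo])
  show ?thesis
  proof (rule collaredI[OF BX])
    show "continuous_map ?S X h"
    proof (rule pasting_lemma[where I = UNIV and T = "\<lambda>n. {p \<in> topspace ?S. fst p \<in> ?U n}"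
          and f = "\<lambda>n (x,t). e n (x, t * f n x / 2)"])
      show "continuous_map (subtopology ?S {p \<in> topspace ?S. fst p \<in> ?U n}) X (\<lambda>(x,t). e n (x, t * f n x / 2))" for n
        by (intro continuous_map_from_subtopology rescaled_continuous_map fe BX)
    next
      fix n m p assume p: "p \<in> topspace ?S \<inter> {p \<in> topspace ?S. fst p \<in> ?U n} \<inter> {p \<in> topspace ?S. fst p \<in> ?U m}"
      obtain x t where "p = (x,t)" by (cases p)
      then have "p = (x,t)" "x \<in> C n" "x \<in> C m" "0 \<le> t" "t < 2" using p UC tS by auto
      then show "(case p of (x,t) \<Rightarrow> e n (x, t * f n x / 2)) = (case p of (x,t) \<Rightarrow> e m (x, t * f m x / 2))"
        using hn[of x n t] hn[of x m t] by simp
    next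
      fix p assume p: "p \<in> topspace ?S"
      then obtain x t where xt: "p = (x,t)" "x \<in> B" "0 \<le> t" "t < 2" using tS by auto
      then obtain n where n: "x \<in> ?U n" using cov by blast
      then have "x \<in> C n" using UC by blast
      then show "\<exists>n. n \<in> UNIV \<and> p \<in> {p \<in> topspace ?S. fst p \<in> ?U n} \<and> h p = (case p of (x,t) \<Rightarrow> e n (x, t * f n x / 2))"
        using xt n p hn[of x n t] by (intro exI[of _ n]) simp
    qed (use To in auto)
    show "open_map ?S X h"
      unfolding open_map_def
    proof (intro allI impI)
      fix W assume W: "openin ?S W"
      define W' where "W' n = W \<inter> {p \<in> topspace ?S. fst p \<in> ?U n}" for n
      have WS: "W \<subseteq> B \<times> {0..<2}" using openin_subset[OF W] tS by simp
      have "openin X ((\<lambda>(x,t). e n (x, t * f n x / 2)) ` W' n)" for n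
      proof (rule rescaled_open_map[OF fe(3) BX fe(1) Uo])
        show "openin ?S (W' n)" unfolding W'_def using W To by (rule openin_Int)
        show "0 < f n x" if "x \<in> ?U n" for x using that UC fe(4) by blast
      qed (auto simp: W'_def)
      moreover have "(\<lambda>(x,t). e n (x, t * f n x / 2)) ` W' n = h ` W' n" for n
      proof (rule image_cong[OF refl])
        fix p assume p: "p \<in> W' n"
        obtain x t where "p = (x,t)" by (cases p)
        then have "p = (x,t)" "x \<in> C n" "0 \<le> t" "t < 2" using p UC WS by (auto simp: W'_def)
        then show "(case p of (x,t) \<Rightarrow> e n (x, t * f n x / 2)) = h p" using hn by simp
      qed
      ultimately have "openin X (\<Union>n. h ` W' n)" by (intro openin_Union) auto
      moreover have "W = (\<Union>n. W' n)"
      proof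
        show "W \<subseteq> (\<Union>n. W' n)"
        proof
          fix p assume p: "p \<in> W"
          then have "fst p \<in> B" using WS by auto
          then obtain n where "fst p \<in> ?U n" using cov by blast
          then show "p \<in> (\<Union>n. W' n)" using p WS tS by (auto simp: W'_def)
        qed
      qed (auto simp: W'_def)
      ultimately show "openin X (h ` W)" by (metis image_UN)
    qed
    show "inj_on h (B \<times> {0..<2})"
    proof (rule inj_onI)
      fix p q assume pq: "p \<in> B \<times> {0..<2}" "q \<in> B \<times> {0..<2}" "h p = h q"
      obtain x t y s where xy: "p = (x,t)" "q = (y,s)" by (cases p, cases q) auto
      then have b: "x \<in> B" "y \<in> B" "0 \<le> t" "t < 2" "0 \<le> s" "s < 2" using pq by auto
      obtain i j where ij: "x \<in> C i" "y \<in> C j" using b C(3) by blast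
      \<comment> \<open>Two base points always lie in a common stage, so injectivity of the limit is
        inherited from a single collar.\<close>
      define n where "n = max i j"
      have n: "x \<in> C n" "y \<in> C n" using ij Cmono[of i n] Cmono[of j n] by (auto simp: n_def)
      have "e n (x, t * f n x / 2) = e n (y, s * f n y / 2)"
        using pq(3) hn[OF n(1) b(3,4)] hn[OF n(2) b(5,6)] xy by simp
      then have "(x, t * f n x / 2) = (y, s * f n y / 2)"
        using fe(3)[of n] uI[OF b(1,3,4)] uI[OF b(2,5,6)] by (auto simp: partial_collar_def dest: inj_onD)
      then show "p = q" using xy fe(4)[OF n(1)] by auto
    qed
    show "h (x,0) = x" if "x \<in> B" for x
      using fe(3)[of "N x"] that by (auto simp: h_def partial_collar_def)
  qed
qed

section \<open>The boundary of a manifold\<close>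

text \<open>The height fills slot \<open>n - 1\<close>, the first one that
  \<open>Euclidean_space (n - 1)\<close> leaves zero. This places the half-space inside
  \<open>Euclidean_space n\<close>, where invariance of domain applies.\<close>

definition half_space_inclusion :: "nat \<Rightarrow> (nat \<Rightarrow> real) \<times> real \<Rightarrow> nat \<Rightarrow> real"
  where "half_space_inclusion n q = (\<lambda>i. if i < n then (if i = n - 1 then snd q else fst q i) else 0)"

lemma topspace_half_space: "topspace (half_space n) = topspace (Euclidean_space (n - 1)) \<times> {0..}"
  by (simp add: half_space_def)

lemma continuous_map_Euclidean_component: "continuous_map (Euclidean_space m) euclideanreal (\<lambda>x. x i)"
  unfolding Euclidean_space_def by (rule continuous_map_from_subtopology[OF continuous_map_product_projection]) simp

lemma continuous_map_half_space_snd: "continuous_map (half_space n) euclideanreal snd"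
  unfolding half_space_def
  by (rule continuous_map_into_fulltopology[where T = "{0..}"], rule continuous_map_snd)

lemma continuous_map_half_space_inclusion:
  "continuous_map (half_space n) (Euclidean_space n) (half_space_inclusion n)"
  unfolding half_space_inclusion_def continuous_map_componentwise_Euclidean_space
proof (intro allI impI)
  fix i
  have "continuous_map (half_space n) (Euclidean_space (n - 1)) fst"
    unfolding half_space_def by (rule continuous_map_fst)
  from continuous_map_compose[OF this continuous_map_Euclidean_component]
  have "continuous_map (half_space n) euclideanreal (\<lambda>q. fst q i)" by (simp add: o_def)
  then show "continuous_map (half_space n) euclideanreal (\<lambda>q. if i = n - 1 then snd q else fst q i)"
    using continuous_map_half_space_snd by (cases "i = n - 1") auto
qed

lemma inj_on_half_space_inclusion:
  assumes "n \<ge> 1"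
  shows "inj_on (half_space_inclusion n) (topspace (half_space n))"
proof (rule inj_onI)
  fix p q assume pq: "p \<in> topspace (half_space n)" "q \<in> topspace (half_space n)"
    "half_space_inclusion n p = half_space_inclusion n q"
  have "snd p = snd q" using fun_cong[OF pq(3), of "n - 1"] assms by (simp add: half_space_inclusion_def)
  moreover have "fst p i = fst q i" for i
  proof (cases "i < n - 1")
    case True
    then have "i < n" "i \<noteq> n - 1" by auto
    then show ?thesis using fun_cong[OF pq(3), of i] by (simp add: half_space_inclusion_def)
  next
    case False
    then show ?thesis using pq(1,2) by (auto simp: topspace_half_space topspace_Euclidean_space)
  qed
  ultimately show "p = q" by (simp add: prod_eq_iff fun_eq_iff)
qed

text \<open>An open image would contain points with slightly negative last coordinate near the image
  of \<open>(z,0)\<close>, while all heights in the half-space are nonnegative.\<close>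

lemma half_space_inclusion_image_not_open:
  assumes n: "n \<ge> 1" and S: "S \<subseteq> topspace (half_space n)" "(z,0) \<in> S"
  shows "\<not> openin (Euclidean_space n) (half_space_inclusion n ` S)"
proof
  assume o: "openin (Euclidean_space n) (half_space_inclusion n ` S)"
  have "continuous_map euclideanreal (Euclidean_space n) (\<lambda>s. half_space_inclusion n (z,s))"
    unfolding half_space_inclusion_def continuous_map_componentwise_Euclidean_space
  proof (intro allI impI)
    fix i
    show "continuous_map euclideanreal euclideanreal (\<lambda>s. if i = n - 1 then snd (z,s) else fst (z,s) i)"
      by (cases "i = n - 1") auto
  qed
  from openin_continuous_map_preimage[OF this o]
  have "open {s. half_space_inclusion n (z,s) \<in> half_space_inclusion n ` S}" by simp
  moreover have "0 \<in> {s. half_space_inclusion n (z,s) \<in> half_space_inclusion n ` S}" using S by blast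
  ultimately obtain d where d: "d > 0" "\<And>s. dist s 0 < d \<Longrightarrow> half_space_inclusion n (z,s) \<in> half_space_inclusion n ` S"
    unfolding open_dist by blast
  then have "half_space_inclusion n (z, -(d/2)) \<in> half_space_inclusion n ` S" by (simp add: dist_real_def)
  then obtain q where q: "q \<in> S" "half_space_inclusion n (z, -(d/2)) = half_space_inclusion n q" by blast
  have "snd q = -(d/2)" using fun_cong[OF q(2), of "n - 1"] n by (simp add: half_space_inclusion_def)
  moreover have "snd q \<ge> 0" using S(1) q(1) by (auto simp: topspace_half_space)
  ultimately show False using d by simp
qed

text \<open>Beyond index \<open>m\<close> all coordinates are zero, so only finitely many conditions
  remain. As a filter statement it combines with other smallness conditions on
  \<open>\<epsilon>\<close>; the factor 2 anticipates the bound 2 on the absolute value of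
  \<open>arctan\<close>.\<close>

lemma Euclidean_box_in_open:
  assumes U: "openin (Euclidean_space m) U" and z: "z \<in> U"
  shows "\<forall>\<^sub>F \<epsilon> in at_right (0::real). \<forall>w\<in>topspace (Euclidean_space m). (\<forall>i<m. \<bar>w i - z i\<bar> < 2 * \<epsilon>) \<longrightarrow> w \<in> U"
proof -
  obtain U' where U': "openin (powertop_real UNIV) U'" "U = U' \<inter> {x. \<forall>i\<ge>m. x i = 0}"
    using U by (auto simp: Euclidean_space_def openin_subtopology)
  then have "\<exists>V. finite {i. V i \<noteq> UNIV} \<and> (\<forall>i. open (V i)) \<and> (\<forall>i. z i \<in> V i) \<and> Pi\<^sub>E UNIV V \<subseteq> U'"
    using z unfolding openin_product_topology_alt by (auto simp: PiE_iff)
  then obtain V where V: "\<And>i. open (V i)" "\<And>i. z i \<in> V i" "Pi\<^sub>E UNIV V \<subseteq> U'"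
    by blast
  have ev: "\<forall>\<^sub>F \<epsilon> in at_right 0. \<forall>y. \<bar>y - z i\<bar> < 2 * \<epsilon> \<longrightarrow> y \<in> V i" for i
  proof -
    obtain d where d: "d > 0" "\<And>y. dist y (z i) < d \<Longrightarrow> y \<in> V i"
      using V(1,2) unfolding open_dist by metis
    show ?thesis
      unfolding eventually_at_right_field
      by (intro exI[of _ "d/2"]) (use d in \<open>auto simp: dist_real_def\<close>)
  qed
  have "\<forall>\<^sub>F \<epsilon> in at_right 0. \<forall>i\<in>{..<m}. \<forall>y. \<bar>y - z i\<bar> < 2 * \<epsilon> \<longrightarrow> y \<in> V i"
    by (rule eventually_ball_finite) (use ev in auto)
  then show ?thesis
  proof (rule eventually_mono, intro ballI impI)
    fix \<epsilon> w assume \<epsilon>: "\<forall>i\<in>{..<m}. \<forall>y. \<bar>y - z i\<bar> < 2 * \<epsilon> \<longrightarrow> y \<in> V i"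
      and w: "w \<in> topspace (Euclidean_space m)" "\<forall>i<m. \<bar>w i - z i\<bar> < 2 * \<epsilon>"
    have "w i \<in> V i" for i
    proof (cases "i < m")
      case False
      then have "w i = z i" using w z U'(2) by (auto simp: topspace_Euclidean_space)
      then show ?thesis using V(2) by simp
    qed (use \<epsilon> w in auto)
    then show "w \<in> U" using V(3) w U'(2) by (auto simp: topspace_Euclidean_space)
  qed
qed

text \<open>The boundary is defined through neighbourhoods homeomorphic to all of Euclidean space,
  so \<open>arctan\<close> in each coordinate is used to shrink the whole space into a small box
  around \<open>(z,t)\<close>. The map is open by invariance of domain, pulled back along
  \<open>half_space_inclusion\<close>.\<close>

lemma Euclidean_neighbourhood_in_half_space:
  assumes n: "n \<ge> 1" and A: "openin (half_space n) A" and zt: "(z,t) \<in> A" and t: "t > 0"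
  shows "\<exists>F. continuous_map (Euclidean_space n) (half_space n) F \<and> open_map (Euclidean_space n) (half_space n) F \<and>
    inj_on F (topspace (Euclidean_space n)) \<and> (z,t) \<in> F ` topspace (Euclidean_space n) \<and>
    F ` topspace (Euclidean_space n) \<subseteq> A"
proof -
  let ?E = "Euclidean_space n" and ?E' = "Euclidean_space (n - 1)"
  obtain U I where UI: "openin ?E' U" "openin (top_of_set {0..}) I" "z \<in> U" "t \<in> I" "U \<times> I \<subseteq> A"
    using A zt unfolding half_space_def openin_prod_topology_alt by metis
  obtain I' where I': "open I'" "I = {0..} \<inter> I'" using UI(2) by (auto simp: openin_open)
  then obtain d where d: "d > 0" "\<And>s. dist s t < d \<Longrightarrow> s \<in> I'" using UI(4) unfolding open_dist by blast
  have "\<forall>\<^sub>F \<epsilon> in at_right (0::real). \<epsilon> \<in> {0<..<min d t / 2}"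
    using d t by (intro eventually_at_right_real) auto
  then have "\<forall>\<^sub>F \<epsilon> in at_right (0::real). \<epsilon> < min d t / 2" by (rule eventually_mono) simp
  then have "\<forall>\<^sub>F \<epsilon> in at_right 0. \<epsilon> < min d t / 2 \<and> \<epsilon> > 0 \<and>
      (\<forall>w\<in>topspace ?E'. (\<forall>i<n - 1. \<bar>w i - z i\<bar> < 2 * \<epsilon>) \<longrightarrow> w \<in> U)"
    by (intro eventually_conj Euclidean_box_in_open[OF UI(1,3)] eventually_at_right_less)
  \<comment> \<open>With \<open>2 * \<epsilon>\<close> below both \<open>d\<close> and
    \<open>t\<close>, all heights in the box are positive and lie in \<open>I\<close>.\<close>
  then obtain \<epsilon> where \<epsilon>: "\<epsilon> < min d t / 2" "\<epsilon> > 0"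
      "\<And>w. w \<in> topspace ?E' \<Longrightarrow> (\<And>i. i < n - 1 \<Longrightarrow> \<bar>w i - z i\<bar> < 2 * \<epsilon>) \<Longrightarrow> w \<in> U"
    using eventually_happens'[OF trivial_limit_at_right_real] by blast
  have small: "\<bar>\<epsilon> * arctan y\<bar> < 2 * \<epsilon>" for y
  proof -
    have "\<bar>arctan y\<bar> < 2" using arctan_bounded[of y] pi_less_4 by auto
    then show ?thesis using \<epsilon>(2) by (simp add: abs_mult)
  qed
  define F where "F x = (\<lambda>i. if i < n - 1 then z i + \<epsilon> * arctan (x i) else 0, t + \<epsilon> * arctan (x (n - 1)))" for x :: "nat \<Rightarrow> real"
  have arc: "continuous_map ?E euclideanreal (\<lambda>x. arctan (x i))" for i
    using continuous_map_compose[OF continuous_map_Euclidean_component, of euclideanreal arctan n i]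
    by (simp add: o_def continuous_on_arctan continuous_on_id)
  have z': "z \<in> topspace ?E'" using UI openin_subset by blast
  have Fpos: "t + \<epsilon> * arctan y \<ge> 0" for y using small[of y] \<epsilon>(1) by auto
  have cF: "continuous_map ?E (half_space n) F"
    unfolding F_def half_space_def
  proof (intro continuous_map_pairedI)
    show "continuous_map ?E ?E' (\<lambda>x i. if i < n - 1 then z i + \<epsilon> * arctan (x i) else 0)"
      unfolding continuous_map_componentwise_Euclidean_space
      by (intro allI impI continuous_map_add continuous_map_real_mult_left arc) auto
    have "continuous_map ?E euclideanreal (\<lambda>x. t + \<epsilon> * arctan (x (n - 1)))"
      by (intro continuous_map_add continuous_map_real_mult_left arc) auto
    then show "continuous_map ?E (top_of_set {0..}) (\<lambda>x. t + \<epsilon> * arctan (x (n - 1)))"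
      using Fpos by (auto simp: continuous_map_in_subtopology)
  qed
  have iF: "inj_on F (topspace ?E)"
  proof (rule inj_onI)
    fix x y assume xy: "x \<in> topspace ?E" "y \<in> topspace ?E" "F x = F y"
    have "x i = y i" for i
    proof -
      consider "i < n - 1" | "i = n - 1" | "i \<ge> n" using n by linarith
      then show ?thesis
      proof cases
        case 1
        then have "z i + \<epsilon> * arctan (x i) = z i + \<epsilon> * arctan (y i)"
          using arg_cong[OF xy(3), of "\<lambda>q. fst q i"] by (simp add: F_def)
        then have "arctan (x i) = arctan (y i)" using \<epsilon>(2) by simp
        then show ?thesis by (metis tan_arctan)
      next
        case 2
        then have "arctan (x i) = arctan (y i)" using xy(3) \<epsilon>(2) by (simp add: F_def)
        then show ?thesis by (metis tan_arctan)
      qed (use xy in \<open>auto simp: topspace_Euclidean_space\<close>)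
    qed
    then show "x = y" by blast
  qed
  let ?J = "half_space_inclusion n"
  have FX: "F x \<in> topspace (half_space n)" if "x \<in> topspace ?E" for x
    using continuous_map_image_subset_topspace[OF cF] that by blast
  have "open_map ?E (half_space n) F"
    unfolding open_map_def
  proof (intro allI impI)
    fix W assume W: "openin ?E W"
    have WE: "W \<subseteq> topspace ?E" using W openin_subset by blast
    have "openin ?E ((?J \<circ> F) ` W)"
    proof (rule invariance_of_domain_Euclidean_space[OF W])
      show "continuous_map (subtopology ?E W) ?E (?J \<circ> F)"
        by (intro continuous_map_from_subtopology continuous_map_compose[OF cF] continuous_map_half_space_inclusion)
      show "inj_on (?J \<circ> F) W"
        using inj_on_subset[OF iF WE] FX WE
        by (intro comp_inj_on inj_on_subset[OF inj_on_half_space_inclusion[OF n]]) auto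
    qed
    from openin_continuous_map_preimage[OF continuous_map_half_space_inclusion this]
    have "openin (half_space n) {q \<in> topspace (half_space n). ?J q \<in> (?J \<circ> F) ` W}" .
    moreover have "{q \<in> topspace (half_space n). ?J q \<in> (?J \<circ> F) ` W} = F ` W"
    proof (intro equalityI subsetI)
      fix q assume "q \<in> {q \<in> topspace (half_space n). ?J q \<in> (?J \<circ> F) ` W}"
      then obtain x where x: "q \<in> topspace (half_space n)" "x \<in> W" "?J q = ?J (F x)" by auto
      then have "q = F x" using inj_onD[OF inj_on_half_space_inclusion[OF n]] FX WE by blast
      then show "q \<in> F ` W" using x by blast
    qed (use FX WE in auto)
    ultimately show "openin (half_space n) (F ` W)" by simp
  qed
  moreover have "(z,t) \<in> F ` topspace ?E"
  proof
    show "(\<lambda>i. 0) \<in> topspace ?E" by (simp add: topspace_Euclidean_space)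
    show "(z,t) = F (\<lambda>i. 0)" using z' by (auto simp: F_def topspace_Euclidean_space not_less)
  qed
  moreover have "F ` topspace ?E \<subseteq> A"
  proof
    fix q assume "q \<in> F ` topspace ?E"
    then obtain x where x: "x \<in> topspace ?E" "q = F x" by blast
    have "fst (F x) \<in> topspace ?E'" by (simp add: F_def topspace_Euclidean_space)
    moreover have "\<bar>fst (F x) i - z i\<bar> < 2 * \<epsilon>" if "i < n - 1" for i using that small by (simp add: F_def)
    ultimately have "fst (F x) \<in> U" using \<epsilon>(3) by blast
    moreover have "snd (F x) \<in> I"
      using small[of "x (n - 1)"] \<epsilon>(1) d(2)[of "snd (F x)"] Fpos I'(2) by (auto simp: F_def dist_real_def)
    ultimately show "q \<in> A" using UI(5) x by (metis SigmaI prod.collapse subsetD)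
  qed
  ultimately show ?thesis using cF iF by blast
qed

section \<open>Charts and the boundary\<close>

text \<open>Above the bottom, a Euclidean piece of the half-space is carried back to a neighbourhood
  of \<open>p\<close>. At the bottom, a Euclidean neighbourhood of \<open>p\<close> would by
  invariance of domain make some set of half-space points containing one of height 0 open in
  \<open>Euclidean_space n\<close>, which is impossible.\<close>

lemma boundary_iff_chart:
  assumes n: "n \<ge> 1" and N: "N \<subseteq> topspace M" and \<phi>: "homeomorphic_map (subtopology M N) (half_space n) \<phi>"
    and p: "p \<in> M interior_of N"
  shows "p \<in> boundary n M \<longleftrightarrow> snd (\<phi> p) = 0"
proof -
  have tN: "topspace (subtopology M N) = N" using N by auto
  have IN: "M interior_of N \<subseteq> N" by (rule interior_of_subset)
  have \<phi>': "continuous_map (subtopology M N) (half_space n) \<phi>" "open_map (subtopology M N) (half_space n) \<phi>"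
    "\<phi> ` N = topspace (half_space n)" "inj_on \<phi> N"
    using \<phi> tN by (auto simp: homeomorphic_eq_everything_map)
  obtain \<psi> where "homeomorphic_maps (subtopology M N) (half_space n) \<phi> \<psi>"
    using \<phi> homeomorphic_map_maps by blast
  then have \<psi>: "homeomorphic_map (half_space n) (subtopology M N) \<psi>" "\<And>x. x \<in> N \<Longrightarrow> \<psi> (\<phi> x) = x"
    "\<And>q. q \<in> topspace (half_space n) \<Longrightarrow> \<phi> (\<psi> q) = q"
    using tN by (auto simp: homeomorphic_maps_map)
  have pX: "p \<in> topspace M" using p N IN by blast
  have \<phi>p: "\<phi> p \<in> topspace (half_space n)" using \<phi>'(3) p IN by blast
  obtain z t where zt: "\<phi> p = (z,t)" by (cases "\<phi> p")
  show ?thesis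
  proof
    assume b: "p \<in> boundary n M"
    show "snd (\<phi> p) = 0"
    proof (rule ccontr)
      assume "snd (\<phi> p) \<noteq> 0"
      then have t: "t > 0" using \<phi>p zt by (auto simp: topspace_half_space)
      have "openin (subtopology M N) (M interior_of N)"
        using IN by (metis inf.absorb_iff1 openin_interior_of openin_subtopology)
      then have oA: "openin (half_space n) (\<phi> ` (M interior_of N))" using \<phi>'(2) by (simp add: open_map_def)
      have "(z,t) \<in> \<phi> ` (M interior_of N)" using p zt by (metis imageI)
      from Euclidean_neighbourhood_in_half_space[OF n oA this t] obtain F where
        F: "continuous_map (Euclidean_space n) (half_space n) F" "open_map (Euclidean_space n) (half_space n) F"
          "inj_on F (topspace (Euclidean_space n))" "(z,t) \<in> F ` topspace (Euclidean_space n)"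
          "F ` topspace (Euclidean_space n) \<subseteq> \<phi> ` (M interior_of N)" by blast
      let ?S = "F ` topspace (Euclidean_space n)"
      have So: "openin (half_space n) ?S" using F(2) unfolding open_map_def by simp
      have "Euclidean_space n homeomorphic_space subtopology (half_space n) ?S"
        using embedding_map_imp_homeomorphic_space[OF injective_open_imp_embedding_map[OF F(1,2,3)]] .
      moreover have \<psi>S: "\<psi> ` ?S \<subseteq> M interior_of N"
      proof
        fix x assume "x \<in> \<psi> ` ?S"
        then obtain q where q: "x = \<psi> q" "q \<in> ?S" by (rule imageE)
        from subsetD[OF F(5) q(2)] obtain y where y: "q = \<phi> y" "y \<in> M interior_of N" by (rule imageE)
        have "x = y" unfolding q(1) y(1) by (rule \<psi>(2)[OF subsetD[OF IN y(2)]])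
        then show "x \<in> M interior_of N" using y(2) by simp
      qed
      have "subtopology (half_space n) ?S homeomorphic_space subtopology (subtopology M N) (\<psi> ` ?S)"
      proof (rule homeomorphic_map_imp_homeomorphic_space, rule homeomorphic_map_subtopologies[OF \<psi>(1)])
        have "?S \<subseteq> topspace (half_space n)" using So openin_subset by blast
        then show "\<psi> ` (topspace (half_space n) \<inter> ?S) = topspace (subtopology M N) \<inter> \<psi> ` ?S"
          using \<psi>S IN tN by (metis inf.absorb2 subset_trans)
      qed
      moreover have "subtopology (subtopology M N) (\<psi> ` ?S) = subtopology M (\<psi> ` ?S)"
        using \<psi>S IN by (metis inf.absorb2 subset_trans subtopology_subtopology)
      ultimately have hom: "subtopology M (\<psi> ` ?S) homeomorphic_space Euclidean_space n"
        by (metis homeomorphic_space_sym homeomorphic_space_trans)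
      have "openin (subtopology M N) (\<psi> ` ?S)"
        using So homeomorphic_imp_open_map[OF \<psi>(1)] by (simp add: open_map_def)
      then obtain H where "openin M H" "\<psi> ` ?S = H \<inter> N" by (auto simp: openin_subtopology)
      \<comment> \<open>\<open>N\<close> is a neighbourhood that need not be open, so relative
        openness alone is not enough; it gives openness in \<open>M\<close> because the set lies in
        the interior of \<open>N\<close>.\<close>
      then have "openin M H" "\<psi> ` ?S = H \<inter> M interior_of N" using \<psi>S IN by blast+
      then have "openin M (\<psi> ` ?S)" by (metis openin_Int openin_interior_of)
      moreover have "p \<in> \<psi> ` ?S" using F(4) \<psi>(2)[of p] p IN zt by (metis imageI subsetD)
      ultimately have "nbhd M p (\<psi> ` ?S)"
        unfolding nbhd_def using openin_subset by (metis interior_of_openin)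
      then show False using b hom unfolding boundary_def by blast
    qed
  next
    assume "snd (\<phi> p) = 0"
    then have t: "t = 0" using zt by simp
    show "p \<in> boundary n M"
    proof (rule ccontr)
      assume "p \<notin> boundary n M"
      then obtain N' where N': "nbhd M p N'" "subtopology M N' homeomorphic_space Euclidean_space n"
        using pX unfolding boundary_def by blast
      then obtain g h where gh: "homeomorphic_maps (subtopology M N') (Euclidean_space n) g h"
        unfolding homeomorphic_space_def by blast
      have N'X: "N' \<subseteq> topspace M" "p \<in> M interior_of N'" using N' by (auto simp: nbhd_def)
      then have tN': "topspace (subtopology M N') = N'" by auto
      have g: "homeomorphic_map (subtopology M N') (Euclidean_space n) g" "continuous_map (Euclidean_space n) (subtopology M N') h"
        "\<And>x. x \<in> N' \<Longrightarrow> h (g x) = x" "\<And>y. y \<in> topspace (Euclidean_space n) \<Longrightarrow> g (h y) = y"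
        using gh tN' homeomorphic_maps_map by (auto simp: homeomorphic_maps_map homeomorphic_imp_continuous_map)
      \<comment> \<open>The two charts are compared on their common interior, which is open in
        \<open>M\<close>.\<close>
      define R where "R = M interior_of N \<inter> M interior_of N'"
      have R: "openin M R" "R \<subseteq> N" "R \<subseteq> N'" "p \<in> R"
        using p N'X interior_of_subset by (fastforce simp: R_def)+
      have "openin (subtopology M N') R" using R by (metis inf.absorb_iff1 openin_subtopology)
      then have gR: "openin (Euclidean_space n) (g ` R)"
        using homeomorphic_imp_open_map[OF g(1)] by (simp add: open_map_def)
      let ?G = "half_space_inclusion n \<circ> (\<phi> \<circ> h)"
      have hgR: "h ` g ` R = R" using g(3) R(3) by (force simp: image_iff)
      have "openin (Euclidean_space n) (?G ` (g ` R))"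
      proof (rule invariance_of_domain_Euclidean_space[OF gR])
        have "continuous_map (subtopology (Euclidean_space n) (g ` R)) M h"
          by (rule continuous_map_from_subtopology, rule continuous_map_into_fulltopology[OF g(2)])
        then have "continuous_map (subtopology (Euclidean_space n) (g ` R)) (subtopology M N) h"
          unfolding continuous_map_in_subtopology using hgR R(2) by auto
        then show "continuous_map (subtopology (Euclidean_space n) (g ` R)) (Euclidean_space n) ?G"
          using \<phi>'(1) continuous_map_half_space_inclusion by (metis continuous_map_compose)
        have "inj_on h (g ` R)"
        proof (rule inj_on_inverseI[where g = g])
          fix y assume "y \<in> g ` R"
          then obtain x where "y = g x" "x \<in> R" by (rule imageE)
          then show "g (h y) = y" using g(3)[OF subsetD[OF R(3)]] by simp
        qed
        moreover have "inj_on \<phi> (h ` g ` R)" using \<phi>'(4) R(2) hgR by (simp add: inj_on_subset)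
        moreover have "inj_on (half_space_inclusion n) (\<phi> ` h ` g ` R)"
          using \<phi>'(3) R(2) hgR by (intro inj_on_subset[OF inj_on_half_space_inclusion[OF n]]) auto
        ultimately show "inj_on ?G (g ` R)" by (simp add: comp_inj_on image_comp)
      qed
      moreover have "?G ` (g ` R) = half_space_inclusion n ` (\<phi> ` R)" by (simp only: image_comp[symmetric] hgR)
      moreover have "\<phi> ` R \<subseteq> topspace (half_space n)" using \<phi>'(3) R(2) by blast
      moreover have "(z,0) \<in> \<phi> ` R" using zt t R(4) by (metis imageI)
      ultimately show False using half_space_inclusion_image_not_open[OF n] by metis
    qed
  qed
qed

lemma second_countable_euclidean: "second_countable (euclidean :: 'a::second_countable_topology topology)"
proof -
  obtain \<B> :: "'a set set" where \<B>: "countable \<B>" "topological_basis \<B>"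
    using ex_countable_basis by blast
  show ?thesis
    unfolding second_countable_def
  proof (intro exI[of _ \<B>] conjI ballI allI impI \<B>(1))
    show "openin euclidean V" if "V \<in> \<B>" for V using topological_basis_open[OF \<B>(2) that] by simp
    show "\<exists>V\<in>\<B>. x \<in> V \<and> V \<subseteq> U" if "openin euclidean U \<and> x \<in> U" for U x
      using topological_basisE[OF \<B>(2), of U x] that by (metis open_openin)
  qed
qed

lemma half_space_locally_compact_second_countable:
  "locally_compact_space (half_space n)" "second_countable (half_space n)"
proof -
  have E: "second_countable (Euclidean_space m)" for m
    unfolding Euclidean_space_def euclidean_product_topology
    by (intro second_countable_subtopology second_countable_euclidean)
  have "second_countable (top_of_set {0::real..})"
    by (intro second_countable_subtopology second_countable_euclidean)
  then obtain \<B>2 where b2: "countable \<B>2 \<and> (\<forall>V\<in>\<B>2. openin (top_of_set {0::real..}) V) \<and>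
      (\<forall>U x. openin (top_of_set {0::real..}) U \<and> x \<in> U \<longrightarrow> (\<exists>V\<in>\<B>2. x \<in> V \<and> V \<subseteq> U))"
    unfolding second_countable_def ..
  obtain \<B>1 where b1: "countable \<B>1 \<and> (\<forall>V\<in>\<B>1. openin (Euclidean_space (n - 1)) V) \<and>
      (\<forall>U x. openin (Euclidean_space (n - 1)) U \<and> x \<in> U \<longrightarrow> (\<exists>V\<in>\<B>1. x \<in> V \<and> V \<subseteq> U))"
    using E[of "n - 1"] unfolding second_countable_def ..
  have b1': "\<exists>V\<in>\<B>1. x \<in> V \<and> V \<subseteq> U" if "openin (Euclidean_space (n - 1)) U" "x \<in> U" for x U
    using b1[THEN conjunct2, THEN conjunct2, rule_format, OF conjI, OF that] .
  have b2': "\<exists>V\<in>\<B>2. x \<in> V \<and> V \<subseteq> U" if "openin (top_of_set {0::real..}) U" "x \<in> U" for x U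
    using b2[THEN conjunct2, THEN conjunct2, rule_format, OF conjI, OF that] .
  show "second_countable (half_space n)"
    unfolding second_countable_def
  proof (intro exI conjI ballI allI impI)
    show "countable ((\<lambda>(U,V). U \<times> V) ` (\<B>1 \<times> \<B>2))" using b1 b2 by simp
    show "openin (half_space n) V" if "V \<in> (\<lambda>(U,V). U \<times> V) ` (\<B>1 \<times> \<B>2)" for V
    proof -
      from that obtain q where q: "V = (case q of (U,V) \<Rightarrow> U \<times> V)" "q \<in> \<B>1 \<times> \<B>2" by (rule imageE)
      obtain V1 V2 where "q = (V1,V2)" by (cases q)
      then have "V = V1 \<times> V2" "V1 \<in> \<B>1" "V2 \<in> \<B>2" using q by simp_all
      then show ?thesis using b1 b2 by (simp add: half_space_def openin_prod_Times_iff)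
    qed
    fix U q assume "openin (half_space n) U \<and> q \<in> U"
    then have oU: "openin (prod_topology (Euclidean_space (n - 1)) (top_of_set {0..})) U" and "(fst q, snd q) \<in> U"
      by (simp_all add: half_space_def)
    from openin_prod_topology_alt[THEN iffD1, rule_format, OF this]
    have "\<exists>U1 U2. openin (Euclidean_space (n - 1)) U1 \<and> openin (top_of_set {0..}) U2 \<and>
        fst q \<in> U1 \<and> snd q \<in> U2 \<and> U1 \<times> U2 \<subseteq> U" .
    then obtain U1 U2 where U: "openin (Euclidean_space (n - 1)) U1" "openin (top_of_set {0..}) U2"
      "fst q \<in> U1" "snd q \<in> U2" "U1 \<times> U2 \<subseteq> U"
      by metis
    obtain V1 where V1: "V1 \<in> \<B>1" "fst q \<in> V1" "V1 \<subseteq> U1" using b1'[OF U(1,3)] by metis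
    obtain V2 where V2: "V2 \<in> \<B>2" "snd q \<in> V2" "V2 \<subseteq> U2" using b2'[OF U(2,4)] by metis
    show "\<exists>V\<in>(\<lambda>(U,V). U \<times> V) ` (\<B>1 \<times> \<B>2). q \<in> V \<and> V \<subseteq> U"
    proof (intro bexI conjI)
      show "q \<in> V1 \<times> V2" using V1 V2 by (simp add: mem_Times_iff)
      show "V1 \<times> V2 \<subseteq> U" using V1 V2 U(5) by blast
      show "V1 \<times> V2 \<in> (\<lambda>(U,V). U \<times> V) ` (\<B>1 \<times> \<B>2)" using V1 V2 by auto
    qed
  qed
  have "locally_compact_space (top_of_set {0::real..})"
    by (rule locally_compact_space_closed_subset) (auto simp: locally_compact_space_euclidean)
  then show "locally_compact_space (half_space n)"
    unfolding half_space_def by (simp add: locally_compact_space_prod_topology locally_compact_Euclidean_space)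
qed

section \<open>Local properties of manifolds and collars inside charts\<close>

context
  fixes n :: nat and M :: "'a topology"
  assumes n: "n \<ge> 1" and M: "manifold n M"
begin

lemma manifold_chart:
  assumes "p \<in> topspace M"
  obtains N \<phi> \<psi> where "N \<subseteq> topspace M" "p \<in> M interior_of N"
    "homeomorphic_map (subtopology M N) (half_space n) \<phi>" "homeomorphic_map (half_space n) (subtopology M N) \<psi>"
    "\<forall>x\<in>N. \<psi> (\<phi> x) = x" "\<forall>q\<in>topspace (half_space n). \<phi> (\<psi> q) = q"
proof -
  obtain N where N: "nbhd M p N" "subtopology M N homeomorphic_space half_space n"
    using M assms unfolding manifold_def by blast
  then obtain \<phi> \<psi> where h: "homeomorphic_maps (subtopology M N) (half_space n) \<phi> \<psi>"
    unfolding homeomorphic_space_def by blast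
  have NX: "N \<subseteq> topspace M" "p \<in> M interior_of N" using N(1) by (auto simp: nbhd_def)
  then have "topspace (subtopology M N) = N" by auto
  then show thesis using h NX by (intro that[of N \<phi> \<psi>]) (auto simp: homeomorphic_maps_map)
qed

lemma boundary_subset: "boundary n M \<subseteq> topspace M"
  by (auto simp: boundary_def)

lemma closedin_boundary: "closedin M (boundary n M)"
  unfolding closedin_def
proof (intro conjI boundary_subset)
  show "openin M (topspace M - boundary n M)"
  proof (subst openin_subopen, intro ballI)
    fix p assume "p \<in> topspace M - boundary n M"
    then obtain N where N: "nbhd M p N" "subtopology M N homeomorphic_space Euclidean_space n"
      by (auto simp: boundary_def)
    have "q \<in> topspace M - boundary n M" if q: "q \<in> M interior_of N" for q
    proof -
      have "nbhd M q N" using N(1) q by (auto simp: nbhd_def)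
      then show ?thesis using N(2) q interior_of_subset_topspace[of M N] by (auto simp: boundary_def)
    qed
    then show "\<exists>T. openin M T \<and> p \<in> T \<and> T \<subseteq> topspace M - boundary n M"
      using N(1) by (intro exI[of _ "M interior_of N"]) (auto simp: nbhd_def)
  qed
qed

lemma Hausdorff_manifold: "Hausdorff_space M"
  using M by (simp add: manifold_def)

lemma locally_compact_manifold: "locally_compact_space M"
  unfolding locally_compact_space_def
proof
  fix p assume "p \<in> topspace M"
  then obtain N \<phi> \<psi> where N: "N \<subseteq> topspace M" "p \<in> M interior_of N" "homeomorphic_map (subtopology M N) (half_space n) \<phi>"
    by (rule manifold_chart)
  have "locally_compact_space (subtopology M N)"
    using homeomorphic_locally_compact_space[OF homeomorphic_map_imp_homeomorphic_space[OF N(3)]]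
      half_space_locally_compact_second_countable by simp
  moreover have "p \<in> topspace (subtopology M N)" using N interior_of_subset by fastforce
  ultimately obtain U K where U: "openin (subtopology M N) U" "compactin (subtopology M N) K" "p \<in> U" "U \<subseteq> K"
    unfolding locally_compact_space_def by blast
  then obtain U' where U': "openin M U'" "U = U' \<inter> N" by (auto simp: openin_subtopology)
  show "\<exists>U K. openin M U \<and> compactin M K \<and> p \<in> U \<and> U \<subseteq> K"
  proof (intro exI conjI)
    show "openin M (U' \<inter> M interior_of N)" using U' by (intro openin_Int) auto
    show "compactin M K" using U by (simp add: compactin_subtopology)
    show "p \<in> U' \<inter> M interior_of N" using U U' N by blast
    show "U' \<inter> M interior_of N \<subseteq> K" using U U' interior_of_subset[of M N] by blast
  qed
qed

lemma second_countable_neighbourhood: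
  assumes "p \<in> topspace M"
  shows "\<exists>U. openin M U \<and> p \<in> U \<and> second_countable (subtopology M U)"
proof -
  obtain N \<phi> \<psi> where N: "N \<subseteq> topspace M" "p \<in> M interior_of N" "homeomorphic_map (subtopology M N) (half_space n) \<phi>"
    using assms by (rule manifold_chart)
  have "second_countable (subtopology M N)"
    using homeomorphic_space_second_countability[OF homeomorphic_map_imp_homeomorphic_space[OF N(3)]]
      half_space_locally_compact_second_countable by simp
  then have "second_countable (subtopology (subtopology M N) (M interior_of N))"
    by (rule second_countable_subtopology)
  moreover have "subtopology (subtopology M N) (M interior_of N) = subtopology M (M interior_of N)"
    by (simp add: subtopology_subtopology Int_absorb1 interior_of_subset)
  ultimately show ?thesis using N(2) by (intro exI[of _ "M interior_of N"]) simp
qed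

text \<open>\<open>S\<close> is arbitrary because this serves for the interior, for the boundary and
  for all of \<open>M\<close>.\<close>

lemma second_countable_Lindelof_subspace:
  assumes "Lindelof_space (subtopology M S)"
  shows "second_countable (subtopology M S)"
proof (rule Lindelof_locally_second_countable_imp_second_countable[OF assms])
  fix x assume x: "x \<in> topspace (subtopology M S)"
  then have "x \<in> topspace M" by simp
  from second_countable_neighbourhood[OF this]
  obtain U where U: "openin M U" "x \<in> U" "second_countable (subtopology M U)" by metis
  have "subtopology (subtopology M S) (S \<inter> U) = subtopology (subtopology M U) S"
    by (simp add: subtopology_subtopology Int_ac)
  then show "\<exists>U. openin (subtopology M S) U \<and> x \<in> U \<and> second_countable (subtopology (subtopology M S) U)"
    using U x second_countable_subtopology[OF U(3), of S]
    by (intro exI[of _ "S \<inter> U"]) (auto simp: openin_subtopology_Int2)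
qed

text \<open>In a chart the local collar is vertical motion over a compact \<open>C\<close> up to
  height \<open>r\<close>. The box over \<open>C\<close> stays in the image of the interior of
  \<open>N\<close>, where height 0 characterizes the boundary and openness relative to
  \<open>N\<close> gives openness in \<open>M\<close>.\<close>

lemma locally_collarable_boundary: "locally_collarable M (boundary n M)"
  unfolding locally_collarable_def
proof
  let ?B = "boundary n M" and ?E = "Euclidean_space (n - 1)"
  fix b assume b: "b \<in> ?B"
  then have "b \<in> topspace M" using boundary_subset by blast
  then obtain N \<phi> \<psi> where N: "N \<subseteq> topspace M" "b \<in> M interior_of N"
    and \<phi>: "homeomorphic_map (subtopology M N) (half_space n) \<phi>"
    and \<psi>: "homeomorphic_map (half_space n) (subtopology M N) \<psi>"
    and inv: "\<forall>x\<in>N. \<psi> (\<phi> x) = x" "\<forall>q\<in>topspace (half_space n). \<phi> (\<psi> q) = q"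
    by (rule manifold_chart)
  have \<psi>\<phi>: "\<psi> (\<phi> x) = x" if "x \<in> N" for x using inv(1) that ..
  have \<phi>\<psi>: "\<phi> (\<psi> q) = q" if "q \<in> topspace (half_space n)" for q using inv(2) that ..
  let ?I = "M interior_of N"
  have IN: "?I \<subseteq> N" by (rule interior_of_subset)
  have bd: "p \<in> ?B \<longleftrightarrow> snd (\<phi> p) = 0" if "p \<in> ?I" for p
    using boundary_iff_chart[OF n N(1) \<phi> that] .
  have tN: "topspace (subtopology M N) = N" using N(1) by auto
  have tH: "topspace (half_space n) = topspace ?E \<times> {0..}" by (rule topspace_half_space)
  have c\<phi>: "continuous_map (subtopology M N) (half_space n) \<phi>" and o\<phi>: "open_map (subtopology M N) (half_space n) \<phi>"
    and c\<psi>: "continuous_map (half_space n) (subtopology M N) \<psi>" and o\<psi>: "open_map (half_space n) (subtopology M N) \<psi>"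
    and \<phi>N: "\<And>x. x \<in> N \<Longrightarrow> \<phi> x \<in> topspace (half_space n)" and \<psi>N: "\<And>q. q \<in> topspace (half_space n) \<Longrightarrow> \<psi> q \<in> N"
    using \<phi> \<psi> tN by (auto simp: homeomorphic_eq_everything_map)
  have oI: "openin M (\<psi> ` Q)" if "openin (half_space n) Q" "\<psi> ` Q \<subseteq> ?I" for Q
  proof -
    have "openin (subtopology M N) (\<psi> ` Q)" using o\<psi> that(1) by (simp add: open_map_def)
    then obtain H where H: "openin M H" "\<psi> ` Q = H \<inter> N" by (auto simp: openin_subtopology)
    then have "\<psi> ` Q = H \<inter> ?I" using that(2) IN by blast
    then show ?thesis using H(1) by auto
  qed
  have oH: "openin (half_space n) (\<phi> ` W)" if "openin M W" "W \<subseteq> N" for W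
  proof -
    have "openin (subtopology M N) W" using that by (metis inf.absorb_iff1 openin_subtopology)
    then show ?thesis using o\<phi> by (simp add: open_map_def)
  qed
  define A where "A = \<phi> ` ?I"
  have Ao: "openin (half_space n) A" unfolding A_def by (rule oH) (use IN in auto)
  have \<psi>A: "\<psi> q \<in> ?I" "q \<in> topspace (half_space n)" if "q \<in> A" for q
    using that \<psi>\<phi> IN \<phi>N by (auto simp: A_def subset_iff)
  obtain z where z: "\<phi> b = (z, 0)" using bd[OF N(2)] b by (metis prod.collapse)
  have "(z,0) \<in> A" using N(2) z unfolding A_def by (metis imageI)
  then obtain U J where UJ: "openin ?E U" "openin (top_of_set {0..}) J" "z \<in> U" "(0::real) \<in> J" "U \<times> J \<subseteq> A"
    using Ao unfolding half_space_def openin_prod_topology_alt by metis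
  obtain J' where J': "open J'" "J = {0..} \<inter> J'" using UJ(2) by (auto simp: openin_open)
  then obtain d where d: "d > 0" "\<And>s. dist s 0 < d \<Longrightarrow> s \<in> J'" using UJ(4) unfolding open_dist by blast
  \<comment> \<open>Half of \<open>d\<close>, so that the closed segments up to height
    \<open>r\<close> stay inside \<open>J\<close>.\<close>
  define r where "r = d / 2"
  have r: "r > 0" "\<And>s. 0 \<le> s \<Longrightarrow> s \<le> r \<Longrightarrow> s \<in> J" using d J'(2) by (auto simp: r_def dist_real_def)
  have "neighbourhood_base_of (compactin ?E) ?E"
    using locally_compact_space_neighbourhood_base[of ?E] locally_compact_Euclidean_space Hausdorff_Euclidean_space by blast
  then obtain W C where W: "openin ?E W" "compactin ?E C" "z \<in> W" "W \<subseteq> C" "C \<subseteq> U"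
    unfolding neighbourhood_base_of using UJ(1,3) by meson
  have CA: "(c, s) \<in> A" if "c \<in> C" "0 \<le> s" "s \<le> r" for c s
    using that W(5) r(2) UJ(5) by blast
  define K where "K = \<psi> ` (C \<times> {0})"
  have KI: "K \<subseteq> ?I" unfolding K_def using \<psi>A(1) CA r(1) by force
  have K\<phi>: "fst (\<phi> x) \<in> C \<and> snd (\<phi> x) = 0" if "x \<in> K" for x
    using that \<phi>\<psi> \<psi>A(2) CA r(1) by (force simp: K_def)
  have KB: "K \<subseteq> ?B" using KI K\<phi> bd by blast
  define k where "k p = \<psi> (fst (\<phi> (fst p)), r * snd p)" for p
  have Kmem: "(fst (\<phi> x), r * t) \<in> A" if "x \<in> K" "t \<in> {0..1}" for x t
    using CA K\<phi> that r(1) by (simp add: mult_left_le)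
  define V where "V = {x \<in> ?I \<inter> ?B. fst (\<phi> x) \<in> W}"
  have "local_collar M ?B K k"
    unfolding local_collar_def
  proof (intro conjI ballI allI impI KB)
    have "compactin (half_space n) (C \<times> {0})"
      using W(2) by (auto simp: half_space_def compactin_Times compactin_subtopology)
    then have "compactin (subtopology M N) K" unfolding K_def by (rule image_compactin[OF _ c\<psi>])
    then show "compactin M K" by (simp add: compactin_subtopology)
    have "K \<subseteq> N" using KI IN by blast
    let ?S = "strip M (K \<times> {0..1})" and ?r = "\<lambda>p. (fst (\<phi> (fst p)), r * snd p)"
    have "continuous_map ?S (subtopology M N) fst"
      unfolding continuous_map_in_subtopology using continuous_map_strip_fst \<open>K \<subseteq> N\<close> by auto
    then have "continuous_map ?S (half_space n) (\<phi> \<circ> fst)" by (rule continuous_map_compose[OF _ c\<phi>])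
    then have c1: "continuous_map ?S ?E (\<lambda>p. fst (\<phi> (fst p)))"
      unfolding half_space_def by (auto simp: o_def dest: continuous_map_fst_of)
    have "continuous_map ?S (top_of_set {0..}) (\<lambda>p. r * snd p)"
      unfolding continuous_map_in_subtopology
      using continuous_map_real_mult_left[OF continuous_map_strip_snd] r(1) by auto
    then have "continuous_map ?S (half_space n) ?r"
      unfolding half_space_def by (intro continuous_map_pairedI c1)
    from continuous_map_compose[OF this c\<psi>]
    have "continuous_map ?S (subtopology M N) k" by (simp add: o_def k_def[abs_def])
    then show "continuous_map ?S M k" by (rule continuous_map_into_fulltopology)
    show "inj_on k (K \<times> {0..1})"
    proof (rule inj_onI)
      fix p q assume pq: "p \<in> K \<times> {0..1}" "q \<in> K \<times> {0..1}" "k p = k q"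
      obtain x t y s where e: "p = (x,t)" "q = (y,s)" by (cases p, cases q) auto
      have m: "x \<in> K" "y \<in> K" "t \<in> {0..1}" "s \<in> {0..1}" using pq e by auto
      have "\<phi> (k p) = (fst (\<phi> x), r * t)" "\<phi> (k q) = (fst (\<phi> y), r * s)"
        using \<phi>\<psi> \<psi>A(2) Kmem m by (auto simp: k_def e)
      then have "fst (\<phi> x) = fst (\<phi> y)" "t = s" using pq(3) r(1) by auto
      then have "\<phi> x = \<phi> y" using K\<phi> m by (simp add: prod_eq_iff)
      then have "x = y" using \<psi>\<phi> m \<open>K \<subseteq> N\<close> by (metis subsetD)
      then show "p = q" using e \<open>t = s\<close> by simp
    qed
    show "k (x, 0) = x" if "x \<in> K" for x
    proof -
      have "(fst (\<phi> x), r * 0) = \<phi> x" using K\<phi>[OF that] by (simp add: prod_eq_iff)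
      then show ?thesis using \<psi>\<phi> that \<open>K \<subseteq> N\<close> by (auto simp: k_def)
    qed
    show "t = 0" if "x \<in> K" "t \<in> {0..1}" "k (x,t) \<in> ?B" for x t
    proof -
      have "k (x,t) \<in> ?I" using \<psi>A(1) Kmem that by (simp add: k_def)
      then have "snd (\<phi> (k (x,t))) = 0" using bd that(3) by blast
      moreover have "\<phi> (k (x,t)) = (fst (\<phi> x), r * t)" using \<phi>\<psi> \<psi>A(2) Kmem that by (simp add: k_def)
      ultimately show ?thesis using r(1) by simp
    qed
    show "openin M (k ` (V \<times> {0..<c}))"
      if V: "openin (subtopology M ?B) V \<and> V \<subseteq> K \<and> 0 < c \<and> c \<le> 1" for V and c :: real
    proof -
      obtain V' where V': "openin M V'" "V = V' \<inter> ?B" using V by (auto simp: openin_subtopology)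
      have A': "openin (half_space n) (\<phi> ` (V' \<inter> ?I))" by (rule oH) (use V' IN in auto)
      \<comment> \<open>The trace of \<open>V\<close> on the bottom of the half-space, open in
        \<open>Euclidean_space (n - 1)\<close>; a cylinder over \<open>V\<close> corresponds to a
        product with base \<open>Z\<close>, with heights scaled by \<open>r\<close>.\<close>
      define Z where "Z = {z \<in> topspace ?E. (z, 0) \<in> \<phi> ` (V' \<inter> ?I)}"
      have "continuous_map ?E (half_space n) (\<lambda>z. (z, 0))"
        unfolding half_space_def by (intro continuous_map_pairedI) auto
      then have Zo: "openin ?E Z" unfolding Z_def by (rule openin_continuous_map_preimage[OF _ A'])
      have ZV: "\<exists>v\<in>V. \<phi> v = (w,0)" if "w \<in> Z" for w
      proof -
        obtain v where v: "v \<in> V'" "v \<in> ?I" "\<phi> v = (w,0)" using \<open>w \<in> Z\<close> unfolding Z_def by (auto simp: image_iff)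
        then have "v \<in> ?B" using bd by simp
        then show ?thesis using v V' by blast
      qed
      have VZ: "fst (\<phi> v) \<in> Z \<and> \<phi> v = (fst (\<phi> v), 0)" if "v \<in> V" for v
      proof -
        have "v \<in> K" "v \<in> V'" using that V V' by auto
        then have "v \<in> ?I" "\<phi> v = (fst (\<phi> v), 0)" using KI K\<phi> by (auto simp: prod_eq_iff)
        moreover from this have "fst (\<phi> v) \<in> topspace ?E" using \<phi>N IN unfolding tH by (metis mem_Times_iff subsetD)
        ultimately show ?thesis using \<open>v \<in> V'\<close> unfolding Z_def by (metis (no_types, lifting) IntI imageI mem_Collect_eq)
      qed
      have eq: "k ` (V \<times> {0..<c}) = \<psi> ` (Z \<times> {0..<r * c})"
      proof (intro equalityI subsetI)
        fix y assume "y \<in> k ` (V \<times> {0..<c})"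
        then obtain v t where v: "v \<in> V" "0 \<le> t" "t < c" "y = \<psi> (fst (\<phi> v), r * t)" by (auto simp: k_def)
        then show "y \<in> \<psi> ` (Z \<times> {0..<r * c})" using VZ r(1) by auto
      next
        fix y assume "y \<in> \<psi> ` (Z \<times> {0..<r * c})"
        then obtain w s where w: "w \<in> Z" "0 \<le> s" "s < r * c" "y = \<psi> (w, s)" by auto
        obtain v where v: "v \<in> V" "\<phi> v = (w,0)" using ZV[OF w(1)] by blast
        have "y = k (v, s / r)" using w v r(1) by (simp add: k_def)
        moreover have "s / r < c" "0 \<le> s / r" using w r(1) by (auto simp: field_simps)
        ultimately show "y \<in> k ` (V \<times> {0..<c})" using v(1) by (intro image_eqI[of _ _ "(v, s / r)"]) auto
      qed
      have ZA: "Z \<times> {0..<r * c} \<subseteq> A"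
      proof
        fix q assume q: "q \<in> Z \<times> {0..<r * c}"
        then have "fst q \<in> Z" by auto
        then obtain v where v: "v \<in> V" "\<phi> v = (fst q,0)" using ZV by blast
        then have "fst q \<in> C" using K\<phi>[of v] V by auto
        moreover have "r * c \<le> r" using V r(1) by (simp add: mult_left_le)
        ultimately show "q \<in> A" using CA[of "fst q" "snd q"] q by auto
      qed
      have "{0..<r * c} = {0..} \<inter> {..<r * c}" by auto
      then have "openin (top_of_set {0..}) {0..<r * c}" by (metis open_lessThan openin_open)
      then have "openin (half_space n) (Z \<times> {0..<r * c})"
        unfolding half_space_def using Zo by (simp add: openin_prod_Times_iff)
      then show ?thesis unfolding eq by (rule oI) (use ZA \<psi>A(1) in blast)
    qed
  qed
  moreover have "openin (subtopology M ?B) V"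
  proof -
    have "continuous_map (subtopology M ?I) (half_space n) \<phi>"
      by (rule continuous_map_from_subtopology_mono[OF c\<phi> IN])
    from continuous_map_fst_of[OF this[unfolded half_space_def]]
    have "continuous_map (subtopology M ?I) ?E (fst \<circ> \<phi>)" .
    from openin_continuous_map_preimage[OF this W(1)]
    have "openin (subtopology M ?I) {x \<in> topspace (subtopology M ?I). (fst \<circ> \<phi>) x \<in> W}" .
    then have "openin M {x \<in> topspace (subtopology M ?I). (fst \<circ> \<phi>) x \<in> W}"
      using openin_open_subtopology[of M ?I] by simp
    moreover have "V = {x \<in> topspace (subtopology M ?I). (fst \<circ> \<phi>) x \<in> W} \<inter> ?B"
      using interior_of_subset_topspace[of M N] by (auto simp: V_def)
    ultimately show ?thesis unfolding openin_subtopology by blast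
  qed
  moreover have "b \<in> V" using b N(2) W(3) z by (simp add: V_def)
  moreover have "V \<subseteq> K"
  proof
    fix x assume x: "x \<in> V"
    then have "\<phi> x = (fst (\<phi> x), 0)" "fst (\<phi> x) \<in> C" "x \<in> N" using bd W(4) IN by (auto simp: V_def prod_eq_iff)
    then show "x \<in> K" unfolding K_def using \<psi>\<phi>[of x] by (intro image_eqI[of _ _ "\<phi> x"]) (auto simp: mem_Times_iff prod_eq_iff)
  qed
  ultimately show "\<exists>K k V. local_collar M ?B K k \<and> openin (subtopology M ?B) V \<and> b \<in> V \<and> V \<subseteq> K"
    by blast
qed

end

section \<open>Shrinking collars and the complement of a collared set\<close>

lemma prod_topology_unit_strip:
  "prod_topology (subtopology X B) (top_of_set {0..1}) = strip X (B \<times> {0..1})"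
  by (simp add: subtopology_Times)

text \<open>The principle is that of \<open>partial_collar_openin_image\<close>: the embedding is
  open onto its image, and the part of that image below level 1 is open in \<open>X\<close>.\<close>

lemma collaring_openin_image:
  assumes h: "collaring X B h" and BX: "B \<subseteq> topspace X"
    and W: "openin (strip X (B \<times> {0..1})) W" "W \<subseteq> B \<times> {0..<1}"
  shows "openin X (h ` W)"
proof -
  have t: "topspace (strip X (B \<times> {0..1})) = B \<times> {0..1}" using BX by auto
  have emb: "embedding_map (strip X (B \<times> {0..1})) X h" and o: "openin X (h ` (B \<times> {0..<1}))"
    using h by (auto simp: collaring_def prod_topology_unit_strip)
  have "open_map (strip X (B \<times> {0..1})) (subtopology X (h ` (B \<times> {0..1}))) h"
    using emb unfolding embedding_map_def t by (rule homeomorphic_imp_open_map)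
  then have "openin (subtopology X (h ` (B \<times> {0..1}))) (h ` W)" using W(1) by (simp add: open_map_def)
  then obtain G where G: "openin X G" "h ` W = G \<inter> h ` (B \<times> {0..1})" by (auto simp: openin_subtopology)
  have "h ` W \<subseteq> h ` (B \<times> {0..<1})" using W(2) by (rule image_mono)
  moreover have "h ` (B \<times> {0..<1}) \<subseteq> h ` (B \<times> {0..1})" by (rule image_mono) auto
  ultimately have "h ` W = G \<inter> h ` (B \<times> {0..<1})" using G(2) by blast
  then show ?thesis using G(1) o by auto
qed

lemma collaring_facts:
  assumes h: "collaring X B h" and BX: "B \<subseteq> topspace X"
  shows "continuous_map (strip X (B \<times> {0..1})) X h" "inj_on h (B \<times> {0..1})"
    "\<And>x. x \<in> B \<Longrightarrow> h (x,0) = x" "\<And>x t. x \<in> B \<Longrightarrow> 0 \<le> t \<Longrightarrow> t \<le> 1 \<Longrightarrow> h (x,t) \<in> B \<Longrightarrow> t = 0"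
    "embedding_map (strip X (B \<times> {0..1})) X h" "openin X (h ` (B \<times> {0..<1}))"
proof -
  have t: "topspace (strip X (B \<times> {0..1})) = B \<times> {0..1}" using BX by auto
  show emb: "embedding_map (strip X (B \<times> {0..1})) X h" "openin X (h ` (B \<times> {0..<1}))"
    using h by (auto simp: collaring_def prod_topology_unit_strip)
  have hm: "homeomorphic_map (strip X (B \<times> {0..1})) (subtopology X (h ` (B \<times> {0..1}))) h"
    using emb(1) unfolding embedding_map_def t .
  show "continuous_map (strip X (B \<times> {0..1})) X h"
    using homeomorphic_imp_continuous_map[OF hm] by (rule continuous_map_into_fulltopology)
  show "inj_on h (B \<times> {0..1})"
    using homeomorphic_imp_injective_map[OF hm] unfolding t .
  show "h (x,0) = x" if "x \<in> B" for x using h that by (auto simp: collaring_def)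
  show "t = 0" if "x \<in> B" "0 \<le> t" "t \<le> 1" "h (x,t) \<in> B" for x t
  proof -
    have "(x,t) \<in> {p \<in> B \<times> {0..1}. h p \<in> B}" using that by simp
    then show ?thesis using h by (auto simp: collaring_def)
  qed
qed

lemma compact_collared_imp_strongly_collared:
  assumes haus: "Hausdorff_space X" and BX: "B \<subseteq> topspace X" and B: "compact_space (subtopology X B)"
    and c: "collared X B"
  shows "strongly_collared X B"
proof -
  obtain h where h: "collaring X B h" using c by (auto simp: collared_def)
  have "compact_space (prod_topology (subtopology X B) (top_of_set {0..1::real}))"
    using B by (simp add: compact_space_prod_topology compact_space_subtopology)
  then have "closed_map (prod_topology (subtopology X B) (top_of_set {0..1})) X h"
    using continuous_imp_closed_map[OF _ _ haus] collaring_facts(1)[OF h BX] by (simp add: prod_topology_unit_strip)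
  then show ?thesis using h by (auto simp: strongly_collared_def)
qed

text \<open>The closure of \<open>V\<close> stays in the open collar. Hence a point off the collar
  of height \<open>f\<close> either lies outside that closure or on the old collar strictly between
  height \<open>f\<close> and level 1, and both sets are open. So the lowered collar has closed
  image, and an embedding with closed image is a closed map.\<close>

lemma collaring_shrink_strong:
  assumes h: "collaring X B h" and B: "closedin X B"
    and f: "continuous_map (subtopology X B) euclideanreal f" and fr: "\<And>x. x \<in> B \<Longrightarrow> 0 < f x \<and> f x \<le> 1/2"
    and V: "openin X V" "X closure_of V \<subseteq> h ` (B \<times> {0..<1})"
    and hV: "\<And>x t. x \<in> B \<Longrightarrow> 0 \<le> t \<Longrightarrow> t \<le> f x \<Longrightarrow> h (x,t) \<in> V"
  shows "strongly_collared X B"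
proof -
  have BX: "B \<subseteq> topspace X" using B closedin_subset by blast
  note hf = collaring_facts[OF h BX]
  let ?P = "strip X (B \<times> {0..1})"
  have t: "topspace ?P = B \<times> {0..1}" using BX by auto
  have cfst: "continuous_map ?P (subtopology X B) fst"
    unfolding continuous_map_in_subtopology using continuous_map_strip_fst t by fastforce
  have cf: "continuous_map ?P euclideanreal (\<lambda>p. f (fst p))"
    using continuous_map_compose[OF cfst f] by (simp add: o_def)
  define \<psi> where "\<psi> p = (fst p, snd p * f (fst p))" for p
  define C where "C = {p \<in> B \<times> {0..1}. snd p \<le> f (fst p)}"
  have CP: "C \<subseteq> B \<times> {0..1}" by (auto simp: C_def)
  have \<psi>C: "\<psi> p \<in> C" if "p \<in> B \<times> {0..1}" for p
  proof -
    obtain x t where p: "p = (x,t)" "x \<in> B" "0 \<le> t" "t \<le> 1" using \<open>p \<in> _\<close> by auto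
    have "t * f x \<le> f x" "0 \<le> t * f x" using fr[OF p(2)] p by (auto intro: mult_left_le_one_le)
    moreover have "t * f x \<le> 1" using calculation(1) fr[OF p(2)] by linarith
    ultimately show ?thesis using p by (simp add: \<psi>_def C_def)
  qed
  have fx0: "f (fst p) \<noteq> 0" if "p \<in> B \<times> {0..1}" for p using fr[of "fst p"] that by force
  have sub: "subtopology ?P C = strip X C" using CP by (simp add: subtopology_subtopology Int_absorb1)
  have tC: "topspace (strip X C) = C" using CP BX by auto
  have "homeomorphic_maps ?P (strip X C) \<psi> (\<lambda>p. (fst p, snd p / f (fst p)))"
    unfolding homeomorphic_maps_def t tC
  proof (intro conjI ballI)
    show "continuous_map ?P (strip X C) \<psi>"
      unfolding continuous_map_in_subtopology
    proof
      show "continuous_map ?P (prod_topology X euclideanreal) \<psi>" unfolding \<psi>_def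
        by (intro continuous_map_pairedI continuous_map_real_mult cf continuous_map_strip_fst continuous_map_strip_snd)
    qed (use \<psi>C t in auto)
    show "continuous_map (strip X C) ?P (\<lambda>p. (fst p, snd p / f (fst p)))"
      unfolding continuous_map_in_subtopology
    proof
      have "continuous_map (strip X C) euclideanreal (\<lambda>p. f (fst p))"
        using continuous_map_from_subtopology[OF cf, of C] sub by simp
      then show "continuous_map (strip X C) (prod_topology X euclideanreal) (\<lambda>p. (fst p, snd p / f (fst p)))"
        using fx0 CP tC
        by (intro continuous_map_pairedI continuous_map_real_divide continuous_map_strip_fst continuous_map_strip_snd) auto
      show "(\<lambda>p. (fst p, snd p / f (fst p))) \<in> topspace (strip X C) \<rightarrow> B \<times> {0..1}"
        unfolding tC C_def using fr by (auto simp: divide_simps)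
    qed
    show "(fst (\<psi> p), snd (\<psi> p) / f (fst (\<psi> p))) = p" if "p \<in> B \<times> {0..1}" for p
      using fx0[OF that] by (simp add: \<psi>_def)
    show "\<psi> (fst p, snd p / f (fst p)) = p" if "p \<in> C" for p
      using fx0[of p] that CP by (auto simp: \<psi>_def)
  qed
  then have hom: "homeomorphic_map ?P (subtopology ?P C) \<psi>" unfolding sub by (rule homeomorphic_maps_imp_map)
  have im\<psi>: "\<psi> ` (B \<times> {0..1}) = C"
    using homeomorphic_imp_surjective_map[OF hom] t tC sub by simp
  have emb: "embedding_map ?P X (h \<circ> \<psi>)"
    by (rule embedding_map_compose[OF _ hf(5)]) (use hom in \<open>simp only: embedding_map_def t im\<psi>\<close>)
  have op1: "openin ?P {p \<in> topspace ?P. f (fst p) - snd p \<in> S}" if "open S" for S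
    by (rule openin_continuous_map_preimage[OF continuous_map_diff[OF cf continuous_map_strip_snd]]) (use that in simp)
  have o1: "openin X (h ` {p \<in> topspace ?P. f (fst p) - snd p \<in> {0<..}})"
    by (rule collaring_openin_image[OF h BX op1]) (use fr t in force)+
  have e1: "\<psi> ` (B \<times> {0..<1}) = {p \<in> topspace ?P. f (fst p) - snd p \<in> {0<..}}"
  proof (intro equalityI subsetI)
    fix q assume "q \<in> \<psi> ` (B \<times> {0..<1})"
    then obtain x s where q: "q = \<psi> (x,s)" "x \<in> B" "0 \<le> s" "s < 1" by auto
    then have "q \<in> C" using \<psi>C by simp
    then show "q \<in> {p \<in> topspace ?P. f (fst p) - snd p \<in> {0<..}}"
      using q fr[OF q(2)] CP t by (auto simp: \<psi>_def)
  next
    fix q assume q: "q \<in> {p \<in> topspace ?P. f (fst p) - snd p \<in> {0<..}}"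
    then have qB: "q \<in> B \<times> {0..1}" "snd q < f (fst q)" using t by auto
    then have "q \<in> C" by (simp add: C_def)
    then obtain p where p: "p \<in> B \<times> {0..1}" "q = \<psi> p" using im\<psi> by blast
    then have "snd p * f (fst p) < f (fst p)" "0 < f (fst p)" using qB(2) fr by (auto simp: \<psi>_def)
    then have "snd p < 1" by simp
    then show "q \<in> \<psi> ` (B \<times> {0..<1})" using p by (intro image_eqI[of _ _ p]) auto
  qed
  have op: "openin X ((h \<circ> \<psi>) ` (B \<times> {0..<1}))"
    unfolding image_comp[symmetric] e1 by (rule o1)
  have "closedin X (h ` C)"
  proof -
    define W where "W = {p \<in> topspace ?P. f (fst p) - snd p \<in> {..<0}} \<inter> {p \<in> topspace ?P. snd p \<in> {..<1}}"
    have "openin ?P {p \<in> topspace ?P. snd p \<in> {..<1}}"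
      by (rule openin_continuous_map_preimage[OF continuous_map_strip_snd]) simp
    then have Wo: "openin ?P W" unfolding W_def using op1[of "{..<0}"] by (intro openin_Int) auto
    have Wmem: "p \<in> W \<longleftrightarrow> p \<in> B \<times> {0..1} \<and> f (fst p) < snd p \<and> snd p < 1" for p
      unfolding W_def t by auto
    have W: "openin X (h ` W)" by (rule collaring_openin_image[OF h BX Wo]) (auto simp: Wmem)
    have WC: "B \<times> {0..<1} \<subseteq> C \<union> W" "W \<inter> C = {}" "W \<subseteq> B \<times> {0..1}"
    proof -
      show "B \<times> {0..<1} \<subseteq> C \<union> W"
      proof
        fix p assume p: "p \<in> B \<times> {0..<1::real}"
        then have "p \<in> B \<times> {0..1}" "snd p < 1" by auto
        then show "p \<in> C \<union> W" by (cases "snd p \<le> f (fst p)") (simp_all add: Wmem C_def)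
      qed
      show "W \<inter> C = {}" using Wmem unfolding C_def by fastforce
      show "W \<subseteq> B \<times> {0..1}" using Wmem by blast
    qed
    have s1: "h ` W \<inter> h ` C = {}" using inj_on_image_Int[OF hf(2) WC(3) CP] WC(2) by simp
    have hCV: "h ` C \<subseteq> V" using hV by (auto simp: C_def)
    have s2: "V \<subseteq> X closure_of V" using closure_of_subset[OF openin_subset[OF V(1)]] .
    have s3: "h ` (B \<times> {0..<1}) \<subseteq> h ` C \<union> h ` W" using image_mono[OF WC(1), of h] by (simp add: image_Un)
    have s4: "h ` W \<subseteq> topspace X" using openin_subset[OF W] .
    have "T - c = (T - cl) \<union> w"
      if "w \<inter> c = {}" "c \<subseteq> v" "v \<subseteq> cl" "r \<subseteq> c \<union> w" "w \<subseteq> T" "cl \<subseteq> r" for T c cl w v r :: "'a set"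
      using that by blast
    from this[OF s1 hCV s2 s3 s4 V(2)]
    have "topspace X - h ` C = (topspace X - X closure_of V) \<union> h ` W" .
    then have "openin X (topspace X - h ` C)" using W by (metis openin_Un openin_diff openin_topspace closedin_closure_of)
    moreover have "h ` C \<subseteq> topspace X" using hCV openin_subset[OF V(1)] by blast
    ultimately show ?thesis by (simp add: closedin_def)
  qed
  then have "closedin X ((h \<circ> \<psi>) ` topspace ?P)" unfolding t by (simp only: image_comp[symmetric] im\<psi>)
  then have cl: "closed_map ?P X (h \<circ> \<psi>)" by (rule embedding_imp_closed_map[OF emb])
  have "{p \<in> B \<times> {0..1}. (h \<circ> \<psi>) p \<in> B} = B \<times> {0}"
  proof (intro equalityI subsetI)
    fix p assume "p \<in> {p \<in> B \<times> {0..1}. (h \<circ> \<psi>) p \<in> B}"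
    then have p: "p \<in> B \<times> {0..1}" "h (\<psi> p) \<in> B" by auto
    then have "\<psi> p \<in> B \<times> {0..1}" using \<psi>C CP by blast
    then have "snd (\<psi> p) = 0" using hf(4)[of "fst (\<psi> p)" "snd (\<psi> p)"] p(2) by auto
    then have "snd p = 0" using fx0[OF p(1)] by (simp add: \<psi>_def)
    then show "p \<in> B \<times> {0}" using p(1) by (metis SigmaE SigmaI insertI1 snd_conv)
  qed (use hf(3) in \<open>auto simp: \<psi>_def\<close>)
  then have "collaring X B (h \<circ> \<psi>)"
    unfolding collaring_def prod_topology_unit_strip using emb op hf(3) by (auto simp: \<psi>_def)
  then show ?thesis unfolding strongly_collared_def prod_topology_unit_strip using cl by blast
qed

section \<open>Positive functions below a step function, and strong collars\<close>

text \<open>This is the Weierstrass M-test on an abstract topological domain; the line is viewed as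
  the metric space \<open>Met_TC\<close> to obtain continuity of the uniform limit.\<close>

lemma continuous_map_suminf:
  fixes f :: "nat \<Rightarrow> 'a \<Rightarrow> real"
  assumes "\<And>i. continuous_map X euclideanreal (f i)" "\<And>i x. x \<in> topspace X \<Longrightarrow> norm (f i x) \<le> a i" "summable a"
  shows "continuous_map X euclideanreal (\<lambda>x. suminf (\<lambda>i. f i x))"
proof -
  have ul: "uniform_limit (topspace X) (\<lambda>n x. \<Sum>i<n. f i x) (\<lambda>x. suminf (\<lambda>i. f i x)) sequentially"
    by (rule Weierstrass_m_test) (use assms in auto)
  have "continuous_map X Met_TC.mtopology (\<lambda>x. suminf (\<lambda>i. f i x))"
  proof (rule Met_TC.continuous_map_uniform_limit_alt)
    show "\<forall>\<^sub>F n in sequentially. continuous_map X Met_TC.mtopology (\<lambda>x. \<Sum>i<n. f i x)"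
      using assms(1) by (auto intro!: always_eventually continuous_map_sum)
    show "\<forall>\<^sub>F n in sequentially. \<forall>x\<in>topspace X. dist (\<Sum>i<n. f i x) (suminf (\<lambda>i. f i x)) < \<epsilon>" if "0 < \<epsilon>" for \<epsilon>
      using ul that unfolding uniform_limit_iff by blast
  qed auto
  then show ?thesis by simp
qed

text \<open>A normal countably metacompact space is countably paracompact; this is the form of that fact
  in which only a positive continuous function below a prescribed step function is needed.\<close>

lemma countably_metacompact_positive_function:
  assumes norm: "normal_space Y" and cm: "countably_metacompact_space Y"
    and U: "\<And>i. openin Y (U i)" "incseq U" "(\<Union>i. U i) = topspace Y"
    and a: "decseq a" "\<And>i. 0 < a i"
  shows "\<exists>f. continuous_map Y euclideanreal f \<and>
    (\<forall>x\<in>topspace Y. 0 < f x \<and> (\<exists>m::nat. x \<in> U m \<and> f x \<le> (a m :: real)))"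
proof -
  have "countable (range U) \<and> (\<forall>W\<in>range U. openin Y W) \<and> \<Union>(range U) = topspace Y" using U by simp
  from cm[unfolded countably_metacompact_space_def, rule_format, OF this]
  obtain \<V> where "(\<forall>V\<in>\<V>. openin Y V \<and> (\<exists>W\<in>range U. V \<subseteq> W)) \<and> \<Union>\<V> = topspace Y \<and>
      (\<forall>x\<in>topspace Y. finite {V\<in>\<V>. x \<in> V})" ..
  then have \<V>: "\<forall>V\<in>\<V>. openin Y V \<and> (\<exists>W\<in>range U. V \<subseteq> W)" "\<Union>\<V> = topspace Y"
      "\<forall>x\<in>topspace Y. finite {V\<in>\<V>. x \<in> V}" by simp_all
  define idx where "idx V = (LEAST j. V \<subseteq> U j)" for V
  have idx: "V \<subseteq> U (idx V)" if "V \<in> \<V>" for V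
  proof -
    have "\<exists>j. V \<subseteq> U j" using \<V>(1) that by blast
    then show ?thesis unfolding idx_def by (rule LeastI_ex)
  qed
  \<comment> \<open>A point is in \<open>D i\<close> when all members of the refinement around it
    have index below \<open>i\<close>. This closed set lies in \<open>U i\<close>, and
    point-finiteness puts every point into some \<open>D i\<close>: the closed shrinking on which
    Urysohn functions can be built.\<close>
  define D where "D i = topspace Y - \<Union>{V\<in>\<V>. i \<le> idx V}" for i
  have Dcl: "closedin Y (D i)" for i unfolding D_def using \<V>(1) by (intro closedin_diff openin_Union) auto
  have DU: "D i \<subseteq> U i" for i
  proof
    fix x assume x: "x \<in> D i"
    then obtain V where V: "V \<in> \<V>" "x \<in> V" using \<V>(2) by (auto simp: D_def)
    then have "idx V \<le> i" using x by (force simp: D_def)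
    then show "x \<in> U i" using idx[OF V(1)] V(2) U(2) by (meson incseqD subsetD)
  qed
  have Dcov: "\<exists>i. x \<in> D i" if x: "x \<in> topspace Y" for x
  proof -
    have "finite (idx ` {V\<in>\<V>. x \<in> V})" using \<V>(3) x by blast
    then obtain N where "\<forall>j\<in>idx ` {V\<in>\<V>. x \<in> V}. j < N" using finite_nat_set_iff_bounded by blast
    then have "x \<in> D N" using x by (auto simp: D_def not_le)
    then show ?thesis ..
  qed
  have "\<exists>g. continuous_map Y (top_of_set {0..1::real}) g \<and> g ` (topspace Y - U i) \<subseteq> {0} \<and> g ` D i \<subseteq> {1}" for i
  proof -
    have "closedin Y (topspace Y - U i) \<and> closedin Y (D i) \<and> disjnt (topspace Y - U i) (D i)"
      using U(1) Dcl DU by (auto simp: disjnt_iff)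
    then show ?thesis using norm[unfolded normal_space_iff_Urysohn] by metis
  qed
  then obtain g where g: "\<And>i. continuous_map Y (top_of_set {0..1::real}) (g i)"
    "\<And>i. g i ` (topspace Y - U i) \<subseteq> {0}" "\<And>i. g i ` D i \<subseteq> {1}" by metis
  have g01: "0 \<le> g i x \<and> g i x \<le> 1" if "x \<in> topspace Y" for i x
    using g(1)[of i] that by (auto simp: continuous_map_in_subtopology)
  have gc: "continuous_map Y euclideanreal (g i)" for i using g(1) by (simp add: continuous_map_in_subtopology)
  \<comment> \<open>The weights \<open>(1/2) ^ Suc i\<close> add up to 1, so if all coefficients
    that matter are at most \<open>a m\<close>, so is the sum.\<close>
  define F where "F i x = (1/2) ^ Suc i * a i * g i x" for i x
  have am: "a i \<le> a 0" for i using a(1) by (simp add: decseqD)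
  have half: "(\<lambda>i. (1/2) ^ Suc i * c) sums c" for c :: real
    using sums_mult2[OF power_half_series, of c] by simp
  have F0: "0 \<le> F i x" if "x \<in> topspace Y" for i x
    unfolding F_def using g01[OF that] a(2)[of i] by (intro mult_nonneg_nonneg) (auto simp: less_imp_le)
  have Fle: "F i x \<le> (1/2) ^ Suc i * a i" if "x \<in> topspace Y" for i x
    unfolding F_def using g01[OF that] a(2)[of i] by (intro mult_left_le) (auto simp: less_imp_le)
  have Fle0: "F i x \<le> (1/2) ^ Suc i * a 0" if "x \<in> topspace Y" for i x
    using Fle[OF that, of i] am[of i] by (meson mult_left_mono order_trans zero_le_power zero_le_divide_1_iff zero_le_numeral)
  have sumF: "summable (\<lambda>i. F i x)" if "x \<in> topspace Y" for x
    by (rule summable_comparison_test'[OF sums_summable[OF half[of "a 0"]], of 0]) (use F0 Fle0 that in auto)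
  have "continuous_map Y euclideanreal (\<lambda>x. suminf (\<lambda>i. F i x))"
  proof (rule continuous_map_suminf[OF _ _ sums_summable[OF half[of "a 0"]]])
    show "continuous_map Y euclideanreal (F i)" for i
      unfolding F_def by (intro continuous_map_real_mult_left gc)
    show "norm (F i x) \<le> (1/2) ^ Suc i * a 0" if "x \<in> topspace Y" for i x
      using F0[OF that] Fle0[OF that] by simp
  qed
  moreover have "0 < (suminf (\<lambda>i. F i x)) \<and> (\<exists>m. x \<in> U m \<and> (suminf (\<lambda>i. F i x)) \<le> a m)" if x: "x \<in> topspace Y" for x
  proof -
    obtain i where i: "x \<in> D i" using Dcov x by blast
    then have gi: "g i x = 1" using g(3)[of i] by auto
    then have Fi: "0 < F i x" using a(2)[of i] by (simp add: F_def)
    \<comment> \<open>Terms before \<open>m\<close> vanish and later ones have coefficient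
      \<open>a j \<le> a m\<close>, which bounds the sum by \<open>a m\<close>; and
      \<open>g m x \<noteq> 0\<close> forces \<open>x\<close> into \<open>U m\<close>.\<close>
    define m where "m = (LEAST i. g i x \<noteq> 0)"
    have m: "g m x \<noteq> 0" unfolding m_def by (rule LeastI[of _ i]) (simp add: gi)
    have less: "g j x = 0" if "j < m" for j using that not_less_Least unfolding m_def by blast
    have "x \<in> U m" using g(2)[of m] m x by auto
    moreover have "(suminf (\<lambda>i. F i x)) \<le> suminf (\<lambda>i. (1/2) ^ Suc i * a m)"
    proof (rule suminf_le[OF _ sumF[OF x] sums_summable[OF half]])
      fix j
      show "F j x \<le> (1/2) ^ Suc j * a m"
      proof (cases "j < m")
        case True
        then show ?thesis using less a(2)[of m] by (simp add: F_def)
      next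
        case False
        then have "a j \<le> a m" using a(1) by (simp add: decseqD)
        then show ?thesis using Fle[OF x, of j] by (meson mult_left_mono order_trans zero_le_power zero_le_divide_1_iff zero_le_numeral)
      qed
    qed
    moreover have "suminf (\<lambda>i. (1/2) ^ Suc i * a m) = a m" using sums_unique[OF half[of "a m"]] by simp
    moreover have "0 < (suminf (\<lambda>i. F i x))" by (rule suminf_pos2[OF sumF[OF x] _ Fi]) (use F0[OF x] in auto)
    ultimately show ?thesis by auto
  qed
  ultimately show ?thesis by blast
qed

proposition normal_countably_metacompact_imp_strongly_collared:
  assumes norm: "normal_space X" and B: "closedin X B" and cm: "countably_metacompact_space (subtopology X B)"
    and c: "collared X B"
  shows "strongly_collared X B"
proof -
  have BX: "B \<subseteq> topspace X" using B closedin_subset by blast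
  obtain h where h: "collaring X B h" using c by (auto simp: collared_def)
  note hf = collaring_facts[OF h BX]
  let ?Y = "subtopology X B"
  have tY: "topspace ?Y = B" using BX by auto
  have "B \<subseteq> h ` (B \<times> {0..<1})"
  proof
    fix x assume "x \<in> B"
    then show "x \<in> h ` (B \<times> {0..<1})" using hf(3) by (intro image_eqI[of _ _ "(x,0)"]) auto
  qed
  then obtain V where V: "openin X V" "B \<subseteq> V" "X closure_of V \<subseteq> h ` (B \<times> {0..<1})"
    using norm[unfolded normal_space_alt] B hf(6) by metis
  \<comment> \<open>The sequence starts at 1/2, the bound that
    \<open>collaring_shrink_strong\<close> puts on the height.\<close>
  define a where "a i = inverse (real (Suc (Suc i)))" for i
  have adec: "decseq a" unfolding decseq_def by (auto simp: a_def intro: le_imp_inverse_le)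
  have a: "0 < a i" "a i \<le> 1/2" for i by (auto simp: a_def divide_simps)
  \<comment> \<open>The union \<open>U i\<close> is the relative interior of the set of base points
    whose fibre up to height \<open>a i\<close> stays in \<open>V\<close>. Openness is then
    immediate, and the sets grow because \<open>a\<close> decreases.\<close>
  define \<W> where "\<W> i = {W. openin ?Y W \<and> (\<forall>x\<in>W. \<forall>t\<in>{0..a i}. h (x,t) \<in> V)}" for i
  define U where "U i = \<Union>(\<W> i)" for i
  have Uo: "openin ?Y (U i)" for i unfolding U_def \<W>_def by blast
  have Uinc: "incseq U"
  proof (rule incseq_SucI)
    fix i
    have "a (Suc i) \<le> a i" using adec by (simp add: decseq_SucD)
    then have "\<W> i \<subseteq> \<W> (Suc i)" unfolding \<W>_def by auto
    then show "U i \<subseteq> U (Suc i)" unfolding U_def by (rule Union_mono)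
  qed
  have Ucov: "(\<Union>i. U i) = topspace ?Y"
  proof
    show "(\<Union>i. U i) \<subseteq> topspace ?Y" using Uo openin_subset by blast
    show "topspace ?Y \<subseteq> (\<Union>i. U i)"
    proof
      fix x assume "x \<in> topspace ?Y"
      then have x: "x \<in> B" using tY by simp
      have "openin (strip X (B \<times> {0..1})) {p \<in> topspace (strip X (B \<times> {0..1})). h p \<in> V}"
        by (rule openin_continuous_map_preimage[OF hf(1) V(1)])
      then obtain G where G: "openin (prod_topology X euclideanreal) G"
        "{p \<in> topspace (strip X (B \<times> {0..1})). h p \<in> V} = G \<inter> (B \<times> {0..1})"
        by (auto simp: openin_subtopology)
      have "(x,0) \<in> {p \<in> topspace (strip X (B \<times> {0..1})). h p \<in> V}" using x BX V(2) hf(3) by auto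
      then have "(x,0) \<in> G" using G(2) by blast
      from openin_prod_topology_alt[THEN iffD1, rule_format, OF G(1) this]
      obtain W I where WI: "openin X W" "open I" "x \<in> W" "0 \<in> I" "W \<times> I \<subseteq> G" by auto
      obtain d where d: "d > 0" "\<And>y::real. dist y 0 < d \<Longrightarrow> y \<in> I" using WI(2,4) unfolding open_dist by blast
      obtain i where i: "inverse (real (Suc i)) < d" using reals_Archimedean[OF d(1)] by blast
      have "a i \<le> inverse (real (Suc i))" by (auto simp: a_def intro: le_imp_inverse_le)
      then have aid: "a i < d" using i by linarith
      have "W \<inter> B \<in> \<W> i"
        unfolding \<W>_def
      proof (intro CollectI conjI ballI)
        show "openin ?Y (W \<inter> B)" using WI(1) by (auto simp: openin_subtopology)
        fix y t assume y: "y \<in> W \<inter> B" and t: "t \<in> {0..a i}"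
        have "t \<in> I" using d(2)[of t] t aid by (auto simp: dist_real_def)
        moreover have "t \<le> 1" using t a(2)[of i] by auto
        ultimately have "(y,t) \<in> G \<inter> (B \<times> {0..1})" using WI(5) y t by auto
        then show "h (y,t) \<in> V" using G(2) by blast
      qed
      then show "x \<in> (\<Union>i. U i)" using WI(3) x unfolding U_def by blast
    qed
  qed
  have "normal_space ?Y" using norm B by (rule normal_space_closed_subtopology)
  from countably_metacompact_positive_function[OF this cm Uo Uinc Ucov adec a(1)]
  obtain f where f: "continuous_map ?Y euclideanreal f" "\<forall>x\<in>B. 0 < f x \<and> (\<exists>m. x \<in> U m \<and> f x \<le> a m)"
    unfolding tY by blast
  show ?thesis
  proof (rule collaring_shrink_strong[OF h B f(1) _ V(1,3)])
    fix x assume x: "x \<in> B"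
    then obtain m where m: "x \<in> U m" "f x \<le> a m" using f(2) by blast
    then show "0 < f x \<and> f x \<le> 1/2" using f(2) x a(2)[of m] by force
    fix t assume "0 \<le> t" "t \<le> f x"
    then have "t \<in> {0..a m}" using m by simp
    then show "h (x,t) \<in> V" using m(1) unfolding U_def \<W>_def by blast
  qed
qed

section \<open>The complement of a collared set\<close>

text \<open>A separation of the complement extends over \<open>B\<close>: a fibre without its ends
  is connected and misses \<open>B\<close>, so it lies on one side, and its base point is assigned
  to that side. The extended sides are open, disjoint and cover \<open>X\<close>, against
  connectedness.\<close>

proposition collared_imp_connected_complement:
  assumes conn: "connected_space X" and B: "closedin X B" and c: "collared X B"
  shows "connected_space (subtopology X (topspace X - B))"
proof (rule ccontr)
  have BX: "B \<subseteq> topspace X" using B closedin_subset by blast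
  obtain h where h: "collaring X B h" using c by (auto simp: collared_def)
  note hf = collaring_facts[OF h BX]
  let ?P = "strip X (B \<times> {0..1})" and ?Z = "subtopology X (topspace X - B)"
  have t: "topspace ?P = B \<times> {0..1}" using BX by auto
  have hX: "h (x,s) \<in> topspace X" if "x \<in> B" "0 \<le> s" "s \<le> 1" for x s
    using continuous_map_image_subset_topspace[OF hf(1)] that t by auto
  have tZ: "topspace ?Z = topspace X - B" by auto
  assume "\<not> connected_space ?Z"
  then obtain E1 E2 where E: "openin ?Z E1" "openin ?Z E2" "topspace X - B \<subseteq> E1 \<union> E2" "E1 \<inter> E2 = {}" "E1 \<noteq> {}" "E2 \<noteq> {}"
    unfolding connected_space_def tZ by blast
  have oZ: "openin X (topspace X - B)" using B by blast
  have Eo: "openin X E1" "openin X E2" using E(1,2) oZ openin_trans_full by blast+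
  have EB: "E1 \<subseteq> topspace X - B" "E2 \<subseteq> topspace X - B" using openin_subset[OF E(1)] openin_subset[OF E(2)] tZ by auto
  \<comment> \<open>The point at height 1/2 decides to which side a fibre belongs; \<open>E'\<close>
    then adds the half-open fibre with its base point.\<close>
  define V where "V S = {x \<in> B. h (x,1/2) \<in> S}" for S
  define E' where "E' S = S \<union> h ` (V S \<times> {0..<1})" for S
  have E'o: "openin X (E' S)" if S: "openin X S" for S
  proof -
    have "continuous_map (subtopology X B) ?P (\<lambda>x. (x, 1/2))"
      unfolding continuous_map_in_subtopology by (auto intro!: continuous_map_pairedI)
    from continuous_map_compose[OF this hf(1)]
    have "continuous_map (subtopology X B) X (\<lambda>x. h (x,1/2))" by (simp add: o_def)
    from openin_continuous_map_preimage[OF this S]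
    have "openin (subtopology X B) {x \<in> topspace (subtopology X B). h (x,1/2) \<in> S}" .
    then have "openin (subtopology X B) (V S)" using BX by (simp add: V_def Int_absorb1)
    then obtain G where G: "openin X G" "V S = G \<inter> B" by (auto simp: openin_subtopology)
    have "openin (prod_topology X euclideanreal) (G \<times> {..<1})" using G by (simp add: openin_prod_Times_iff)
    moreover have "V S \<times> {0..<1::real} = (G \<times> {..<1}) \<inter> (B \<times> {0..1})" using G(2) by auto
    ultimately have "openin ?P (V S \<times> {0..<1})" by (metis openin_subtopology)
    then have "openin X (h ` (V S \<times> {0..<1}))"
      by (rule collaring_openin_image[OF h BX]) (auto simp: V_def)
    then show ?thesis unfolding E'_def using S by blast
  qed
  have half: "h (x,1/2) \<in> topspace X - B" if "x \<in> B" for x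
    using hX[of x "1/2"] hf(4)[of x "1/2"] that by auto
  have seg: "h (x,s) \<in> S" if S: "S = E1 \<or> S = E2" and x: "x \<in> V S" and s: "0 < s" "s < 1" for S x s
  proof -
    have xB: "x \<in> B" using x by (simp add: V_def)
    have "continuous_map (top_of_set {0<..<1}) ?P (\<lambda>t. (x, t))"
      unfolding continuous_map_in_subtopology using xB BX by (auto intro!: continuous_map_pairedI)
    from continuous_map_compose[OF this hf(1)]
    have "continuous_map (top_of_set {0<..<1}) X (\<lambda>t. h (x,t))" by (simp add: o_def)
    moreover have "connectedin (top_of_set {0<..<1::real}) {0<..<1}" by (simp add: connectedin_subtopology)
    ultimately have con: "connectedin X ((\<lambda>t. h (x,t)) ` {0<..<1})" by (rule connectedin_continuous_map_image)
    let ?L = "(\<lambda>t. h (x,t)) ` {0<..<1}"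
    have "?L \<subseteq> E1 \<union> E2"
    proof
      fix y assume "y \<in> ?L"
      then obtain t where t: "y = h (x,t)" "0 < t" "t < 1" by auto
      then have "y \<notin> B" using hf(4)[of x t] xB by auto
      moreover have "y \<in> topspace X" using hX[of x t] xB t by auto
      ultimately show "y \<in> E1 \<union> E2" using E(3) by blast
    qed
    moreover have "E1 \<inter> E2 \<inter> ?L = {}" using E(4) by blast
    ultimately have "E1 \<inter> ?L = {} \<or> E2 \<inter> ?L = {}" using con Eo unfolding connectedin by blast
    moreover have "h (x,1/2) \<in> S \<inter> ?L" using x by (auto simp: V_def)
    moreover have "h (x,s) \<in> ?L" using s by simp
    ultimately show ?thesis using \<open>?L \<subseteq> E1 \<union> E2\<close> S by blast
  qed
  have "E' E1 \<inter> E' E2 = {}"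
  proof -
    have cross: "h ` (V S \<times> {0..<1}) \<inter> T = {}" if ST: "S = E1 \<and> T = E2 \<or> S = E2 \<and> T = E1" for S T
    proof (rule ccontr)
      assume "h ` (V S \<times> {0..<1}) \<inter> T \<noteq> {}"
      then obtain x s where xs: "x \<in> V S" "0 \<le> s" "s < 1" "h (x,s) \<in> T" by auto
      then have "x \<in> B" by (simp add: V_def)
      have "h (x,s) \<notin> B" using ST EB xs(4) by blast
      then have "s \<noteq> 0" using hf(3) \<open>x \<in> B\<close> by auto
      then have "h (x,s) \<in> S" using seg[of S x s] ST xs by auto
      then show False using ST E(4) xs(4) by blast
    qed
    have "h ` (V E1 \<times> {0..<1}) \<inter> h ` (V E2 \<times> {0..<1}) = h ` ((V E1 \<times> {0..<1}) \<inter> (V E2 \<times> {0..<1}))"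
      by (rule inj_on_image_Int[OF hf(2), symmetric]) (auto simp: V_def)
    also have "(V E1 \<times> {0..<1}) \<inter> (V E2 \<times> {0..<1::real}) = {}" using E(4) by (auto simp: V_def)
    finally show ?thesis using cross[of E1 E2] cross[of E2 E1] E(4) unfolding E'_def by blast
  qed
  moreover have "topspace X \<subseteq> E' E1 \<union> E' E2"
  proof
    fix x assume x: "x \<in> topspace X"
    show "x \<in> E' E1 \<union> E' E2"
    proof (cases "x \<in> B")
      case True
      then have "x \<in> V E1 \<or> x \<in> V E2" using half E(3) by (auto simp: V_def)
      moreover have "x \<in> h ` (V S \<times> {0..<1})" if "x \<in> V S" for S
        using that True hf(3) by (intro image_eqI[of _ _ "(x,0)"]) auto
      ultimately show ?thesis unfolding E'_def by blast
    qed (use x E(3) in \<open>auto simp: E'_def\<close>)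
  qed
  moreover have "E' E1 \<noteq> {}" "E' E2 \<noteq> {}" using E(5,6) by (auto simp: E'_def)
  ultimately show False using conn E'o[OF Eo(1)] E'o[OF Eo(2)] unfolding connected_space_def by blast
qed

lemma collared_imp_second_countable:
  assumes BX: "B \<subseteq> topspace X" and c: "collared X B"
    and sc: "second_countable (subtopology X (topspace X - B))"
  shows "second_countable (subtopology X B)"
proof -
  obtain h where h: "collaring X B h" using c by (auto simp: collared_def)
  note hf = collaring_facts[OF h BX]
  let ?P = "strip X (B \<times> {0..1})" and ?Y = "subtopology X B"
  have t: "topspace ?P = B \<times> {0..1}" "topspace ?Y = B" using BX by auto
  have "continuous_map ?Y ?P (\<lambda>x. (x, 1/2))"
    unfolding continuous_map_in_subtopology by (auto intro!: continuous_map_pairedI)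
  moreover have "continuous_map ?P ?Y fst"
    unfolding continuous_map_in_subtopology using continuous_map_strip_fst t by fastforce
  \<comment> \<open>The projection is a left inverse, so the slice at height 1/2 is an embedded copy
    of \<open>B\<close>; being at positive height it avoids \<open>B\<close>.\<close>
  ultimately have "section_map ?Y ?P (\<lambda>x. (x, 1/2))"
    unfolding section_map_def retraction_maps_def by (intro exI[of _ fst]) simp
  then have "embedding_map ?Y X (h \<circ> (\<lambda>x. (x, 1/2)))"
    by (intro embedding_map_compose[OF _ hf(5)] section_imp_embedding_map)
  then have "?Y homeomorphic_space subtopology X ((h \<circ> (\<lambda>x. (x, 1/2))) ` B)"
    using embedding_map_imp_homeomorphic_space t(2) by metis
  moreover have "(h \<circ> (\<lambda>x. (x, 1/2))) ` B \<subseteq> topspace X - B"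
  proof
    fix y assume "y \<in> (h \<circ> (\<lambda>x. (x, 1/2))) ` B"
    then obtain x where "x \<in> B" "y = h (x,1/2)" by auto
    then show "y \<in> topspace X - B"
      using hf(4)[of x "1/2"] continuous_map_image_subset_topspace[OF hf(1)] t(1) by auto
  qed
  then have "subtopology X ((h \<circ> (\<lambda>x. (x, 1/2))) ` B) = subtopology (subtopology X (topspace X - B)) ((h \<circ> (\<lambda>x. (x, 1/2))) ` B)"
    by (simp add: subtopology_subtopology Int_absorb1)
  ultimately show ?thesis
    using homeomorphic_space_second_countability second_countable_subtopology[OF sc] by metis
qed

section \<open>Collars of manifold boundaries\<close>

context
  fixes n :: nat and M :: "'a topology"
  assumes n: "n \<ge> 1" and M: "manifold n M"
begin

lemma regular_manifold: "regular_space M"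
  using locally_compact_manifold[OF n M] Hausdorff_manifold[OF n M]
    locally_compact_Hausdorff_imp_regular_space by blast

lemma metrizable_Lindelof_subspace:
  assumes "Lindelof_space (subtopology M S)"
  shows "metrizable_space (subtopology M S)"
  by (intro second_countable_regular_imp_metrizable regular_space_subtopology Hausdorff_space_subtopology
      regular_manifold Hausdorff_manifold[OF n M] second_countable_Lindelof_subspace[OF n M] assms)

lemma Lindelof_boundary_imp_collared:
  assumes "Lindelof_space (subtopology M (boundary n M))"
  shows "collared M (boundary n M)"
  by (rule Lindelof_locally_collarable_imp_collared[OF Hausdorff_manifold[OF n M] locally_compact_manifold[OF n M]
        closedin_boundary[OF n M] locally_collarable_boundary[OF n M] assms])

lemma collared_imp_second_countable_parts:
  assumes conn: "connected_space M" and met: "metrizable_space (subtopology M (topspace M - boundary n M))"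
    and c: "collared M (boundary n M)"
  shows "second_countable (subtopology M (topspace M - boundary n M))" "second_countable (subtopology M (boundary n M))"
proof -
  let ?I = "topspace M - boundary n M"
  have "openin M ?I" using closedin_boundary[OF n M] by blast
  then have "locally_compact_space (subtopology M ?I)"
    using locally_compact_manifold[OF n M] Hausdorff_manifold[OF n M] locally_compact_space_open_subset by blast
  moreover have "connected_space (subtopology M ?I)"
    by (rule collared_imp_connected_complement[OF conn closedin_boundary[OF n M] c])
  ultimately have "Lindelof_space (subtopology M ?I)"
    using met metrizable_locally_compact_connected_imp_Lindelof by blast
  then show sc: "second_countable (subtopology M ?I)" by (rule second_countable_Lindelof_subspace[OF n M])
  show "second_countable (subtopology M (boundary n M))"
    by (rule collared_imp_second_countable[OF boundary_subset[OF n M] c sc])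
qed

lemma collared_imp_metrizable:
  assumes conn: "connected_space M" and met: "metrizable_space (subtopology M (topspace M - boundary n M))"
    and c: "collared M (boundary n M)"
  shows "metrizable_space M"
proof -
  let ?B = "boundary n M"
  \<comment> \<open>Second countability does not pass to a union of two arbitrary subspaces, but the
    Lindelof property does; local second countability of \<open>M\<close> then restores the
    former.\<close>
  have "Lindelof_space (subtopology M (\<Union>{topspace M - ?B, ?B}))"
    by (rule Lindelof_space_Union)
      (use collared_imp_second_countable_parts[OF conn met c] second_countable_imp_Lindelof_space in auto)
  moreover have "\<Union>{topspace M - ?B, ?B} = topspace M" using boundary_subset[OF n M] by blast
  ultimately show ?thesis using metrizable_Lindelof_subspace[of "topspace M"] by simp
qed

text \<open>Connectedness makes the locally compact metrizable \<open>M\<close> Lindelof, so its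
  closed boundary is Lindelof and collared. Metrizability also gives normality of \<open>M\<close>
  and countable metacompactness of the boundary, which make the collar strong.\<close>

lemma metrizable_imp_strongly_collared_boundary:
  assumes conn: "connected_space M" and met: "metrizable_space M"
  shows "strongly_collared M (boundary n M)"
proof -
  have "Lindelof_space M"
    by (rule metrizable_locally_compact_connected_imp_Lindelof[OF met locally_compact_manifold[OF n M] conn])
  then have "Lindelof_space (subtopology M (boundary n M))"
    by (rule Lindelof_space_closedin_subtopology[OF _ closedin_boundary[OF n M]])
  then have "collared M (boundary n M)" by (rule Lindelof_boundary_imp_collared)
  moreover have "countably_metacompact_space (subtopology M (boundary n M))"
    by (rule metrizable_imp_countably_metacompact[OF metrizable_space_subtopology[OF met]])
  ultimately show ?thesis
    using normal_countably_metacompact_imp_strongly_collared metrizable_imp_normal_space[OF met]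
      closedin_boundary[OF n M] by blast
qed

end

theorem theorem1p2:
  fixes M :: "'a topology" and n :: nat
  assumes "n \<ge> 1"
    and "manifold n M"
    and "connected_space M"
  shows
    "(compact_space (subtopology M (boundary n M)) \<longrightarrow>
        strongly_collared M (boundary n M)) \<and>
     (Lindelof_space (subtopology M (boundary n M)) \<longrightarrow>
        collared M (boundary n M)) \<and>
     (metrizable_space (subtopology M (topspace M - boundary n M)) \<and>
        collared M (boundary n M) \<longrightarrow>
        Lindelof_space (subtopology M (boundary n M))) \<and>
     ((normal_space M \<and> countably_metacompact_space (subtopology M (boundary n M)) \<and>
        collared M (boundary n M) \<longrightarrow>
        strongly_collared M (boundary n M)) \<and>
      (metrizable_space (subtopology M (boundary n M)) \<or>
        Lindelof_space (subtopology M (boundary n M)) \<longrightarrow>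
        countably_metacompact_space (subtopology M (boundary n M)))) \<and>
     (metrizable_space (subtopology M (topspace M - boundary n M)) \<longrightarrow>
        (collared M (boundary n M) \<longleftrightarrow> strongly_collared M (boundary n M)) \<and>
        (strongly_collared M (boundary n M) \<longleftrightarrow> metrizable_space M))"
proof (intro conjI impI)
  let ?B = "boundary n M" and ?I = "topspace M - boundary n M"
  note nM = assms(1,2)
  have strong: "collared M ?B" if "strongly_collared M ?B"
    using that by (auto simp: strongly_collared_def collared_def)
  \<comment> \<open>A compact boundary is Lindelof, hence collared, and a continuous map from a
    compact cylinder to a Hausdorff space is closed.\<close>
  show "strongly_collared M ?B" if "compact_space (subtopology M ?B)"
    using compact_collared_imp_strongly_collared[OF Hausdorff_manifold[OF nM] boundary_subset[OF nM] that]
      Lindelof_boundary_imp_collared[OF nM compact_imp_Lindelof_space[OF that]] by blast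
  show "collared M ?B" if "Lindelof_space (subtopology M ?B)"
    using that by (rule Lindelof_boundary_imp_collared[OF nM])
  show "Lindelof_space (subtopology M ?B)" if "metrizable_space (subtopology M ?I) \<and> collared M ?B"
    using collared_imp_second_countable_parts(2)[OF nM assms(3)] that second_countable_imp_Lindelof_space by blast
  show "strongly_collared M ?B"
    if "normal_space M \<and> countably_metacompact_space (subtopology M ?B) \<and> collared M ?B"
    using that normal_countably_metacompact_imp_strongly_collared closedin_boundary[OF nM] by blast
  \<comment> \<open>The Lindelof case reduces to the metrizable one: a Lindelof subspace of a
    manifold is second countable and regular.\<close>
  show "countably_metacompact_space (subtopology M ?B)"
    if "metrizable_space (subtopology M ?B) \<or> Lindelof_space (subtopology M ?B)"
    using that metrizable_Lindelof_subspace[OF nM] metrizable_imp_countably_metacompact by blast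
  assume met: "metrizable_space (subtopology M ?I)"
  \<comment> \<open>The equivalences close in a cycle: collared gives metrizable, metrizable gives
    strongly collared, and strongly collared gives collared.\<close>
  have "metrizable_space M" if "collared M ?B"
    using collared_imp_metrizable[OF nM assms(3) met that] .
  moreover have "strongly_collared M ?B" if "metrizable_space M"
    using metrizable_imp_strongly_collared_boundary[OF nM assms(3) that] .
  ultimately show "collared M ?B \<longleftrightarrow> strongly_collared M ?B" "strongly_collared M ?B \<longleftrightarrow> metrizable_space M"
    using strong by blast+
qed

end
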